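(* Let $\mathbf H\in\mathbb C^{d\times d}$ be Hermitian with $\operatorname{tr}(\mathbf H)=0$ and $\mathbf H^2=\mathbf I$, let $\mathbf M\in\mathbb C^{d\times d}$ be an arbitrary nonzero Hermitian matrix with $\operatorname{tr}(\mathbf M)=0$, and let $\mathbf W_1,\dots,\mathbf W_p$ be independent Haar-random unitaries in $U(d)$. Consider the random QNN with $\mathbf H_l=\mathbf W_l\mathbf H\mathbf W_l^\dagger$, i.e. $\mathbf U(\boldsymbol\theta)=e^{-i\theta_p\mathbf W_p\mathbf H\mathbf W_p^\dagger}\cdots e^{-i\theta_1\mathbf W_1\mathbf H\mathbf W_1^\dagger}$, with observable $\mathbf M$. Then this QNN is with linear independence with probability at least $1-O(d^{-1})$ for fixed $p$ (as $d\to\infty$), and with probability at least $1-O(e^{-p})$ when the dimension satisfies $\log d=\Theta(p)$.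
   Context: For $l\in[p]$ and Hermitian $\mathbf A$: $\Phi_l^{(0)}(\mathbf A)=\frac12(\mathbf A+\mathbf H_l\mathbf A\mathbf H_l)$, $\Phi_l^{(1)}(\mathbf A)=\frac12(\mathbf A-\mathbf H_l\mathbf A\mathbf H_l)$, $\Phi_l^{(2)}(\mathbf A)=\frac i2[\mathbf H_l,\mathbf A]$, and $\Phi_{\boldsymbol\xi}=\Phi_1^{(\xi_1)}\circ\cdots\circ\Phi_p^{(\xi_p)}$ for $\boldsymbol\xi\in\{0,1,2\}^p$. A QNN with generators $\mathbf H_1,\dots,\mathbf H_p$ and observable $\mathbf M$ is with linear independence if the $3^p-1$ matrices $\{\Phi_{\boldsymbol\xi}(\mathbf M)\}_{\boldsymbol\xi\in\{0,1,2\}^p\setminus\{\mathbf 0\}}$ are linearly independent.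
   Formalization: "log d = Θ(p)" is read with a sufficiently large lower constant: c₁p ≤ log d ≤ c₂p for some c₁>0 and every c₂≥c₁. For arbitrary constants the claim fails, e.g. d=2^⌈p/2⌉, where 3^p−1 exceeds d²−1, the dimension of the traceless Hermitian matrices. *)

theory Defs
  imports "HOL-Probability.Probability" "Jordan_Normal_Form.Matrix"
begin

definition adj :: "complex mat \<Rightarrow> complex mat" where
  "adj A = mat (dim_col A) (dim_row A) (\<lambda>(i,j). cnj (A $$ (j,i)))"

definition tr :: "complex mat \<Rightarrow> complex" where
  "tr A = (\<Sum>i<dim_row A. A $$ (i,i))"

definition hermitian_mat :: "nat \<Rightarrow> complex mat \<Rightarrow> bool" where
  "hermitian_mat d A \<longleftrightarrow> A \<in> carrier_mat d d \<and> adj A = A"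

definition unitary_mat :: "nat \<Rightarrow> complex mat \<Rightarrow> bool" where
  "unitary_mat d U \<longleftrightarrow> U \<in> carrier_mat d d \<and> adj U * U = 1\<^sub>m d \<and> U * adj U = 1\<^sub>m d"

definition Phi :: "complex mat \<Rightarrow> nat \<Rightarrow> complex mat \<Rightarrow> complex mat" where
  "Phi Hl k A =
     (if k = 0 then (1/2 :: complex) \<cdot>\<^sub>m (A + Hl * A * Hl)
      else if k = 1 then (1/2 :: complex) \<cdot>\<^sub>m (A - Hl * A * Hl)
      else (\<i>/2) \<cdot>\<^sub>m (Hl * A - A * Hl))"

fun Phi_xi :: "(nat \<Rightarrow> complex mat) \<Rightarrow> (nat \<Rightarrow> nat) \<Rightarrow> nat \<Rightarrow> complex mat \<Rightarrow> complex mat" where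
  "Phi_xi Hs xi 0 A = A"
| "Phi_xi Hs xi (Suc k) A = Phi_xi Hs xi k (Phi (Hs (Suc k)) (xi (Suc k)) A)"

definition xi_set :: "nat \<Rightarrow> (nat \<Rightarrow> nat) set" where
  "xi_set p = {xi. (\<forall>l. xi l \<in> {0,1,2}) \<and> (\<forall>l. l \<notin> {1..p} \<longrightarrow> xi l = 0) \<and> (\<exists>l. xi l \<noteq> 0)}"

definition qnn_lin_indep :: "nat \<Rightarrow> nat \<Rightarrow> (nat \<Rightarrow> complex mat) \<Rightarrow> complex mat \<Rightarrow> bool" where
  "qnn_lin_indep d p Hs M \<longleftrightarrow>
     (\<forall>c :: (nat \<Rightarrow> nat) \<Rightarrow> real.
        (\<forall>i<d. \<forall>j<d. (\<Sum>xi\<in>xi_set p. complex_of_real (c xi) * Phi_xi Hs xi p M $$ (i,j)) = 0)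
        \<longrightarrow> (\<forall>xi\<in>xi_set p. c xi = 0))"

definition mat_entries :: "nat \<Rightarrow> complex mat \<Rightarrow> (nat \<times> nat \<Rightarrow> complex)" where
  "mat_entries d A = (\<lambda>(i,j). if i < d \<and> j < d then A $$ (i,j) else 0)"

definition mat_space :: "nat \<Rightarrow> complex mat measure" where
  "mat_space d = vimage_algebra (carrier_mat d d) (mat_entries d) borel"

text \<open>Haar measure on U(d): a probability measure on d x d matrices concentrated on the
  unitary group and invariant under left multiplication by unitaries (unique by Haar's theorem).\<close>
definition is_haar :: "nat \<Rightarrow> complex mat measure \<Rightarrow> bool" where
  "is_haar d \<mu> \<longleftrightarrow> prob_space \<mu> \<and> sets \<mu> = sets (mat_space d) \<and> space \<mu> = carrier_mat d d \<and>
     {U \<in> carrier_mat d d. unitary_mat d U} \<in> sets \<mu> \<and>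
     emeasure \<mu> {U \<in> carrier_mat d d. unitary_mat d U} = 1 \<and>
     (\<forall>V. unitary_mat d V \<longrightarrow> distr \<mu> (mat_space d) (\<lambda>W. V * W) = \<mu>)"

definition prob_lin_indep :: "nat \<Rightarrow> complex mat measure \<Rightarrow> nat \<Rightarrow> complex mat \<Rightarrow> complex mat \<Rightarrow> real" where
  "prob_lin_indep d \<mu> p H M =
     measure (PiM {1..p} (\<lambda>_. \<mu>))
       {W \<in> space (PiM {1..p} (\<lambda>_. \<mu>)). qnn_lin_indep d p (\<lambda>l. W l * H * adj (W l)) M}"

end

theory Submission
  imports Defs "Jordan_Normal_Form.Determinant"
begin

text \<open>As soon as \<open>d > 4 * 3 ^ p\<close>, linear independence even holds almost surely; for smaller \<open>d\<close> both
  bounds are void.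

  Dependence means that a Gram determinant vanishes. Along each one-parameter subgroup
  \<open>1 + (z - 1) v v\<^sup>*\<close> (\<open>|z| = 1\<close>, \<open>v\<close> a unit vector) of the unitary group this determinant is a
  Laurent polynomial in \<open>z\<close>, so it vanishes finitely often or identically. By left invariance of the
  Haar measure, almost every dependent tuple therefore stays dependent under every word in finitely
  many such rotations.

  Conversely every tuple of unitaries is moved to an independent one by some word. Treating one
  coordinate at a time, let the word maximize the rank of the blocks \<open>P X P + Q X Q\<close>, \<open>P X Q\<close>,
  \<open>Q X P\<close> of the rotated matrices, where \<open>P\<close>, \<open>Q\<close> are the spectral projections of \<open>H\<close>. Maximality
  forces that, whenever such a block of some \<open>X\<close> in the span vanishes, the same block of every
  commutator \<open>[X, A]\<close> lies in the few-dimensional space of blocks. Rank one matrices \<open>A\<close> then show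
  that \<open>X = 0\<close>, because \<open>tr X = 0\<close> and \<open>P\<close>, \<open>Q\<close> have rank \<open>d/2\<close>.\<close>

section \<open>Linear independence and Gram determinants\<close>

text \<open>The obstacle is that a zero set on the unitary group must be shown null while the
  measure is accessible only through its left invariance. One-parameter subgroups reduce this to one
  complex variable. Words are uncountably many, so null sets cannot be collected word by word; one
  null set is attached to each sequence of coordinates and axes, it serves all angles at once, and
  there are only countably many such sequences.

  The threshold \<open>4 * 3 ^ p\<close> arises thus. Each linear functional imposed on a vector in
  the range of \<open>P\<close> costs one unit of the trace \<open>d / 2\<close>. Comparing the
  eigenvalues of two rows costs twice the number \<open>n\<close> of matrices present, which asks
  for \<open>d > 4 * n\<close>, and \<open>n\<close> triples with every coordinate. Coordinate
  \<open>p\<close> is treated first, because \<open>Phi_xi\<close> applies its map first.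

  Trace zero is essential: the identity commutes with everything and its corner blocks vanish, so a
  multiple of it in the span would produce a dependence that no rotation removes.\<close>

definition fam_indep :: "'i set \<Rightarrow> 'e set \<Rightarrow> ('i \<Rightarrow> 'e \<Rightarrow> complex) \<Rightarrow> bool" where
  "fam_indep I E v \<longleftrightarrow> (\<forall>c. (\<forall>e\<in>E. (\<Sum>i\<in>I. c i * v i e) = 0) \<longrightarrow> (\<forall>i\<in>I. c i = 0))"

lemma fam_indepI:
  "(\<And>c i. \<forall>e\<in>E. (\<Sum>i\<in>I. c i * v i e) = 0 \<Longrightarrow> i \<in> I \<Longrightarrow> c i = 0) \<Longrightarrow> fam_indep I E v"
  by (simp add: fam_indep_def)

lemma fam_indepD:
  "fam_indep I E v \<Longrightarrow> (\<And>e. e \<in> E \<Longrightarrow> (\<Sum>i\<in>I. c i * v i e) = 0) \<Longrightarrow> i \<in> I \<Longrightarrow> c i = 0"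
  by (simp add: fam_indep_def)

lemma fam_indep_cong:
  assumes "\<And>i e. i \<in> I \<Longrightarrow> e \<in> E \<Longrightarrow> v i e = w i e"
  shows "fam_indep I E v \<longleftrightarrow> fam_indep I E w"
proof -
  have "(\<Sum>i\<in>I. c i * v i e) = (\<Sum>i\<in>I. c i * w i e)" if "e \<in> E" for c e
    using assms that by (intro sum.cong) auto
  then show ?thesis by (simp add: fam_indep_def)
qed

lemma fam_indep_mono:
  assumes "fam_indep I E v" "J \<subseteq> I" "finite I"
  shows "fam_indep J E v"
proof (rule fam_indepI)
  fix c i assume c: "\<forall>e\<in>E. (\<Sum>i\<in>J. c i * v i e) = 0" and i: "i \<in> J"
  have "(\<Sum>i\<in>I. (if i \<in> J then c i else 0) * v i e) = (\<Sum>i\<in>J. c i * v i e)" for e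
    using assms by (intro sum.mono_neutral_cong_right) auto
  then show "c i = 0"
    using fam_indepD[OF assms(1), of "\<lambda>i. if i \<in> J then c i else 0" i] c i assms(2) by auto
qed

lemma fam_indep_reindex:
  assumes f: "bij_betw f J I"
  shows "fam_indep I E v \<longleftrightarrow> fam_indep J E (\<lambda>j. v (f j))"
proof
  assume ind: "fam_indep I E v"
  show "fam_indep J E (\<lambda>j. v (f j))"
  proof (rule fam_indepI)
    fix c j assume c: "\<forall>e\<in>E. (\<Sum>j\<in>J. c j * v (f j) e) = 0" and j: "j \<in> J"
    have inv: "inv_into J f (f k) = k" if "k \<in> J" for k
      using f that by (simp add: bij_betw_def)
    have "(\<Sum>i\<in>I. c (inv_into J f i) * v i e) = (\<Sum>j\<in>J. c j * v (f j) e)" for e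
      by (subst sum.reindex_bij_betw[OF f, symmetric]) (simp add: inv)
    then have "c (inv_into J f (f j)) = 0"
      using c j f by (intro fam_indepD[OF ind, where c = "\<lambda>i. c (inv_into J f i)"])
        (auto simp: bij_betw_def)
    then show "c j = 0" using inv j by simp
  qed
next
  assume ind: "fam_indep J E (\<lambda>j. v (f j))"
  show "fam_indep I E v"
  proof (rule fam_indepI)
    fix c i assume c: "\<forall>e\<in>E. (\<Sum>i\<in>I. c i * v i e) = 0" and i: "i \<in> I"
    obtain j where j: "j \<in> J" "i = f j" using f i by (auto simp: bij_betw_def)
    have "(\<Sum>j\<in>J. c (f j) * v (f j) e) = 0" if "e \<in> E" for e
      using c that sum.reindex_bij_betw[OF f, of "\<lambda>i. c i * v i e"] by simp
    then show "c i = 0"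
      using fam_indepD[OF ind, of "\<lambda>j. c (f j)" j] j by simp
  qed
qed

lemma fam_indep_insert:
  assumes ind: "fam_indep J E v" and fin: "finite J" and k: "k \<notin> J"
    and nsp: "\<nexists>c. \<forall>e\<in>E. v k e = (\<Sum>j\<in>J. c j * v j e)"
  shows "fam_indep (insert k J) E v"
proof (rule fam_indepI)
  fix c i assume c: "\<forall>e\<in>E. (\<Sum>i\<in>insert k J. c i * v i e) = 0" and i: "i \<in> insert k J"
  have eq: "c k * v k e + (\<Sum>j\<in>J. c j * v j e) = 0" if "e \<in> E" for e
    using c that fin k by simp
  have ck: "c k = 0"
  proof (rule ccontr)
    assume nz: "c k \<noteq> 0"
    have "v k e = (\<Sum>j\<in>J. (- c j / c k) * v j e)" if "e \<in> E" for e
    proof -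
      have "(\<Sum>j\<in>J. (- c j / c k) * v j e) = - (\<Sum>j\<in>J. c j * v j e) / c k"
        by (simp add: sum_divide_distrib sum_negf)
      also have "\<dots> = v k e"
        using eq[OF that] nz by (simp add: field_simps add_eq_0_iff)
      finally show ?thesis by simp
    qed
    then show False using nsp by (metis (no_types))
  qed
  then have "\<And>e. e \<in> E \<Longrightarrow> (\<Sum>j\<in>J. c j * v j e) = 0" using eq by simp
  then show "c i = 0" using fam_indepD[OF ind] i ck by blast
qed

definition gram :: "nat \<Rightarrow> (nat \<Rightarrow> 'i) \<Rightarrow> 'e set \<Rightarrow> ('i \<Rightarrow> 'e \<Rightarrow> complex) \<Rightarrow> complex mat" where
  "gram n f E v = mat n n (\<lambda>(i,j). \<Sum>e\<in>E. cnj (v (f i) e) * v (f j) e)"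

lemma gram_mult_vec:
  assumes "x \<in> carrier_vec n" "i < n"
  shows "(gram n f E v *\<^sub>v x) $ i = (\<Sum>e\<in>E. cnj (v (f i) e) * (\<Sum>j\<in>{..<n}. x $ j * v (f j) e))"
proof -
  have "(gram n f E v *\<^sub>v x) $ i = (\<Sum>j\<in>{..<n}. (\<Sum>e\<in>E. cnj (v (f i) e) * v (f j) e) * x $ j)"
    using assms by (simp add: gram_def scalar_prod_def atLeast0LessThan)
  also have "\<dots> = (\<Sum>j\<in>{..<n}. \<Sum>e\<in>E. cnj (v (f i) e) * (x $ j * v (f j) e))"
    by (simp add: sum_distrib_left sum_distrib_right mult_ac)
  also have "\<dots> = (\<Sum>e\<in>E. \<Sum>j\<in>{..<n}. cnj (v (f i) e) * (x $ j * v (f j) e))"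
    by (rule sum.swap)
  finally show ?thesis by (simp add: sum_distrib_left)
qed

text \<open>A kernel vector \<open>x\<close> of the Gram matrix makes the combination
  \<open>y\<close> orthogonal to every member of the family, hence to itself, so
  \<open>y = 0\<close>. Independence thereby becomes the nonvanishing of one expression in the
  entries and their conjugates.\<close>

lemma fam_indep_iff_gram:
  assumes f: "bij_betw f {..<n} I" and E: "finite E"
  shows "fam_indep I E v \<longleftrightarrow> det (gram n f E v) \<noteq> 0"
proof -
  have car: "gram n f E v \<in> carrier_mat n n" by (simp add: gram_def)
  have "fam_indep {..<n} E (\<lambda>j. v (f j)) \<longleftrightarrow> det (gram n f E v) \<noteq> 0"
  proof
    assume ind: "fam_indep {..<n} E (\<lambda>j. v (f j))"
    show "det (gram n f E v) \<noteq> 0"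
    proof
      assume "det (gram n f E v) = 0"
      then obtain x where x: "x \<in> carrier_vec n" "x \<noteq> 0\<^sub>v n" "gram n f E v *\<^sub>v x = 0\<^sub>v n"
        using det_0_iff_vec_prod_zero_field[OF car] by blast
      define y where "y e = (\<Sum>j\<in>{..<n}. x $ j * v (f j) e)" for e
      have 0: "(\<Sum>e\<in>E. cnj (v (f i) e) * y e) = 0" if "i < n" for i
        using gram_mult_vec[OF x(1) that, of f E v] that x(3) by (simp add: y_def)
      have "of_real (\<Sum>e\<in>E. (cmod (y e))\<^sup>2) = (\<Sum>e\<in>E. cnj (y e) * y e)"
        by (simp add: complex_norm_square mult.commute del: of_real_power)
      also have "\<dots> = (\<Sum>e\<in>E. \<Sum>i\<in>{..<n}. cnj (x $ i) * (cnj (v (f i) e) * y e))"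
      proof (rule sum.cong)
        fix e
        have "cnj (y e) = (\<Sum>i\<in>{..<n}. cnj (x $ i) * cnj (v (f i) e))" by (simp add: y_def)
        then show "cnj (y e) * y e = (\<Sum>i\<in>{..<n}. cnj (x $ i) * (cnj (v (f i) e) * y e))"
          by (simp add: sum_distrib_right mult.assoc)
      qed simp
      also have "\<dots> = (\<Sum>i\<in>{..<n}. cnj (x $ i) * (\<Sum>e\<in>E. cnj (v (f i) e) * y e))"
        by (subst sum.swap) (simp add: sum_distrib_left)
      also have "\<dots> = 0" using 0 by simp
      finally have "(\<Sum>e\<in>E. (cmod (y e))\<^sup>2) = 0"
        by (simp only: of_real_eq_0_iff)
      then have "\<forall>e\<in>E. y e = 0"
        using E by (simp add: sum_nonneg_eq_0_iff)
      then have "x $ i = 0" if "i < n" for i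
        using fam_indepD[OF ind, of "\<lambda>i. x $ i" i] that by (simp add: y_def)
      then have "x = 0\<^sub>v n" using x(1) by (intro eq_vecI) auto
      then show False using x(2) by simp
    qed
  next
    assume nz: "det (gram n f E v) \<noteq> 0"
    show "fam_indep {..<n} E (\<lambda>j. v (f j))"
    proof (rule fam_indepI)
      fix c i assume c: "\<forall>e\<in>E. (\<Sum>i\<in>{..<n}. c i * v (f i) e) = 0" and i: "i \<in> {..<n}"
      have "gram n f E v *\<^sub>v vec n c = 0\<^sub>v n"
      proof (rule eq_vecI)
        show "dim_vec (gram n f E v *\<^sub>v vec n c) = dim_vec (0\<^sub>v n :: complex vec)"
          by (simp add: gram_def)
        fix k assume "k < dim_vec (0\<^sub>v n :: complex vec)"
        then have k: "k < n" by simp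
        have "(gram n f E v *\<^sub>v vec n c) $ k = 0"
          by (subst gram_mult_vec[OF _ k]) (use c in simp_all)
        then show "(gram n f E v *\<^sub>v vec n c) $ k = 0\<^sub>v n $ k" using k by simp
      qed
      then have "vec n c = 0\<^sub>v n"
        using nz det_0_iff_vec_prod_zero_field[OF car] by (metis vec_carrier)
      then show "c i = 0" using i by (metis index_vec index_zero_vec(1) lessThan_iff)
    qed
  qed
  then show ?thesis using fam_indep_reindex[OF f, of E v] by simp
qed

section \<open>Function algebras closed under conjugation\<close>

locale function_algebra =
  fixes C :: "('a \<Rightarrow> complex) \<Rightarrow> bool"
  assumes const: "C (\<lambda>_. c)"
    and add: "C f \<Longrightarrow> C g \<Longrightarrow> C (\<lambda>x. f x + g x)"
    and mult: "C f \<Longrightarrow> C g \<Longrightarrow> C (\<lambda>x. f x * g x)"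
    and cnj: "C f \<Longrightarrow> C (\<lambda>x. cnj (f x))"
begin

lemma uminus: "C f \<Longrightarrow> C (\<lambda>x. - f x)"
  using mult[OF const[of "- 1"], of f] by simp

lemma diff: "C f \<Longrightarrow> C g \<Longrightarrow> C (\<lambda>x. f x - g x)"
  using add[OF _ uminus, of f g] by simp

lemma sum: "(\<And>i. i \<in> A \<Longrightarrow> C (f i)) \<Longrightarrow> C (\<lambda>x. \<Sum>i\<in>A. f i x)"
  by (induction A rule: infinite_finite_induct) (simp_all add: const add)

lemma prod: "(\<And>i. i \<in> A \<Longrightarrow> C (f i)) \<Longrightarrow> C (\<lambda>x. \<Prod>i\<in>A. f i x)"
  by (induction A rule: infinite_finite_induct) (simp_all add: const mult)

lemma of_real_Re: "C f \<Longrightarrow> C (\<lambda>x. complex_of_real (Re (f x)))"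
  using mult[OF const[of "1/2"] add[OF _ cnj], of f f]
  by (simp add: complex_add_cnj)

lemma of_real_Im: "C f \<Longrightarrow> C (\<lambda>x. complex_of_real (Im (f x)))"
proof -
  assume f: "C f"
  have "complex_of_real (Im (f x)) = - \<i> / 2 * (f x - cnj (f x))" for x
    by (simp add: complex_eq_iff)
  then show ?thesis using mult[OF const[of "- \<i> / 2"] diff[OF f cnj[OF f]]] by simp
qed

lemma det_gram:
  assumes "\<And>i e. i < n \<Longrightarrow> e \<in> E \<Longrightarrow> C (\<lambda>x. v x (f i) e)"
  shows "C (\<lambda>x. det (gram n f E (v x)))"
proof -
  have "det (gram n f E (v x)) = (\<Sum> p \<in> {p. p permutes {0 ..< n}}.
     signof p * (\<Prod> i = 0 ..< n. \<Sum>e\<in>E. cnj (v x (f i) e) * v x (f (p i)) e))" for x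
    by (subst det_def'[of _ n]) (auto simp: gram_def intro!: sum.cong prod.cong)
  moreover have "C (\<lambda>x. \<Sum> p \<in> {p. p permutes {0 ..< n}}.
     signof p * (\<Prod> i = 0 ..< n. \<Sum>e\<in>E. cnj (v x (f i) e) * v x (f (p i)) e))"
    by (intro sum mult const prod cnj assms) (auto simp: permutes_def)
  ultimately show ?thesis by simp
qed

text \<open>Two instances are intended: for Laurent polynomials the zeros of \<open>g\<close> on the
  circle are finite in number or everything, and for measurable functions \<open>g\<close> shows
  that the dependent tuples form a measurable set. Conjugation belongs to the algebra because Gram
  determinants and adjoints contain it.\<close>

lemma fam_indep_witness:
  assumes "finite I" "finite E" "\<And>i e. i \<in> I \<Longrightarrow> e \<in> E \<Longrightarrow> C (\<lambda>x. v x i e)"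
  shows "\<exists>g. C g \<and> (\<forall>x. fam_indep I E (v x) \<longleftrightarrow> g x \<noteq> 0)"
proof -
  obtain f where f: "bij_betw f {..<card I} I"
    using ex_bij_betw_nat_finite[OF assms(1)] by (auto simp: atLeast0LessThan)
  then have "C (\<lambda>x. det (gram (card I) f E (v x)))"
    using assms(3) by (intro det_gram) (auto simp: bij_betw_def)
  then show ?thesis using fam_indep_iff_gram[OF f assms(2)] by blast
qed

text \<open>The dimensions are fixed for every argument \<open>x\<close>, so that an entry of a
  product is the same finite sum of products of entries for all \<open>x\<close>.\<close>

definition cmat :: "nat \<Rightarrow> nat \<Rightarrow> ('a \<Rightarrow> complex mat) \<Rightarrow> bool" where
  "cmat m n F \<longleftrightarrow> (\<forall>x. F x \<in> carrier_mat m n) \<and> (\<forall>i<m. \<forall>j<n. C (\<lambda>x. F x $$ (i,j)))"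

lemma cmatD: "cmat m n F \<Longrightarrow> i < m \<Longrightarrow> j < n \<Longrightarrow> C (\<lambda>x. F x $$ (i,j))"
  by (simp add: cmat_def)

lemma cmat_const: "A \<in> carrier_mat m n \<Longrightarrow> cmat m n (\<lambda>_. A)"
  by (simp add: cmat_def const)

lemma cmat_add:
  assumes "cmat m n F" "cmat m n G"
  shows "cmat m n (\<lambda>x. F x + G x)"
proof -
  have "F x \<in> carrier_mat m n" "G x \<in> carrier_mat m n" for x
    using assms by (auto simp: cmat_def)
  then have "(F x + G x) $$ (i,j) = F x $$ (i,j) + G x $$ (i,j)" if "i < m" "j < n" for x i j
    using that by (metis carrier_matD index_add_mat(1))
  then show ?thesis using assms by (auto simp: cmat_def intro!: add)
qed

lemma cmat_diff:
  assumes "cmat m n F" "cmat m n G"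
  shows "cmat m n (\<lambda>x. F x - G x)"
proof -
  have "F x \<in> carrier_mat m n" "G x \<in> carrier_mat m n" for x
    using assms by (auto simp: cmat_def)
  then have "(F x - G x) $$ (i,j) = F x $$ (i,j) - G x $$ (i,j)" if "i < m" "j < n" for x i j
    using that by (metis carrier_matD index_minus_mat(1))
  then show ?thesis using assms by (auto simp: cmat_def minus_carrier_mat intro!: diff)
qed

lemma cmat_smult:
  assumes "C f" "cmat m n F"
  shows "cmat m n (\<lambda>x. f x \<cdot>\<^sub>m F x)"
proof -
  have "F x \<in> carrier_mat m n" for x
    using assms by (auto simp: cmat_def)
  then have "(f x \<cdot>\<^sub>m F x) $$ (i,j) = f x * F x $$ (i,j)" if "i < m" "j < n" for x i j
    using that by (metis carrier_matD index_smult_mat(1))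
  then show ?thesis using assms by (auto simp: cmat_def intro!: mult)
qed

lemma cmat_mult:
  assumes "cmat m k F" "cmat k n G"
  shows "cmat m n (\<lambda>x. F x * G x)"
proof -
  have car: "F x \<in> carrier_mat m k" "G x \<in> carrier_mat k n" for x
    using assms by (auto simp: cmat_def)
  have "(F x * G x) $$ (i,j) = (\<Sum>l\<in>{..<k}. F x $$ (i,l) * G x $$ (l,j))" if "i < m" "j < n" for x i j
    using that carrier_matD[OF car(1)[of x]] carrier_matD[OF car(2)[of x]]
    by (simp add: scalar_prod_def atLeast0LessThan)
  moreover have "F x * G x \<in> carrier_mat m n" for x
    using car by (rule mult_carrier_mat)
  ultimately show ?thesis using assms by (auto simp: cmat_def intro!: sum mult)
qed

lemma cmat_adj:
  assumes "cmat m n F"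
  shows "cmat n m (\<lambda>x. adj (F x))"
proof -
  have "dim_row (F x) = m \<and> dim_col (F x) = n" for x
    using assms by (auto simp: cmat_def)
  then show ?thesis using assms by (auto simp: cmat_def adj_def intro!: cnj)
qed

lemma cmat_Phi:
  assumes "cmat d d F" "cmat d d K"
  shows "cmat d d (\<lambda>x. Phi (K x) k (F x))"
proof -
  note KF = cmat_mult[OF assms(2,1)] and FK = cmat_mult[OF assms]
  note KFK = cmat_mult[OF KF assms(2)]
  show ?thesis
    unfolding Phi_def
    using cmat_smult[OF const[of "1/2"] cmat_add[OF assms(1) KFK]]
      cmat_smult[OF const[of "1/2"] cmat_diff[OF assms(1) KFK]]
      cmat_smult[OF const[of "\<i>/2"] cmat_diff[OF KF FK]]
    by (cases "k = 0"; cases "k = 1"; simp)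
qed

lemma cmat_Phi_xi:
  assumes "cmat d d F" "\<And>l. l \<in> {1..p} \<Longrightarrow> cmat d d (K l)"
  shows "cmat d d (\<lambda>x. Phi_xi (\<lambda>l. K l x) xi p (F x))"
  using assms by (induction p arbitrary: F) (simp_all add: cmat_Phi)

end

section \<open>Laurent polynomials on the unit circle\<close>

text \<open>The conjugate takes the place of the inverse of \<open>z\<close>. Both agree on the unit
  circle, and the class is then closed under conjugation by its very form.\<close>

inductive laurent :: "(complex \<Rightarrow> complex) \<Rightarrow> bool" where
  laurent_const: "laurent (\<lambda>_. c)"
| laurent_id: "laurent (\<lambda>z. z)"
| laurent_cnj_id: "laurent (\<lambda>z. cnj z)"
| laurent_add: "laurent f \<Longrightarrow> laurent g \<Longrightarrow> laurent (\<lambda>z. f z + g z)"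
| laurent_mult: "laurent f \<Longrightarrow> laurent g \<Longrightarrow> laurent (\<lambda>z. f z * g z)"

lemma laurent_cnj: "laurent f \<Longrightarrow> laurent (\<lambda>z. cnj (f z))"
  by (induction rule: laurent.induct)
    (simp_all add: laurent_const laurent_id laurent_cnj_id laurent_add laurent_mult)

interpretation laurent: function_algebra laurent
  by unfold_locales (fact laurent_const laurent_add laurent_mult laurent_cnj)+

text \<open>A power of \<open>z\<close> clears all conjugates, since \<open>z * cnj z = 1\<close> on
  the circle.\<close>

lemma laurent_poly:
  assumes "laurent f"
  shows "\<exists>m q. \<forall>z. cmod z = 1 \<longrightarrow> z ^ m * f z = poly q z"
  using assms
proof (induction rule: laurent.induct)
  case (laurent_const c)
  show ?case by (rule exI[of _ 0], rule exI[of _ "[:c:]"]) simp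
next
  case laurent_id
  show ?case by (rule exI[of _ 0], rule exI[of _ "[:0,1:]"]) simp
next
  case laurent_cnj_id
  show ?case
    by (rule exI[of _ 1], rule exI[of _ 1]) (simp flip: complex_norm_square)
next
  case (laurent_add f g)
  then obtain m q n r where q: "\<And>z. cmod z = 1 \<Longrightarrow> z ^ m * f z = poly q z"
    and r: "\<And>z. cmod z = 1 \<Longrightarrow> z ^ n * g z = poly r z" by metis
  have "z ^ (m + n) * (f z + g z) = poly (monom 1 n * q + monom 1 m * r) z" if "cmod z = 1" for z
  proof -
    have "z ^ (m + n) * (f z + g z) = z ^ n * (z ^ m * f z) + z ^ m * (z ^ n * g z)"
      by (simp add: power_add distrib_left mult_ac)
    then show ?thesis using q[OF that] r[OF that] by (simp add: poly_monom)
  qed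
  then show ?case by (intro exI[of _ "m + n"] exI[of _ "monom 1 n * q + monom 1 m * r"]) simp
next
  case (laurent_mult f g)
  then obtain m q n r where q: "\<And>z. cmod z = 1 \<Longrightarrow> z ^ m * f z = poly q z"
    and r: "\<And>z. cmod z = 1 \<Longrightarrow> z ^ n * g z = poly r z" by metis
  have "z ^ (m + n) * (f z * g z) = poly (q * r) z" if "cmod z = 1" for z
  proof -
    have "z ^ (m + n) * (f z * g z) = (z ^ m * f z) * (z ^ n * g z)"
      by (simp add: power_add mult_ac)
    then show ?thesis using q[OF that] r[OF that] by simp
  qed
  then show ?case by (intro exI[of _ "m + n"] exI[of _ "q * r"]) simp
qed

text \<open>The dichotomy is carried along instead of the function behind it, because it survives
  arbitrary intersections; these arise when an angle is quantified over the whole circle.\<close>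

definition fin_or_all :: "complex set \<Rightarrow> bool" where
  "fin_or_all Z \<longleftrightarrow> finite (Z \<inter> sphere 0 1) \<or> sphere 0 1 \<subseteq> Z"

lemma laurent_zeros: "laurent f \<Longrightarrow> fin_or_all {z. f z = 0}"
proof -
  assume "laurent f"
  then obtain m q where q: "\<And>z. cmod z = 1 \<Longrightarrow> z ^ m * f z = poly q z"
    using laurent_poly by blast
  show ?thesis
  proof (cases "q = 0")
    case True
    then have "f z = 0" if "cmod z = 1" for z using q[OF that] that by auto
    then show ?thesis by (auto simp: fin_or_all_def)
  next
    case False
    have "{z. f z = 0} \<inter> sphere 0 1 \<subseteq> {z. poly q z = 0}"
    proof
      fix z assume "z \<in> {z. f z = 0} \<inter> sphere 0 1"
      then show "z \<in> {z. poly q z = 0}" using q[of z] by simp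
    qed
    then have "finite ({z. f z = 0} \<inter> sphere 0 1)"
      using poly_roots_finite[OF False] by (rule finite_subset)
    then show ?thesis by (simp add: fin_or_all_def)
  qed
qed

lemma fin_or_all_INT:
  assumes "\<And>i. i \<in> I \<Longrightarrow> fin_or_all (Z i)"
  shows "fin_or_all (\<Inter>i\<in>I. Z i)"
proof (cases "\<exists>i\<in>I. finite (Z i \<inter> sphere 0 1)")
  case True
  then obtain i where "i \<in> I" "finite (Z i \<inter> sphere 0 1)" by blast
  then have "finite ((\<Inter>i\<in>I. Z i) \<inter> sphere 0 1)" by (auto intro: finite_subset[of _ "Z i \<inter> sphere 0 1"])
  then show ?thesis by (simp add: fin_or_all_def)
next
  case False
  then show ?thesis using assms by (auto simp: fin_or_all_def)
qed

lemma laurent_dependent: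
  assumes "finite I" "finite E" "\<And>i e. i \<in> I \<Longrightarrow> e \<in> E \<Longrightarrow> laurent (\<lambda>z. v z i e)"
  shows "fin_or_all {z. \<not> fam_indep I E (v z)}"
proof -
  have "\<exists>g. laurent g \<and> (\<forall>z. fam_indep I E (v z) \<longleftrightarrow> g z \<noteq> 0)"
    by (rule laurent.fam_indep_witness) (use assms in auto)
  then obtain g where g: "laurent g" "\<forall>z. fam_indep I E (v z) \<longleftrightarrow> g z \<noteq> 0"
    by (elim exE conjE)
  then show ?thesis using laurent_zeros[OF g(1)] by simp
qed

lemma infinite_circle: "infinite (sphere 0 1 :: complex set)"
proof
  assume "finite (sphere 0 1 :: complex set)"
  \<comment> \<open>These angles lie between 0 and \<open>pi\<close>, where the cosine is
    injective.\<close>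
  moreover have "inj (\<lambda>n::nat. cis (1 / (real n + 1)))"
  proof (rule injI)
    fix m n :: nat assume eq: "cis (1 / (real m + 1)) = cis (1 / (real n + 1))"
    have "0 \<le> 1 / (real k + 1)" "1 / (real k + 1) \<le> pi" for k
    proof -
      have "1 / (real k + 1) \<le> 1" by simp
      then show "1 / (real k + 1) \<le> pi" using pi_gt3 by linarith
    qed simp
    moreover have "cos (1 / (real m + 1)) = cos (1 / (real n + 1))"
      using arg_cong[OF eq, of Re] by simp
    ultimately have "1 / (real m + 1) = 1 / (real n + 1)" using cos_inj_pi by blast
    then show "m = n" by simp
  qed
  moreover have "range (\<lambda>n::nat. cis (1 / (real n + 1))) \<subseteq> sphere 0 1" by auto
  ultimately show False
    by (metis finite_subset range_inj_infinite)
qed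

section \<open>Idempotent matrices\<close>

text \<open>Equations between dimensions as side conditions, in place of carrier sets, let the ring
  laws act as rewrite rules in which the inner dimensions of a product need not be named.\<close>

lemma mat_assoc:
  "dim_col A = dim_row B \<Longrightarrow> dim_col B = dim_row C \<Longrightarrow> (A * B) * C = A * (B * (C :: complex mat))"
  by (rule assoc_mult_mat[of _ "dim_row A" "dim_row B" _ "dim_row C" _ "dim_col C"]) auto

lemma mat_distribs:
  fixes A B C :: "complex mat"
  shows "dim_row A = dim_row B \<Longrightarrow> dim_col A = dim_col B \<Longrightarrow> dim_col A = dim_row C \<Longrightarrow> (A + B) * C = A * C + B * C"
    and "dim_row A = dim_row B \<Longrightarrow> dim_col A = dim_col B \<Longrightarrow> dim_col A = dim_row C \<Longrightarrow> (A - B) * C = A * C - B * C"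
    and "dim_row B = dim_row C \<Longrightarrow> dim_col B = dim_col C \<Longrightarrow> dim_col A = dim_row B \<Longrightarrow> A * (B + C) = A * B + A * C"
    and "dim_row B = dim_row C \<Longrightarrow> dim_col B = dim_col C \<Longrightarrow> dim_col A = dim_row B \<Longrightarrow> A * (B - C) = A * B - A * C"
  by (rule add_mult_distrib_mat minus_mult_distrib_mat mult_add_distrib_mat mult_minus_distrib_mat;
      (rule carrier_matI)?; simp)+

lemma mat_smults:
  fixes A B :: "complex mat"
  shows "dim_col A = dim_row B \<Longrightarrow> (k \<cdot>\<^sub>m A) * B = k \<cdot>\<^sub>m (A * B)"
    and "dim_col A = dim_row B \<Longrightarrow> A * (k \<cdot>\<^sub>m B) = k \<cdot>\<^sub>m (A * B)"
  by (rule mult_smult_assoc_mat mult_smult_distrib; (rule carrier_matI)?; simp)+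

lemma mat_one:
  fixes A :: "complex mat"
  shows "dim_row A = n \<Longrightarrow> 1\<^sub>m n * A = A" and "dim_col A = n \<Longrightarrow> A * 1\<^sub>m n = A"
  by auto

lemma mat_zero:
  fixes A :: "complex mat"
  shows "dim_row A = n \<Longrightarrow> 0\<^sub>m m n * A = 0\<^sub>m m (dim_col A)"
    and "dim_col A = n \<Longrightarrow> A * 0\<^sub>m n m = 0\<^sub>m (dim_row A) m"
  by auto

lemmas mat_ring = mat_assoc mat_distribs mat_smults mat_one mat_zero

lemma mat_mult_index:
  fixes A B :: "complex mat"
  assumes "A \<in> carrier_mat m k" "B \<in> carrier_mat k n" "i < m" "j < n"
  shows "(A * B) $$ (i,j) = (\<Sum>l\<in>{..<k}. A $$ (i,l) * B $$ (l,j))"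
  using assms by (simp add: scalar_prod_def atLeast0LessThan)

lemma tr_carrier: "A \<in> carrier_mat d n \<Longrightarrow> tr A = (\<Sum>i\<in>{..<d}. A $$ (i,i))"
  by (simp add: tr_def)

lemma tr_add: "A \<in> carrier_mat d d \<Longrightarrow> B \<in> carrier_mat d d \<Longrightarrow> tr (A + B) = tr A + tr B"
  by (simp add: tr_def sum.distrib)

lemma tr_diff: "A \<in> carrier_mat d d \<Longrightarrow> B \<in> carrier_mat d d \<Longrightarrow> tr (A - B) = tr A - tr B"
  by (simp add: tr_def sum_subtractf)

lemma tr_smult: "A \<in> carrier_mat d d \<Longrightarrow> tr (k \<cdot>\<^sub>m A) = k * tr A"
  by (simp add: tr_def sum_distrib_left)

lemma tr_one: "tr (1\<^sub>m d) = of_nat d"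
  by (simp add: tr_def)

lemma tr_mult_commute:
  assumes "A \<in> carrier_mat m n" "B \<in> carrier_mat n m"
  shows "tr (A * B) = tr (B * A)"
proof -
  have "tr (A * B) = (\<Sum>i\<in>{..<m}. \<Sum>j\<in>{..<n}. A $$ (i,j) * B $$ (j,i))"
    using assms by (subst tr_carrier[of _ m m]) (auto simp del: index_mult_mat simp: mat_mult_index[OF assms])
  also have "\<dots> = (\<Sum>j\<in>{..<n}. \<Sum>i\<in>{..<m}. B $$ (j,i) * A $$ (i,j))"
    by (subst sum.swap) (simp add: mult.commute)
  also have "\<dots> = tr (B * A)"
    using assms by (subst tr_carrier[of _ n n]) (auto simp del: index_mult_mat simp: mat_mult_index[OF assms(2,1)])
  finally show ?thesis .
qed

text \<open>Columns and rows are kept as matrices with one column or one row, so that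
  \<open>A * p\<close>, \<open>r * A\<close> and the rank one matrix \<open>p * r\<close> are all
  instances of the same product.\<close>

definition ucol :: "nat \<Rightarrow> nat \<Rightarrow> complex mat" where
  "ucol d a = mat d 1 (\<lambda>(i,_). if i = a then 1 else 0)"

lemma ucol_carrier: "ucol d a \<in> carrier_mat d 1"
  by (simp add: ucol_def)

declare ucol_carrier[simp] ucol_carrier[simplified, simp]

lemma mult_ucol:
  assumes "A \<in> carrier_mat m d" "a < d" "i < m"
  shows "(A * ucol d a) $$ (i,0) = A $$ (i,a)"
proof -
  have "(A * ucol d a) $$ (i,0) = (\<Sum>l\<in>{..<d}. A $$ (i,l) * (if l = a then 1 else 0))"
    using assms by (subst mat_mult_index[OF assms(1) ucol_carrier]) (auto simp: ucol_def)
  then show ?thesis using assms(2) by (simp add: if_distrib cong: if_cong)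
qed

text \<open>Each functional lowers the trace of the idempotent by at most one:
  \<open>P - (P f)(c P) / (c P f)\<close> projects onto the kernel of \<open>c\<close> in the range of \<open>P\<close>.\<close>

lemma idempotent_range_meets_kernels:
  fixes c :: "'i \<Rightarrow> complex mat"
  assumes "finite I" "P \<in> carrier_mat d d" "P * P = P" "Re (tr P) > real (card I)"
    "\<And>i. i \<in> I \<Longrightarrow> c i \<in> carrier_mat 1 d"
  shows "\<exists>p\<in>carrier_mat d 1. p \<noteq> 0\<^sub>m d 1 \<and> P * p = p \<and> (\<forall>i\<in>I. c i * p = 0\<^sub>m 1 1)"
  using assms
proof (induction I arbitrary: P rule: finite_induct)
  case empty
  note [simp] = carrier_matD[OF empty.prems(1)] and PP = empty.prems(2)
  have "\<exists>a<d. P $$ (a,a) \<noteq> 0"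
  proof (rule ccontr)
    assume "\<not> ?thesis"
    then have "tr P = 0" by (simp add: tr_def)
    then show False using empty.prems(3) by simp
  qed
  then obtain a where a: "a < d" "P $$ (a,a) \<noteq> 0" by blast
  have "(P * ucol d a) $$ (a,0) = P $$ (a,a)"
    using mult_ucol[OF empty.prems(1) a(1) a(1)] .
  then have nz: "P * ucol d a \<noteq> 0\<^sub>m d 1" using a by (metis index_zero_mat(1) less_one)
  have "P * (P * ucol d a) = P * ucol d a"
    using PP by (simp add: ucol_def flip: mat_assoc)
  then show ?case using nz mult_carrier_mat[OF empty.prems(1) ucol_carrier] by auto
next
  case (insert i I)
  note P = insert.prems(1) and PP = insert.prems(2)
  have ci: "c i \<in> carrier_mat 1 d" using insert.prems(4) by simp
  note [simp] = carrier_matD[OF P] carrier_matD[OF ci]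
  have PPx: "P * (P * X) = P * X" if "dim_row X = d" for X
    using PP that by (simp flip: mat_assoc)
  define w where "w = c i * P"
  have w: "w \<in> carrier_mat 1 d" using ci P by (simp add: w_def)
  note [simp] = carrier_matD[OF w]
  have wP: "w * P = w" by (simp add: w_def mat_ring PP)
  have wPx: "w * (P * X) = w * X" if "dim_row X = d" for X
    using wP that by (simp flip: mat_assoc)
  have card: "Re (tr P) > real (card I) + 1"
    using insert.prems(3) insert.hyps by simp
  show ?case
  \<comment> \<open>If the new functional vanishes on the range of \<open>P\<close>, then
    \<open>P\<close> itself serves for the remaining ones; otherwise the range is cut down by one
    dimension.\<close>
  proof (cases "w = 0\<^sub>m 1 d")
    case True
    obtain p where p: "p \<in> carrier_mat d 1" "p \<noteq> 0\<^sub>m d 1" "P * p = p" "\<forall>i\<in>I. c i * p = 0\<^sub>m 1 1"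
      using insert.IH[OF P PP] card insert.prems(4) by auto
    note [simp] = carrier_matD[OF p(1)]
    have "c i * p = c i * (P * p)" using p(3) by simp
    also have "\<dots> = w * p" by (simp add: w_def mat_assoc)
    also have "\<dots> = 0\<^sub>m 1 1" using True p(1) by simp
    finally show ?thesis using p by auto
  next
    case False
    then obtain a where a: "a < d" "w $$ (0,a) \<noteq> 0"
      using w by (metis eq_matI carrier_matD index_zero_mat less_one)
    define b where "b = w $$ (0,a)"
    define u where "u = P * ucol d a"
    have u: "u \<in> carrier_mat d 1" using P by (auto simp: u_def)
    note [simp] = carrier_matD[OF u]
    have Pu: "P * u = u" by (simp add: u_def PPx ucol_def)
    have "w * u = w * ucol d a" by (simp add: u_def wPx ucol_def)
    then have wu: "w * u = b \<cdot>\<^sub>m 1\<^sub>m 1"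
      using mult_ucol[OF w a(1), of 0] by (intro eq_matI) (auto simp: b_def ucol_def)
    have b: "b \<noteq> 0" using a b_def by simp
    define R where "R = P - (1 / b) \<cdot>\<^sub>m (u * w)"
    have R: "R \<in> carrier_mat d d" using P u w by (simp add: R_def minus_carrier_mat)
    note [simp] = carrier_matD[OF R]
    have Pux: "P * (u * X) = u * X" if "dim_row X = 1" for X
      using Pu that by (simp flip: mat_assoc)
    have wux: "w * (u * X) = b \<cdot>\<^sub>m X" if "dim_row X = 1" for X
      using wu that by (simp flip: mat_assoc add: mat_smults mat_one)
    have PR: "P * R = R"
      by (simp add: R_def mat_ring PP Pux)
    have wR: "w * R = 0\<^sub>m 1 d"
      using b by (simp add: R_def mat_ring wP wux) (intro eq_matI, auto)
    have "R * R = P * R - (1 / b) \<cdot>\<^sub>m (u * (w * R))"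
      by (subst (1) R_def) (simp add: mat_ring)
    also have "\<dots> = R" unfolding PR wR by (intro eq_matI) auto
    finally have RR: "R * R = R" .
    have "tr (u * w) = tr (w * u)" using tr_mult_commute[OF u w] .
    also have "\<dots> = b" by (simp add: wu tr_smult[of _ 1] tr_one)
    finally have "tr R = tr P - 1"
      using b P u w by (simp add: R_def tr_diff[of _ d] tr_smult[of _ d])
    then have trR: "Re (tr R) > real (card I)" using card by simp
    obtain p where p: "p \<in> carrier_mat d 1" "p \<noteq> 0\<^sub>m d 1" "R * p = p" "\<forall>i\<in>I. c i * p = 0\<^sub>m 1 1"
      using insert.IH[OF R RR trR] insert.prems(4) by auto
    note [simp] = carrier_matD[OF p(1)]
    have "P * p = (P * R) * p" using p(3) by (simp add: mat_assoc)
    then have Pp: "P * p = p" using PR p(3) by simp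
    have "c i * p = w * p" using Pp by (simp add: w_def mat_assoc)
    also have "\<dots> = (w * R) * p" using p(3) by (simp add: mat_assoc)
    also have "\<dots> = 0\<^sub>m 1 1" using p(1) by (simp add: wR)
    finally show ?thesis using p Pp by auto
  qed
qed

text \<open>Linearity in a column is expressed by the values on the standard basis. Expanding these
  values in a spanning family turns the coefficients into rows, that is, into linear functionals of
  \<open>p\<close>.\<close>

definition lin_in :: "nat \<Rightarrow> (complex mat \<Rightarrow> complex mat) \<Rightarrow> bool" where
  "lin_in d T \<longleftrightarrow> (\<forall>p\<in>carrier_mat d 1. T p \<in> carrier_mat d d \<and>
     (\<forall>i<d. \<forall>j<d. T p $$ (i,j) = (\<Sum>a\<in>{..<d}. p $$ (a,0) * T (ucol d a) $$ (i,j))))"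

lemma lin_in_carrier: "lin_in d T \<Longrightarrow> p \<in> carrier_mat d 1 \<Longrightarrow> T p \<in> carrier_mat d d"
  by (simp add: lin_in_def)

lemma lin_in_col:
  assumes r: "r \<in> carrier_mat 1 d"
  shows "lin_in d (\<lambda>p. p * r)"
  unfolding lin_in_def
proof (intro ballI conjI allI impI)
  fix p :: "complex mat" assume p: "p \<in> carrier_mat d 1"
  show "p * r \<in> carrier_mat d d" using p r by simp
  fix i j assume ij: "i < d" "j < d"
  have e: "(ucol d a * r) $$ (i,j) = (if a = i then r $$ (0,j) else 0)" for a
  proof -
    have "(ucol d a * r) $$ (i,j) = ucol d a $$ (i,0) * r $$ (0,j)"
      using mat_mult_index[OF ucol_carrier[of d a] r ij] by simp
    then show ?thesis using ij by (simp add: ucol_def)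
  qed
  have "(\<Sum>a\<in>{..<d}. p $$ (a,0) * (ucol d a * r) $$ (i,j)) = p $$ (i,0) * r $$ (0,j)"
    unfolding e using ij by (simp add: if_distrib cong: if_cong)
  then show "(p * r) $$ (i,j) = (\<Sum>a\<in>{..<d}. p $$ (a,0) * (ucol d a * r) $$ (i,j))"
    using mat_mult_index[OF p r ij] by simp
qed

text \<open>The transpose, and not the adjoint, keeps the dependence on \<open>p\<close> linear
  instead of antilinear.\<close>

lemma lin_in_row:
  assumes r: "r \<in> carrier_mat d 1"
  shows "lin_in d (\<lambda>p. r * transpose_mat p)"
  unfolding lin_in_def
proof (intro ballI conjI allI impI)
  fix p :: "complex mat" assume p: "p \<in> carrier_mat d 1"
  show "r * transpose_mat p \<in> carrier_mat d d" using p r by simp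
  fix i j assume ij: "i < d" "j < d"
  have uc: "transpose_mat (ucol d a) \<in> carrier_mat 1 d" and pc: "transpose_mat p \<in> carrier_mat 1 d" for a
    using p by simp_all
  have e: "(r * transpose_mat (ucol d a)) $$ (i,j) = (if a = j then r $$ (i,0) else 0)" for a
  proof -
    have "(r * transpose_mat (ucol d a)) $$ (i,j) = r $$ (i,0) * ucol d a $$ (j,0)"
      using mat_mult_index[OF r uc[of a] ij] ij by (simp add: ucol_def)
    then show ?thesis using ij by (simp add: ucol_def)
  qed
  have "(\<Sum>a\<in>{..<d}. p $$ (a,0) * (r * transpose_mat (ucol d a)) $$ (i,j)) = p $$ (j,0) * r $$ (i,0)"
    unfolding e using ij by (simp add: if_distrib cong: if_cong)
  then show "(r * transpose_mat p) $$ (i,j) = (\<Sum>a\<in>{..<d}. p $$ (a,0) * (r * transpose_mat (ucol d a)) $$ (i,j))"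
    using mat_mult_index[OF r pc ij] ij p by simp
qed

lemma lin_in_add:
  assumes S: "lin_in d S" and T: "lin_in d T"
  shows "lin_in d (\<lambda>p. S p + T p)"
  unfolding lin_in_def
proof (intro ballI conjI allI impI)
  fix p :: "complex mat" assume p: "p \<in> carrier_mat d 1"
  have c: "S q \<in> carrier_mat d d" "T q \<in> carrier_mat d d" if "q \<in> carrier_mat d 1" for q
    using S T that by (auto simp: lin_in_def)
  show "S p + T p \<in> carrier_mat d d" using c[OF p] by simp
  fix i j assume ij: "i < d" "j < d"
  have ad: "(S q + T q) $$ (i,j) = S q $$ (i,j) + T q $$ (i,j)" if "q \<in> carrier_mat d 1" for q
    using carrier_matD[OF c(2)[OF that]] ij by simp
  show "(S p + T p) $$ (i,j) = (\<Sum>a\<in>{..<d}. p $$ (a,0) * (S (ucol d a) + T (ucol d a)) $$ (i,j))"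
    using S T p ij by (simp add: ad[OF p] ad[OF ucol_carrier] lin_in_def distrib_left sum.distrib)
qed

lemma lin_in_diff:
  assumes S: "lin_in d S" and T: "lin_in d T"
  shows "lin_in d (\<lambda>p. S p - T p)"
  unfolding lin_in_def
proof (intro ballI conjI allI impI)
  fix p :: "complex mat" assume p: "p \<in> carrier_mat d 1"
  have c: "S q \<in> carrier_mat d d" "T q \<in> carrier_mat d d" if "q \<in> carrier_mat d 1" for q
    using S T that by (auto simp: lin_in_def)
  show "S p - T p \<in> carrier_mat d d" using c[OF p] by (simp add: minus_carrier_mat)
  fix i j assume ij: "i < d" "j < d"
  have ad: "(S q - T q) $$ (i,j) = S q $$ (i,j) - T q $$ (i,j)" if "q \<in> carrier_mat d 1" for q
    using carrier_matD[OF c(2)[OF that]] ij by simp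
  show "(S p - T p) $$ (i,j) = (\<Sum>a\<in>{..<d}. p $$ (a,0) * (S (ucol d a) - T (ucol d a)) $$ (i,j))"
    using S T p ij by (simp add: ad[OF p] ad[OF ucol_carrier] lin_in_def right_diff_distrib sum_subtractf)
qed

lemma lin_in_mult_left:
  assumes M: "M \<in> carrier_mat d d" and T: "lin_in d T"
  shows "lin_in d (\<lambda>p. M * T p)"
  unfolding lin_in_def
proof (intro ballI conjI allI impI)
  fix p :: "complex mat" assume p: "p \<in> carrier_mat d 1"
  have c: "T q \<in> carrier_mat d d" if "q \<in> carrier_mat d 1" for q
    using T that by (auto simp: lin_in_def)
  show "M * T p \<in> carrier_mat d d" using M c[OF p] by simp
  fix i j assume ij: "i < d" "j < d"
  have "(M * T p) $$ (i,j) = (\<Sum>l\<in>{..<d}. \<Sum>a\<in>{..<d}. M $$ (i,l) * (p $$ (a,0) * T (ucol d a) $$ (l,j)))"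
    using T p ij by (subst mat_mult_index[OF M c[OF p]]) (auto simp: lin_in_def sum_distrib_left)
  also have "\<dots> = (\<Sum>a\<in>{..<d}. p $$ (a,0) * (\<Sum>l\<in>{..<d}. M $$ (i,l) * T (ucol d a) $$ (l,j)))"
    by (subst sum.swap) (simp add: sum_distrib_left mult_ac)
  finally show "(M * T p) $$ (i,j) = (\<Sum>a\<in>{..<d}. p $$ (a,0) * (M * T (ucol d a)) $$ (i,j))"
    using mat_mult_index[OF M c ij, OF ucol_carrier] by simp
qed

lemma lin_in_mult_right:
  assumes M: "M \<in> carrier_mat d d" and T: "lin_in d T"
  shows "lin_in d (\<lambda>p. T p * M)"
  unfolding lin_in_def
proof (intro ballI conjI allI impI)
  fix p :: "complex mat" assume p: "p \<in> carrier_mat d 1"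
  have c: "T q \<in> carrier_mat d d" if "q \<in> carrier_mat d 1" for q
    using T that by (auto simp: lin_in_def)
  show "T p * M \<in> carrier_mat d d" using M c[OF p] by simp
  fix i j assume ij: "i < d" "j < d"
  have "(T p * M) $$ (i,j) = (\<Sum>l\<in>{..<d}. \<Sum>a\<in>{..<d}. p $$ (a,0) * T (ucol d a) $$ (i,l) * M $$ (l,j))"
    using T p ij by (subst mat_mult_index[OF c[OF p] M]) (auto simp: lin_in_def sum_distrib_right)
  also have "\<dots> = (\<Sum>a\<in>{..<d}. p $$ (a,0) * (\<Sum>l\<in>{..<d}. T (ucol d a) $$ (i,l) * M $$ (l,j)))"
    by (subst sum.swap) (simp add: sum_distrib_left mult_ac)
  finally show "(T p * M) $$ (i,j) = (\<Sum>a\<in>{..<d}. p $$ (a,0) * (T (ucol d a) * M) $$ (i,j))"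
    using mat_mult_index[OF c M ij, OF ucol_carrier] by simp
qed

definition in_mspan :: "nat \<Rightarrow> 'i set \<Rightarrow> ('i \<Rightarrow> complex mat) \<Rightarrow> complex mat \<Rightarrow> bool" where
  "in_mspan d I B D \<longleftrightarrow> (\<exists>y. \<forall>i<d. \<forall>j<d. D $$ (i,j) = (\<Sum>k\<in>I. y k * B k $$ (i,j)))"

text \<open>A linear map into the span of \<open>card I\<close> matrices is given by
  \<open>card I\<close> functionals, so all the maps together by \<open>card K * card I\<close> of
  them. A projection of larger trace has a nonzero vector in its range on which all these
  functionals vanish.\<close>

lemma kernel_in_idempotent_range:
  assumes fin: "finite I" "finite K" and P: "P \<in> carrier_mat d d" "P * P = P"
    and big: "Re (tr P) > real (card K * card I)"
    and lin: "\<And>k. k \<in> K \<Longrightarrow> lin_in d (T k)"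
    and sp: "\<And>k p. k \<in> K \<Longrightarrow> p \<in> carrier_mat d 1 \<Longrightarrow> in_mspan d I B (T k p)"
  shows "\<exists>p\<in>carrier_mat d 1. p \<noteq> 0\<^sub>m d 1 \<and> P * p = p \<and> (\<forall>k\<in>K. T k p = 0\<^sub>m d d)"
proof -
  have "\<exists>y. \<forall>i<d. \<forall>j<d. T k (ucol d a) $$ (i,j) = (\<Sum>l\<in>I. y l * B l $$ (i,j))" if "k \<in> K" for k a
    using sp[OF that ucol_carrier] by (simp add: in_mspan_def)
  then obtain y where y: "\<And>k a i j. k \<in> K \<Longrightarrow> i < d \<Longrightarrow> j < d \<Longrightarrow>
      T k (ucol d a) $$ (i,j) = (\<Sum>l\<in>I. y k a l * B l $$ (i,j))"
    by metis
  \<comment> \<open>The row with index \<open>(k,l)\<close> sends \<open>p\<close> to a coefficient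
    of \<open>B l\<close> in an expansion of \<open>T k p\<close>.\<close>
  define c where "c = (\<lambda>(k,l). mat 1 d (\<lambda>(_,a). y k a l))"
  obtain p where p: "p \<in> carrier_mat d 1" "p \<noteq> 0\<^sub>m d 1" "P * p = p" "\<forall>i\<in>K \<times> I. c i * p = 0\<^sub>m 1 1"
    using idempotent_range_meets_kernels[of "K \<times> I" P d c] fin P big
    by (auto simp: c_def card_cartesian_product)
  have "T k p = 0\<^sub>m d d" if k: "k \<in> K" for k
  proof (rule eq_matI)
    show "dim_row (T k p) = dim_row (0\<^sub>m d d :: complex mat)" "dim_col (T k p) = dim_col (0\<^sub>m d d :: complex mat)"
      using lin_in_carrier[OF lin[OF k] p(1)] by auto
    fix i j assume "i < dim_row (0\<^sub>m d d :: complex mat)" "j < dim_col (0\<^sub>m d d :: complex mat)"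
    then have ij: "i < d" "j < d" by auto
    have c0: "(\<Sum>a\<in>{..<d}. y k a l * p $$ (a,0)) = 0" if "l \<in> I" for l
    proof -
      have "c (k,l) \<in> carrier_mat 1 d" by (simp add: c_def)
      then have "(c (k,l) * p) $$ (0,0) = (\<Sum>a\<in>{..<d}. y k a l * p $$ (a,0))"
        using mat_mult_index[OF _ p(1), of "c (k,l)" 1 0 0] by (simp add: c_def)
      moreover have "(c (k,l) * p) $$ (0,0) = 0" using p(4) k that by simp
      ultimately show ?thesis by simp
    qed
    have "T k p $$ (i,j) = (\<Sum>a\<in>{..<d}. p $$ (a,0) * (\<Sum>l\<in>I. y k a l * B l $$ (i,j)))"
      using lin[OF k] p(1) ij by (simp add: lin_in_def y[OF k])
    also have "\<dots> = (\<Sum>a\<in>{..<d}. \<Sum>l\<in>I. (y k a l * p $$ (a,0)) * B l $$ (i,j))"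
      by (simp add: sum_distrib_left mult_ac)
    also have "\<dots> = (\<Sum>l\<in>I. (\<Sum>a\<in>{..<d}. y k a l * p $$ (a,0)) * B l $$ (i,j))"
      by (subst sum.swap) (simp add: sum_distrib_right)
    also have "\<dots> = 0" using c0 by simp
    finally show "T k p $$ (i,j) = 0\<^sub>m d d $$ (i,j)" using ij by simp
  qed
  then show ?thesis using p by blast
qed

section \<open>Blocks with respect to complementary projections\<close>

definition lincomb :: "nat \<Rightarrow> 'i set \<Rightarrow> ('i \<Rightarrow> complex) \<Rightarrow> ('i \<Rightarrow> complex mat) \<Rightarrow> complex mat" where
  "lincomb d I c B = mat d d (\<lambda>(i,j). \<Sum>k\<in>I. c k * B k $$ (i,j))"

lemma lincomb_carrier[simp]: "lincomb d I c B \<in> carrier_mat d d"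
  by (simp add: lincomb_def)

lemma lincomb_index[simp]: "i < d \<Longrightarrow> j < d \<Longrightarrow> lincomb d I c B $$ (i,j) = (\<Sum>k\<in>I. c k * B k $$ (i,j))"
  by (simp add: lincomb_def)

lemma lincomb_dim[simp]: "dim_row (lincomb d I c B) = d" "dim_col (lincomb d I c B) = d"
  by (simp_all add: lincomb_def)

lemma mult_lincomb:
  assumes A: "A \<in> carrier_mat d d" and B: "\<And>k. k \<in> I \<Longrightarrow> B k \<in> carrier_mat d d"
  shows "A * lincomb d I c B = lincomb d I c (\<lambda>k. A * B k)"
proof (rule eq_matI)
  fix i j assume "i < dim_row (lincomb d I c (\<lambda>k. A * B k))" "j < dim_col (lincomb d I c (\<lambda>k. A * B k))"
  then have ij: "i < d" "j < d" by auto
  have "(A * lincomb d I c B) $$ (i,j) = (\<Sum>l\<in>{..<d}. \<Sum>k\<in>I. c k * (A $$ (i,l) * B k $$ (l,j)))"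
    using ij by (subst mat_mult_index[OF A lincomb_carrier]) (auto simp: sum_distrib_left mult_ac)
  also have "\<dots> = (\<Sum>k\<in>I. c k * (\<Sum>l\<in>{..<d}. A $$ (i,l) * B k $$ (l,j)))"
    by (subst sum.swap) (simp add: sum_distrib_left)
  also have "\<dots> = (\<Sum>k\<in>I. c k * (A * B k) $$ (i,j))"
    by (intro sum.cong refl) (simp only: mat_mult_index[OF A B ij])
  finally show "(A * lincomb d I c B) $$ (i,j) = lincomb d I c (\<lambda>k. A * B k) $$ (i,j)"
    using ij by simp
qed (use A in auto)

lemma lincomb_mult:
  assumes A: "A \<in> carrier_mat d d" and B: "\<And>k. k \<in> I \<Longrightarrow> B k \<in> carrier_mat d d"
  shows "lincomb d I c B * A = lincomb d I c (\<lambda>k. B k * A)"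
proof (rule eq_matI)
  fix i j assume "i < dim_row (lincomb d I c (\<lambda>k. B k * A))" "j < dim_col (lincomb d I c (\<lambda>k. B k * A))"
  then have ij: "i < d" "j < d" by auto
  have "(lincomb d I c B * A) $$ (i,j) = (\<Sum>l\<in>{..<d}. \<Sum>k\<in>I. c k * (B k $$ (i,l) * A $$ (l,j)))"
    using ij by (subst mat_mult_index[OF lincomb_carrier A]) (auto simp: sum_distrib_right sum_distrib_left mult_ac)
  also have "\<dots> = (\<Sum>k\<in>I. c k * (\<Sum>l\<in>{..<d}. B k $$ (i,l) * A $$ (l,j)))"
    by (subst sum.swap) (simp add: sum_distrib_left)
  also have "\<dots> = (\<Sum>k\<in>I. c k * (B k * A) $$ (i,j))"
    by (intro sum.cong refl) (simp only: mat_mult_index[OF B A ij])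
  finally show "(lincomb d I c B * A) $$ (i,j) = lincomb d I c (\<lambda>k. B k * A) $$ (i,j)"
    using ij by simp
qed (use A in auto)

lemma lincomb_add:
  assumes "\<And>k. k \<in> I \<Longrightarrow> A k \<in> carrier_mat d d" "\<And>k. k \<in> I \<Longrightarrow> B k \<in> carrier_mat d d"
  shows "lincomb d I c A + lincomb d I c B = lincomb d I c (\<lambda>k. A k + B k)"
proof (rule eq_matI)
  fix i j assume "i < dim_row (lincomb d I c (\<lambda>k. A k + B k))" "j < dim_col (lincomb d I c (\<lambda>k. A k + B k))"
  then have ij: "i < d" "j < d" by auto
  have "(A k + B k) $$ (i,j) = A k $$ (i,j) + B k $$ (i,j)" if "k \<in> I" for k
    using carrier_matD[OF assms(2)[OF that]] ij by simp
  then show "(lincomb d I c A + lincomb d I c B) $$ (i,j) = lincomb d I c (\<lambda>k. A k + B k) $$ (i,j)"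
    using ij by (simp add: distrib_left sum.distrib)
qed auto

lemma lincomb_cong:
  "(\<And>k. k \<in> I \<Longrightarrow> c k = c' k) \<Longrightarrow> (\<And>k. k \<in> I \<Longrightarrow> B k = B' k) \<Longrightarrow> lincomb d I c B = lincomb d I c' B'"
  by (simp add: lincomb_def)

lemma tr_lincomb:
  assumes "\<And>k. k \<in> I \<Longrightarrow> B k \<in> carrier_mat d d" "\<And>k. k \<in> I \<Longrightarrow> tr (B k) = 0"
  shows "tr (lincomb d I c B) = 0"
proof -
  have "tr (lincomb d I c B) = (\<Sum>k\<in>I. c k * (\<Sum>i\<in>{..<d}. B k $$ (i,i)))"
    by (simp add: tr_def sum.swap[of _ I] sum_distrib_left)
  also have "\<dots> = (\<Sum>k\<in>I. c k * tr (B k))"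
    using assms(1) by (intro sum.cong refl) (simp add: tr_carrier[of _ d d])
  finally show ?thesis using assms(2) by simp
qed

lemma tr_transpose: "A \<in> carrier_mat d d \<Longrightarrow> tr (transpose_mat A) = tr A"
  by (simp add: tr_def)

text \<open>The two diagonal blocks form a single component because \<open>Phi H 0 X\<close> only
  shows them together. The corners stay separate, since \<open>Phi H 1 X\<close> and
  \<open>Phi H 2 X\<close> determine both of them.\<close>

definition block :: "complex mat \<Rightarrow> complex mat \<Rightarrow> nat \<Rightarrow> complex mat \<Rightarrow> complex mat" where
  "block P Q s X = (if s = 0 then P * X * P + Q * X * Q else if s = 1 then P * X * Q else Q * X * P)"

lemma block_swap:
  assumes "P \<in> carrier_mat d d" "Q \<in> carrier_mat d d" "X \<in> carrier_mat d d"
  shows "block Q P 0 X = block P Q 0 X" "block Q P 1 X = block P Q 2 X" "block Q P 2 X = block P Q 1 X"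
  using assms by (auto simp: block_def intro!: comm_add_mat[of _ d d])

definition complementary :: "nat \<Rightarrow> complex mat \<Rightarrow> complex mat \<Rightarrow> bool" where
  "complementary d P Q \<longleftrightarrow> P \<in> carrier_mat d d \<and> Q \<in> carrier_mat d d \<and> P * P = P \<and> Q * Q = Q \<and>
     P * Q = 0\<^sub>m d d \<and> Q * P = 0\<^sub>m d d \<and> P + Q = 1\<^sub>m d"

lemma complementary_swap: "complementary d P Q \<Longrightarrow> complementary d Q P"
  by (auto simp: complementary_def comm_add_mat[of Q d d P])

lemma complementaryD:
  assumes "complementary d P Q"
  shows "P \<in> carrier_mat d d" "Q \<in> carrier_mat d d" "dim_row P = d" "dim_col P = d" "dim_row Q = d" "dim_col Q = d"
    "P * P = P" "Q * Q = Q" "P * Q = 0\<^sub>m d d" "Q * P = 0\<^sub>m d d" "P + Q = 1\<^sub>m d"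
    "\<And>X. dim_row X = d \<Longrightarrow> P * (P * X) = P * X" "\<And>X. dim_row X = d \<Longrightarrow> Q * (Q * X) = Q * X"
    "\<And>X. dim_row X = d \<Longrightarrow> P * (Q * X) = 0\<^sub>m d (dim_col X)"
    "\<And>X. dim_row X = d \<Longrightarrow> Q * (P * X) = 0\<^sub>m d (dim_col X)"
  using assms by (auto simp: complementary_def mat_zero simp flip: mat_assoc)

lemma outer_eq_0:
  fixes p r :: "complex mat"
  assumes p: "p \<in> carrier_mat d 1" and r: "r \<in> carrier_mat 1 d" and eq: "p * r = 0\<^sub>m d d"
  shows "p = 0\<^sub>m d 1 \<or> r = 0\<^sub>m 1 d"
proof (rule ccontr)
  assume n: "\<not> ?thesis"
  have "\<exists>i<d. p $$ (i,0) \<noteq> 0"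
  proof (rule ccontr)
    assume "\<not> ?thesis"
    then have "p = 0\<^sub>m d 1" using p by (intro eq_matI) auto
    then show False using n by simp
  qed
  moreover have "\<exists>j<d. r $$ (0,j) \<noteq> 0"
  proof (rule ccontr)
    assume "\<not> ?thesis"
    then have "r = 0\<^sub>m 1 d" using r by (intro eq_matI) auto
    then show False using n by simp
  qed
  ultimately obtain i j where ij: "i < d" "j < d" "p $$ (i,0) \<noteq> 0" "r $$ (0,j) \<noteq> 0" by blast
  have "(p * r) $$ (i,j) = p $$ (i,0) * r $$ (0,j)"
    using mat_mult_index[OF p r ij(1,2)] by simp
  then show False using eq ij by simp
qed

definition urow :: "nat \<Rightarrow> nat \<Rightarrow> complex mat" where
  "urow d a = mat 1 d (\<lambda>(_,j). if j = a then 1 else 0)"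

lemma urow_carrier: "urow d a \<in> carrier_mat 1 d"
  by (simp add: urow_def)

lemma urow_dim[simp]: "dim_row (urow d a) = 1" "dim_col (urow d a) = d"
  by (simp_all add: urow_def)

lemma urow_mult:
  assumes "A \<in> carrier_mat d m" "a < d" "j < m"
  shows "(urow d a * A) $$ (0,j) = A $$ (a,j)"
proof -
  have "(urow d a * A) $$ (0,j) = (\<Sum>l\<in>{..<d}. (if l = a then 1 else 0) * A $$ (l,j))"
    using assms by (subst mat_mult_index[OF urow_carrier assms(1)]) (auto simp: urow_def)
  then show ?thesis using assms(2) by (simp add: if_distrib[of "\<lambda>x. x * _"] cong: if_cong)
qed

lemma eq_mat_urowI:
  assumes A: "A \<in> carrier_mat d m" and B: "B \<in> carrier_mat d m"
    and eq: "\<And>a. a < d \<Longrightarrow> urow d a * A = urow d a * B"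
  shows "A = B"
proof (rule eq_matI)
  fix i j assume "i < dim_row B" "j < dim_col B"
  then have ij: "i < d" "j < m" using B by auto
  show "A $$ (i,j) = B $$ (i,j)"
    using urow_mult[OF A ij] urow_mult[OF B ij] eq[OF ij(1)] by simp
qed (use A B in auto)

lemma eq_mat_ucolI:
  assumes A: "A \<in> carrier_mat m d" and B: "B \<in> carrier_mat m d"
    and eq: "\<And>a. a < d \<Longrightarrow> A * ucol d a = B * ucol d a"
  shows "A = B"
proof (rule eq_matI)
  fix i j assume "i < dim_row B" "j < dim_col B"
  then have ij: "i < m" "j < d" using B by auto
  show "A $$ (i,j) = B $$ (i,j)"
    using mult_ucol[OF A ij(2,1)] mult_ucol[OF B ij(2,1)] eq[OF ij(2)] by simp
qed (use A B in auto)

section \<open>Commutators with rank one matrices\<close>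

definition comm :: "complex mat \<Rightarrow> complex mat \<Rightarrow> complex mat" where
  "comm X A = X * A - A * X"

lemma comm_carrier: "X \<in> carrier_mat d d \<Longrightarrow> A \<in> carrier_mat d d \<Longrightarrow> comm X A \<in> carrier_mat d d"
  by (simp add: comm_def minus_carrier_mat)

lemma lin_in_block_comm:
  assumes "P \<in> carrier_mat d d" "Q \<in> carrier_mat d d" "X \<in> carrier_mat d d" and T: "lin_in d T"
  shows "lin_in d (\<lambda>p. block P Q s (comm X (T p)))"
proof -
  have c: "lin_in d (\<lambda>p. comm X (T p))"
    unfolding comm_def by (intro lin_in_diff lin_in_mult_left lin_in_mult_right assms)
  have m: "lin_in d (\<lambda>p. R * comm X (T p) * S)" if "R \<in> carrier_mat d d" "S \<in> carrier_mat d d" for R S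
    by (intro lin_in_mult_left lin_in_mult_right that c)
  show ?thesis
    unfolding block_def using lin_in_add[OF m m] m assms
    by (cases "s = 0"; cases "s = 1"; simp)
qed

text \<open>Test matrices \<open>p * r\<close> with \<open>P * p = p\<close> and
  \<open>r * Q = r\<close> isolate the corner. In the diagonal block cut out by \<open>P\<close>,
  the summand \<open>X * p * r\<close> of the commutator dies because \<open>r * P = 0\<close>, and
  only \<open>- p * (r * (X * P))\<close> remains. For fixed \<open>r\<close> the blocks range over
  a space of dimension at most \<open>card I\<close>, so some nonzero \<open>p\<close> in the range
  of \<open>P\<close> is sent to 0; then \<open>r * (X * P) = 0\<close>.\<close>

lemma corner_eq_0:
  assumes PQ: "complementary d P Q" and X: "X \<in> carrier_mat d d" and I: "finite I"
    and big: "Re (tr P) > real (card I)"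
    and tan: "\<And>A. A \<in> carrier_mat d d \<Longrightarrow> in_mspan d I B (block P Q 0 (comm X A))"
  shows "Q * X * P = 0\<^sub>m d d"
proof -
  note [simp] = complementaryD(3-)[OF PQ] carrier_matD[OF X]
  note P = complementaryD(1)[OF PQ] and Q = complementaryD(2)[OF PQ]
  have row: "r * (X * P) = 0\<^sub>m 1 d" if r: "r \<in> carrier_mat 1 d" and rQ: "r * Q = r" for r
  proof -
    note [simp] = carrier_matD[OF r]
    have rP: "r * P = 0\<^sub>m 1 d"
    proof -
      have "r * P = (r * Q) * P" by (simp only: rQ)
      also have "\<dots> = 0\<^sub>m 1 d" by (simp add: mat_ring)
      finally show ?thesis .
    qed
    obtain p where p: "p \<in> carrier_mat d 1" "p \<noteq> 0\<^sub>m d 1" "P * p = p"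
        and 0: "block P Q 0 (comm X (p * r)) = 0\<^sub>m d d"
      using kernel_in_idempotent_range[of I "{()}" P d "\<lambda>_ p. block P Q 0 (comm X (p * r))" B]
        I P big lin_in_block_comm[OF P Q X lin_in_col[OF r], of 0] tan r by auto
    note [simp] = carrier_matD[OF p(1)]
    have px: "P * (p * Y) = p * Y" if "dim_row Y = 1" for Y
      using p(3) that by (simp flip: mat_assoc)
    \<comment> \<open>Left multiplication by \<open>P\<close> discards the diagonal block cut out by
      \<open>Q\<close>.\<close>
    have "P * block P Q 0 (comm X (p * r)) = P * (X * (p * (r * P))) - p * (r * (X * P))"
      using p r P Q by (simp add: block_def comm_def mat_ring px) (intro eq_matI, auto)
    then have "0\<^sub>m d d = 0\<^sub>m d d - p * (r * (X * P))"
      using 0 by (simp add: mat_ring rP)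
    moreover have "Y = 0\<^sub>m d d" if "0\<^sub>m d d = 0\<^sub>m d d - Y" "Y \<in> carrier_mat d d" for Y :: "complex mat"
    proof (rule eq_matI)
      fix i j assume ij: "i < dim_row (0\<^sub>m d d :: complex mat)" "j < dim_col (0\<^sub>m d d :: complex mat)"
      have "(0\<^sub>m d d :: complex mat) $$ (i,j) = (0\<^sub>m d d - Y) $$ (i,j)" using that(1) by simp
      then show "Y $$ (i,j) = 0\<^sub>m d d $$ (i,j)" using ij that(2) by simp
    qed (use that in auto)
    ultimately have "p * (r * (X * P)) = 0\<^sub>m d d"
      using p(1) r X P by (meson mult_carrier_mat)
    moreover have "r * (X * P) \<in> carrier_mat 1 d"
      by (rule mult_carrier_mat[OF r mult_carrier_mat[OF X P]])
    ultimately show ?thesis using outer_eq_0[OF p(1)] p(2) by blast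
  qed
  show ?thesis
  proof (rule eq_mat_urowI[where d = d and m = d])
    fix a assume "a < d"
    have "urow d a * (Q * X * P) = (urow d a * Q) * (X * P)" by (simp add: mat_ring)
    also have "\<dots> = 0\<^sub>m 1 d"
      by (rule row[OF mult_carrier_mat[OF urow_carrier Q]]) (simp add: mat_ring)
    also have "\<dots> = urow d a * 0\<^sub>m d d" by (simp add: mat_ring)
    finally show "urow d a * (Q * X * P) = urow d a * 0\<^sub>m d d" .
  qed (use P Q X in auto)
qed

text \<open>The factor \<open>l\<close> is read off from a nonzero entry of \<open>p\<close> and the
  matching entry of \<open>s\<close>. It does not depend on \<open>r\<close> and \<open>t\<close>,
  and this uniformity makes the eigenvalues of different rows agree.\<close>

lemma outer_prop:
  fixes p s :: "complex mat"
  assumes p: "p \<in> carrier_mat d 1" and pnz: "p \<noteq> 0\<^sub>m d 1"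
    and s: "s \<in> carrier_mat d 1"
  shows "\<exists>l. \<forall>r\<in>carrier_mat 1 d. \<forall>t\<in>carrier_mat 1 d. s * r = p * t \<longrightarrow> t = l \<cdot>\<^sub>m r"
proof -
  have "\<exists>i<d. p $$ (i,0) \<noteq> 0"
  proof (rule ccontr)
    assume "\<not> ?thesis"
    then have "p = 0\<^sub>m d 1" using p by (intro eq_matI) auto
    then show False using pnz by simp
  qed
  then obtain i where i: "i < d" "p $$ (i,0) \<noteq> 0" by blast
  have "t = (s $$ (i,0) / p $$ (i,0)) \<cdot>\<^sub>m r"
    if r: "r \<in> carrier_mat 1 d" and t: "t \<in> carrier_mat 1 d" and eq: "s * r = p * t" for r t
  proof (rule eq_matI)
    fix a j assume "a < dim_row ((s $$ (i,0) / p $$ (i,0)) \<cdot>\<^sub>m r)" "j < dim_col ((s $$ (i,0) / p $$ (i,0)) \<cdot>\<^sub>m r)"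
    then have j: "a = 0" "j < d" using r by auto
    have "s $$ (i,0) * r $$ (0,j) = p $$ (i,0) * t $$ (0,j)"
      using mat_mult_index[OF s r i(1) j(2)] mat_mult_index[OF p t i(1) j(2)] eq by simp
    then show "t $$ (a,j) = ((s $$ (i,0) / p $$ (i,0)) \<cdot>\<^sub>m r) $$ (a,j)"
      using j r i(2) by (simp add: field_simps)
  qed (use r t in auto)
  then show ?thesis by blast
qed

text \<open>If the corner of the commutator with \<open>p * r\<close> vanishes, then
  \<open>P * (X * p) * r = p * (r * (X * Q))\<close>. So \<open>p\<close> is an eigenvector of one
  diagonal block and \<open>r\<close> a left eigenvector of the other, with the same eigenvalue.
  Every row fixed by \<open>Q\<close> can be matched with some \<open>p\<close> in this way, and
  every column fixed by \<open>P\<close> with some \<open>r\<close>; a map for which all vectors are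
  eigenvectors is a scalar.\<close>

lemma diagonal_scalar:
  assumes PQ: "complementary d P Q" and X: "X \<in> carrier_mat d d" and I: "finite I"
    and bigP: "Re (tr P) > 2 * real (card I)" and bigQ: "Re (tr Q) > 2 * real (card I)"
    and X0: "P * X * Q = 0\<^sub>m d d"
    and tan: "\<And>A. A \<in> carrier_mat d d \<Longrightarrow> in_mspan d I B (block P Q 1 (comm X A))"
  shows "\<exists>l. P * X * P = l \<cdot>\<^sub>m P \<and> Q * X * Q = l \<cdot>\<^sub>m Q"
proof -
  note [simp] = complementaryD(3-)[OF PQ] carrier_matD[OF X]
  note P = complementaryD(1)[OF PQ] and Q = complementaryD(2)[OF PQ]
  have blk: "block P Q 1 (comm X (p * r)) = P * (X * p) * r - p * (r * (X * Q))"
    if p: "p \<in> carrier_mat d 1" "P * p = p" and r: "r \<in> carrier_mat 1 d" "r * Q = r" for p r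
  proof -
    note [simp] = carrier_matD[OF p(1)] carrier_matD[OF r(1)]
    have px: "P * (p * Y) = p * Y" if "dim_row Y = 1" for Y
      using p(2) that by (simp flip: mat_assoc)
    show ?thesis by (simp add: block_def comm_def mat_ring px r(2))
  qed
  have blk0: "P * (X * p) * r = p * (r * (X * Q))"
    if p: "p \<in> carrier_mat d 1" "P * p = p" and r: "r \<in> carrier_mat 1 d" "r * Q = r"
      and 0: "block P Q 1 (comm X (p * r)) = 0\<^sub>m d d" for p r
  proof (rule eq_matI)
    note [simp] = carrier_matD[OF p(1)] carrier_matD[OF r(1)]
    fix i j assume "i < dim_row (p * (r * (X * Q)))" "j < dim_col (p * (r * (X * Q)))"
    then have ij: "i < d" "j < d" by auto
    have "(P * (X * p) * r - p * (r * (X * Q))) $$ (i,j) = (0\<^sub>m d d :: complex mat) $$ (i,j)"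
      using blk[OF p r] 0 by simp
    then show "(P * (X * p) * r) $$ (i,j) = (p * (r * (X * Q))) $$ (i,j)"
      using ij by (simp del: index_mult_mat(1))
  qed (use p r in auto)
  have "\<exists>a<d. Q $$ (a,a) \<noteq> 0"
  proof (rule ccontr)
    assume "\<not> ?thesis"
    then have "tr Q = 0" by (simp add: tr_def)
    then show False using bigQ by simp
  qed
  then obtain a where a: "a < d" "Q $$ (a,a) \<noteq> 0" by blast
  \<comment> \<open>A nonzero reference row: each other row is compared with it, which fixes the
    common eigenvalue \<open>l\<close>.\<close>
  define r0 where "r0 = urow d a * Q"
  have r0: "r0 \<in> carrier_mat 1 d" "r0 * Q = r0" "r0 \<noteq> 0\<^sub>m 1 d"
  proof -
    show "r0 \<in> carrier_mat 1 d" unfolding r0_def by (rule mult_carrier_mat[OF urow_carrier Q])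
    show "r0 * Q = r0" by (simp add: r0_def mat_ring)
    have "r0 $$ (0,a) \<noteq> 0" using urow_mult[OF Q a(1) a(1)] a(2) by (simp add: r0_def)
    then show "r0 \<noteq> 0\<^sub>m 1 d" using a(1) by auto
  qed
  \<comment> \<open>Killing two rows at once with the same column \<open>p\<close> makes the eigenvalue independent of the row.\<close>
  have two: "\<exists>l. r0 * (X * Q) = l \<cdot>\<^sub>m r0 \<and> r * (X * Q) = l \<cdot>\<^sub>m r"
    if r: "r \<in> carrier_mat 1 d" "r * Q = r" for r
  proof -
    let ?r = "\<lambda>b. if b then r0 else r"
    have rb: "?r b \<in> carrier_mat 1 d" for b using r r0 by simp
    have "real (card (UNIV :: bool set) * card I) < Re (tr P)" using bigP by simp
    then obtain p where p: "p \<in> carrier_mat d 1" "p \<noteq> 0\<^sub>m d 1" "P * p = p"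
        and 0: "\<And>b. block P Q 1 (comm X (p * ?r b)) = 0\<^sub>m d d"
      using kernel_in_idempotent_range[of I UNIV P d "\<lambda>b p. block P Q 1 (comm X (p * ?r b))" B]
        I P lin_in_block_comm[OF P Q X lin_in_col[OF rb], of 1] tan mult_carrier_mat[OF _ rb] by auto
    have "P * (X * p) \<in> carrier_mat d 1" using P X p by simp
    from outer_prop[OF p(1,2) this] obtain l where l: "\<And>r t. r \<in> carrier_mat 1 d \<Longrightarrow> t \<in> carrier_mat 1 d \<Longrightarrow>
        P * (X * p) * r = p * t \<Longrightarrow> t = l \<cdot>\<^sub>m r" by blast
    have "r0 * (X * Q) = l \<cdot>\<^sub>m r0"
      by (rule l[OF r0(1) _ blk0[OF p(1,3) r0(1,2)]]) (use r0 X Q 0[of True] in auto)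
    moreover have "r * (X * Q) = l \<cdot>\<^sub>m r"
      by (rule l[OF r(1) _ blk0[OF p(1,3) r]]) (use r X Q 0[of False] in auto)
    ultimately show ?thesis by blast
  qed
  obtain l where l0: "r0 * (X * Q) = l \<cdot>\<^sub>m r0" using two[OF r0(1,2)] by blast
  have l: "r * (X * Q) = l \<cdot>\<^sub>m r" if r: "r \<in> carrier_mat 1 d" "r * Q = r" for r
  proof -
    obtain m where m: "r0 * (X * Q) = m \<cdot>\<^sub>m r0" "r * (X * Q) = m \<cdot>\<^sub>m r" using two[OF r] by blast
    have "\<exists>j<d. r0 $$ (0,j) \<noteq> 0"
    proof (rule ccontr)
      assume "\<not> ?thesis"
      then have "r0 = 0\<^sub>m 1 d" using r0(1) by (intro eq_matI) auto
      then show False using r0(3) by simp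
    qed
    then obtain j where j: "j < d" "r0 $$ (0,j) \<noteq> 0" by blast
    have "(l \<cdot>\<^sub>m r0) $$ (0,j) = (m \<cdot>\<^sub>m r0) $$ (0,j)" using l0 m(1) by simp
    then have "l = m" using j r0(1) by simp
    then show ?thesis using m(2) by simp
  qed
  have "Q * X * Q = l \<cdot>\<^sub>m Q"
  proof (rule eq_mat_urowI[where d = d and m = d])
    fix b assume "b < d"
    have "urow d b * (Q * X * Q) = (urow d b * Q) * (X * Q)" by (simp add: mat_ring)
    also have "\<dots> = l \<cdot>\<^sub>m (urow d b * Q)"
      by (rule l[OF mult_carrier_mat[OF urow_carrier Q]]) (simp add: mat_ring)
    finally show "urow d b * (Q * X * Q) = urow d b * (l \<cdot>\<^sub>m Q)" by (simp add: mat_ring)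
  qed (use Q X in auto)
  moreover have col: "P * (X * p) = l \<cdot>\<^sub>m p" if p: "p \<in> carrier_mat d 1" "P * p = p" for p
  proof -
    note [simp] = carrier_matD[OF p(1)]
    \<comment> \<open>The roles are now exchanged: for a given column \<open>p\<close> a row is
      sought. It is found as the transpose of a column in the range of
      \<open>transpose_mat Q\<close>, a projection with the trace of \<open>Q\<close>.\<close>
    have trQ: "tr (transpose_mat Q) = tr Q" by (rule tr_transpose[OF Q])
    have QT: "transpose_mat Q * transpose_mat Q = transpose_mat Q"
      using transpose_mult[OF Q Q] by simp
    have "real (card {()} * card I) < Re (tr (transpose_mat Q))" using bigQ trQ by simp
    then obtain q where q: "q \<in> carrier_mat d 1" "q \<noteq> 0\<^sub>m d 1" "transpose_mat Q * q = q"
        and 0: "block P Q 1 (comm X (p * transpose_mat q)) = 0\<^sub>m d d"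
      using kernel_in_idempotent_range[of I "{()}" "transpose_mat Q" d "\<lambda>_ q. block P Q 1 (comm X (p * transpose_mat q))" B]
        I Q QT lin_in_block_comm[OF P Q X lin_in_row[OF p(1)], of 1] tan p(1) by auto
    define r where "r = transpose_mat q"
    have r: "r \<in> carrier_mat 1 d" using q by (simp add: r_def)
    note [simp] = carrier_matD[OF r]
    have rQ: "r * Q = r"
    proof -
      have "r * Q = transpose_mat (transpose_mat Q * q)"
        using transpose_mult[of "transpose_mat Q" d d q 1] Q q by (simp add: r_def)
      then show ?thesis using q(3) by (simp add: r_def)
    qed
    have rnz: "r \<noteq> 0\<^sub>m 1 d"
    proof
      assume "r = 0\<^sub>m 1 d"
      then have "transpose_mat r = 0\<^sub>m d 1" by (auto intro!: eq_matI)
      then show False using q(2) by (simp add: r_def)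
    qed
    have "P * (X * p) * r = p * (r * (X * Q))"
      using blk0[OF p r rQ] 0 by (simp add: r_def)
    also have "\<dots> = (l \<cdot>\<^sub>m p) * r" by (simp add: l[OF r rQ] mat_ring)
    finally have e: "P * (X * p) * r = (l \<cdot>\<^sub>m p) * r" .
    have Xp: "P * (X * p) \<in> carrier_mat d 1" and lp: "l \<cdot>\<^sub>m p \<in> carrier_mat d 1"
      by (rule mult_carrier_mat[OF P mult_carrier_mat[OF X p(1)]]) (use p(1) in simp)
    have D: "P * (X * p) - l \<cdot>\<^sub>m p \<in> carrier_mat d 1" using lp by (rule minus_carrier_mat)
    have "(P * (X * p) - l \<cdot>\<^sub>m p) * r = P * (X * p) * r - (l \<cdot>\<^sub>m p) * r"
      by (rule mat_distribs) simp_all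
    also have "\<dots> = 0\<^sub>m d d" unfolding e using minus_r_inv_mat[OF mult_carrier_mat[OF lp r]] .
    finally have "P * (X * p) - l \<cdot>\<^sub>m p = 0\<^sub>m d 1"
      using outer_eq_0[OF D r] rnz by blast
    then have e: "(P * (X * p) - l \<cdot>\<^sub>m p) $$ (i,j) = (0\<^sub>m d 1 :: complex mat) $$ (i,j)" for i j by simp
    show ?thesis
    proof (rule eq_matI)
      fix i j assume "i < dim_row (l \<cdot>\<^sub>m p)" "j < dim_col (l \<cdot>\<^sub>m p)"
      then show "(P * (X * p)) $$ (i,j) = (l \<cdot>\<^sub>m p) $$ (i,j)"
        using e[of i j] by (simp del: index_mult_mat(1))
    qed simp_all
  qed
  have "P * X * P = l \<cdot>\<^sub>m P"
  proof (rule eq_mat_ucolI[where d = d and m = d])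
    fix b assume "b < d"
    have [simp]: "dim_row (ucol d b) = d" "dim_col (ucol d b) = 1" by (simp_all add: ucol_def)
    have "(P * X * P) * ucol d b = P * (X * (P * ucol d b))" by (simp add: mat_ring)
    also have "\<dots> = l \<cdot>\<^sub>m (P * ucol d b)"
      by (rule col[OF mult_carrier_mat[OF P ucol_carrier]]) (simp add: mat_ring)
    finally show "(P * X * P) * ucol d b = (l \<cdot>\<^sub>m P) * ucol d b" by (simp add: mat_ring)
  qed (use P X in auto)
  ultimately show ?thesis by blast
qed

lemma mat_eq_blocks:
  assumes PQ: "complementary d P Q" and X: "X \<in> carrier_mat d d"
  shows "X = P * X * P + Q * X * Q + P * X * Q + Q * X * P"
proof -
  note [simp] = complementaryD(3-)[OF PQ] carrier_matD[OF X]
  note P = complementaryD(1)[OF PQ]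
  have "X = X * (P + Q)" using X by simp
  also have "\<dots> = X * P + X * Q" by (rule mat_distribs) simp_all
  also have "\<dots> = (P + Q) * (X * P + X * Q)" using X P by simp
  also have "\<dots> = P * (X * P + X * Q) + Q * (X * P + X * Q)" by (rule mat_distribs) simp_all
  also have "\<dots> = P * X * P + Q * X * Q + P * X * Q + Q * X * P"
    by (simp add: mat_ring) (intro eq_matI, auto simp del: index_mult_mat(1))
  finally show ?thesis .
qed

text \<open>\<open>corner_eq_0\<close> removes one corner, its mirror image under exchange of
  \<open>P\<close> and \<open>Q\<close> the other, and the assumption removes the diagonal.\<close>

lemma block_0_kernel_trivial:
  assumes PQ: "complementary d P Q" and X: "X \<in> carrier_mat d d" and I: "finite I"
    and bigP: "Re (tr P) > 2 * real (card I)" and bigQ: "Re (tr Q) > 2 * real (card I)"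
    and X0: "block P Q 0 X = 0\<^sub>m d d"
    and tan: "\<And>A. A \<in> carrier_mat d d \<Longrightarrow> in_mspan d I (B 0) (block P Q 0 (comm X A))"
  shows "X = 0\<^sub>m d d"
proof -
  note P = complementaryD(1)[OF PQ] and Q = complementaryD(2)[OF PQ]
  have "Q * X * P = 0\<^sub>m d d"
    by (rule corner_eq_0[OF PQ X I _ tan]) (use bigP in auto)
  moreover have "P * X * Q = 0\<^sub>m d d"
    by (rule corner_eq_0[OF complementary_swap[OF PQ] X I, where B = "B 0"])
      (use bigQ tan in \<open>auto simp: block_swap[OF P Q comm_carrier[OF X]]\<close>)
  ultimately show ?thesis
    using mat_eq_blocks[OF PQ X] X0 by (simp add: block_def)
qed

text \<open>Apart from one corner, \<open>X\<close> is the scalar \<open>l\<close>. The corner has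
  trace 0 by cyclicity, so \<open>tr X = 0\<close> forces \<open>l = 0\<close>. Only then is the
  diagonal known to vanish and the previous lemma applicable, which is why \<open>tan0\<close> is
  assumed under that condition.\<close>

lemma block_1_kernel_trivial:
  assumes PQ: "complementary d P Q" and X: "X \<in> carrier_mat d d" "tr X = 0" and I: "finite I"
    and bigP: "Re (tr P) > 2 * real (card I)" and bigQ: "Re (tr Q) > 2 * real (card I)"
    and X0: "block P Q 1 X = 0\<^sub>m d d"
    and tan1: "\<And>A. A \<in> carrier_mat d d \<Longrightarrow> in_mspan d I (B 1) (block P Q 1 (comm X A))"
    and tan0: "\<And>A. block P Q 0 X = 0\<^sub>m d d \<Longrightarrow> A \<in> carrier_mat d d \<Longrightarrow> in_mspan d I (B 0) (block P Q 0 (comm X A))"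
  shows "X = 0\<^sub>m d d"
proof -
  note [simp] = complementaryD(3-)[OF PQ] carrier_matD[OF X(1)]
  note P = complementaryD(1)[OF PQ] and Q = complementaryD(2)[OF PQ]
  have PXQ: "P * X * Q = 0\<^sub>m d d" using X0 by (simp add: block_def)
  obtain l where l: "P * X * P = l \<cdot>\<^sub>m P" "Q * X * Q = l \<cdot>\<^sub>m Q"
    using diagonal_scalar[OF PQ X(1) I bigP bigQ PXQ tan1] by blast
  have "tr (Q * X * P) = tr (P * (Q * X))"
    using tr_mult_commute[of "Q * X" d d P] P Q X by simp
  then have trQXP: "tr (Q * X * P) = 0" by (simp add: tr_def)
  have "l \<cdot>\<^sub>m P + l \<cdot>\<^sub>m Q = l \<cdot>\<^sub>m 1\<^sub>m d"
    using add_smult_distrib_left_mat[OF P Q, of l] by simp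
  then have "X = l \<cdot>\<^sub>m 1\<^sub>m d + Q * X * P"
    using mat_eq_blocks[OF PQ X(1)] P Q X by (simp add: l PXQ)
  then have "tr X = l * of_nat d"
    using trQXP P Q X tr_add[of "l \<cdot>\<^sub>m 1\<^sub>m d" d "Q * X * P"] by (simp add: tr_smult[of _ d] tr_one)
  moreover have "d \<noteq> 0"
  proof
    assume "d = 0"
    then have "tr P = 0" by (simp add: tr_def)
    then show False using bigP by simp
  qed
  ultimately have l0: "l = 0" using X(2) by simp
  have b0: "block P Q 0 X = 0\<^sub>m d d" using l l0 P Q by (auto simp: block_def intro!: eq_matI)
  show ?thesis
    using block_0_kernel_trivial[OF PQ X(1) I bigP bigQ b0] tan0 b0 by blast
qed

lemma block_kernel_trivial:
  assumes PQ: "complementary d P Q" and X: "X \<in> carrier_mat d d" "tr X = 0" and I: "finite I"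
    and big: "Re (tr P) > 2 * real (card I)" "Re (tr Q) > 2 * real (card I)"
    and s: "s < 3" "block P Q s X = 0\<^sub>m d d"
    and tan: "\<And>s A. s < 3 \<Longrightarrow> block P Q s X = 0\<^sub>m d d \<Longrightarrow> A \<in> carrier_mat d d \<Longrightarrow>
      in_mspan d I (B s) (block P Q s (comm X A))"
  shows "X = 0\<^sub>m d d"
proof -
  note P = complementaryD(1)[OF PQ] and Q = complementaryD(2)[OF PQ]
  consider "s = 0" | "s = 1" | "s = 2" using s(1) by linarith
  then show ?thesis
  proof cases
    case 1
    then show ?thesis using block_0_kernel_trivial[OF PQ X(1) I big, of B] s tan by simp
  next
    case 2
    then show ?thesis using block_1_kernel_trivial[OF PQ X I big, of B] s tan by simp
  next
    case 3
    note sw = block_swap[OF P Q X(1)] block_swap[OF P Q comm_carrier[OF X(1)]]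
    \<comment> \<open>Exchanging \<open>P\<close> and \<open>Q\<close> exchanges the corners, so the
      family that spans for corner 1 of the exchanged pair is the one with index 2.\<close>
    show ?thesis
      by (rule block_1_kernel_trivial[OF complementary_swap[OF PQ] X I big(2,1), where B = "\<lambda>s. B (if s = 1 then 2 else s)"])
        (use s 3 in \<open>auto simp: sw simp del: One_nat_def intro!: tan\<close>)
  qed
qed

section \<open>Rotations\<close>

lemma adj_carrier[simp]: "A \<in> carrier_mat m n \<Longrightarrow> adj A \<in> carrier_mat n m"
  by (simp add: adj_def)

lemma adj_dim[simp]: "dim_row (adj A) = dim_col A" "dim_col (adj A) = dim_row A"
  by (simp_all add: adj_def)

lemma adj_index: "i < dim_col A \<Longrightarrow> j < dim_row A \<Longrightarrow> adj A $$ (i,j) = cnj (A $$ (j,i))"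
  by (simp add: adj_def)

lemma adj_mult:
  assumes "A \<in> carrier_mat m k" "B \<in> carrier_mat k n"
  shows "adj (A * B) = adj B * adj A"
proof (rule eq_matI)
  fix i j assume "i < dim_row (adj B * adj A)" "j < dim_col (adj B * adj A)"
  then have ij: "i < n" "j < m" using assms by auto
  have "adj (A * B) $$ (i,j) = cnj ((A * B) $$ (j,i))"
    using assms ij by (intro adj_index) auto
  also have "\<dots> = (\<Sum>l\<in>{..<k}. cnj (B $$ (l,i)) * cnj (A $$ (j,l)))"
    by (simp only: mat_mult_index[OF assms ij(2,1)] cnj_sum complex_cnj_mult mult.commute)
  also have "\<dots> = (\<Sum>l\<in>{..<k}. adj B $$ (i,l) * adj A $$ (l,j))"
    using assms ij by (intro sum.cong refl) (simp add: adj_index)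
  also have "\<dots> = (adj B * adj A) $$ (i,j)"
    using mat_mult_index[of "adj B" n k "adj A" m i j] assms ij by simp
  finally show "adj (A * B) $$ (i,j) = (adj B * adj A) $$ (i,j)" .
qed (use assms in auto)

lemma unitary_matD:
  assumes "unitary_mat d U"
  shows "U \<in> carrier_mat d d" "adj U \<in> carrier_mat d d" "dim_row U = d" "dim_col U = d"
    "adj U * U = 1\<^sub>m d" "U * adj U = 1\<^sub>m d"
    "\<And>X. dim_row X = d \<Longrightarrow> adj U * (U * X) = X" "\<And>X. dim_row X = d \<Longrightarrow> U * (adj U * X) = X"
  using assms by (auto simp: unitary_mat_def simp flip: mat_assoc)

lemma unitary_mult:
  assumes U: "unitary_mat d U" and V: "unitary_mat d V"
  shows "unitary_mat d (U * V)"
proof -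
  note [simp] = unitary_matD(3-)[OF U] unitary_matD(3-)[OF V]
  show ?thesis
    unfolding unitary_mat_def adj_mult[OF unitary_matD(1)[OF U] unitary_matD(1)[OF V]]
    using unitary_matD(1)[OF U] unitary_matD(1)[OF V] by (auto simp: mat_ring)
qed

definition outer :: "nat \<Rightarrow> (nat \<Rightarrow> complex) \<Rightarrow> complex mat" where
  "outer d v = mat d d (\<lambda>(a,b). v a * cnj (v b))"

definition rot :: "nat \<Rightarrow> (nat \<Rightarrow> complex) \<Rightarrow> complex \<Rightarrow> complex mat" where
  "rot d v z = 1\<^sub>m d + (z - 1) \<cdot>\<^sub>m outer d v"

definition basis_vec :: "nat \<Rightarrow> nat \<Rightarrow> complex" where
  "basis_vec j a = (if a = j then 1 else 0)"

definition pair_vec :: "complex \<Rightarrow> nat \<Rightarrow> nat \<Rightarrow> nat \<Rightarrow> complex" where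
  "pair_vec w j k a = (if a = j then 1 else if a = k then w else 0) / complex_of_real (sqrt 2)"

text \<open>The projections onto these lines span all matrices by polarization.\<close>

definition axes :: "nat \<Rightarrow> (nat \<Rightarrow> complex) set" where
  "axes d = basis_vec ` {..<d} \<union>
     (\<lambda>(w,j,k). pair_vec w j k) ` ({1,\<i>} \<times> {(j,k). j < d \<and> k < d \<and> j \<noteq> k})"

lemma pair_vec_axes:
  "w \<in> {1,\<i>} \<Longrightarrow> j < d \<Longrightarrow> k < d \<Longrightarrow> j \<noteq> k \<Longrightarrow> pair_vec w j k \<in> axes d"
  unfolding axes_def by (rule UnI2, rule image_eqI[of _ _ "(w,j,k)"]) auto

lemma finite_axes: "finite (axes d)"
proof -
  have "finite {(j,k). j < d \<and> k < d \<and> j \<noteq> k}"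
    by (rule finite_subset[of _ "{..<d} \<times> {..<d}"]) auto
  then show ?thesis by (simp add: axes_def)
qed

lemma outer_carrier[simp]: "outer d v \<in> carrier_mat d d" "dim_row (outer d v) = d" "dim_col (outer d v) = d"
  by (simp_all add: outer_def)

lemma rot_carrier[simp]: "rot d v z \<in> carrier_mat d d" "dim_row (rot d v z) = d" "dim_col (rot d v z) = d"
  by (simp_all add: rot_def)

lemma sum_two:
  assumes "finite A" "j \<in> A" "k \<in> A" "j \<noteq> k" "\<And>a. a \<in> A \<Longrightarrow> a \<noteq> j \<Longrightarrow> a \<noteq> k \<Longrightarrow> f a = (0 :: complex)"
  shows "sum f A = f j + f k"
proof -
  have "sum f A = sum f {j,k}" using assms by (intro sum.mono_neutral_right) auto
  then show ?thesis using assms(4) by simp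
qed

lemma axes_unit:
  assumes "v \<in> axes d"
  shows "(\<Sum>a\<in>{..<d}. cnj (v a) * v a) = 1"
proof -
  consider j where "j < d" "v = basis_vec j"
    | w j k where "w \<in> {1,\<i>}" "j < d" "k < d" "j \<noteq> k" "v = pair_vec w j k"
    using assms by (auto simp: axes_def)
  then show ?thesis
  proof cases
    case 1
    then show ?thesis by (simp add: basis_vec_def if_distrib cong: if_cong)
  next
    case 2
    have r: "complex_of_real (sqrt 2) * complex_of_real (sqrt 2) = 2"
      by (simp flip: of_real_mult)
    have w: "cnj w * w = 1" using 2(1) by auto
    have "(\<Sum>a\<in>{..<d}. cnj (v a) * v a) = cnj (v j) * v j + cnj (v k) * v k"
      using 2 by (intro sum_two) (auto simp: pair_vec_def)
    also have "\<dots> = 1" using 2(4) w r by (simp add: 2(5) pair_vec_def)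
    finally show ?thesis .
  qed
qed

lemma outer_idem:
  assumes "v \<in> axes d"
  shows "outer d v * outer d v = outer d v"
proof (rule eq_matI)
  fix i j assume "i < dim_row (outer d v)" "j < dim_col (outer d v)"
  then have ij: "i < d" "j < d" by auto
  have "(outer d v * outer d v) $$ (i,j) = (\<Sum>l\<in>{..<d}. v i * cnj (v j) * (cnj (v l) * v l))"
    using ij by (subst mat_mult_index[OF outer_carrier(1) outer_carrier(1)]) (auto simp: outer_def mult_ac)
  also have "\<dots> = v i * cnj (v j)"
    using axes_unit[OF assms] by (simp flip: sum_distrib_left)
  finally show "(outer d v * outer d v) $$ (i,j) = outer d v $$ (i,j)"
    using ij by (simp add: outer_def)
qed auto

lemma adj_rot: "adj (rot d v z) = rot d v (cnj z)"
  by (rule eq_matI) (auto simp: adj_def rot_def outer_def)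

lemma rot_one: "rot d v 1 = 1\<^sub>m d"
  by (rule eq_matI) (auto simp: rot_def)

lemma rot_mult:
  assumes v: "v \<in> axes d"
  shows "rot d v y * rot d v z = rot d v (y * z)"
  by (simp add: rot_def mat_ring outer_idem[OF v]) (intro eq_matI, auto simp: algebra_simps)

lemma unitary_rot:
  assumes v: "v \<in> axes d" and z: "z \<in> sphere 0 1"
  shows "unitary_mat d (rot d v z)"
proof -
  have "cnj z * z = 1" using z complex_norm_square[of z] by (simp add: mult.commute)
  then show ?thesis
    by (simp add: unitary_mat_def adj_rot rot_mult[OF v] mult.commute[of z] rot_one)
qed

lemma outers_span:
  assumes A: "A \<in> carrier_mat d d" and zero: "S (0\<^sub>m d d)"
    and outer: "\<And>v. v \<in> axes d \<Longrightarrow> S (outer d v)"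
    and add: "\<And>A B. A \<in> carrier_mat d d \<Longrightarrow> B \<in> carrier_mat d d \<Longrightarrow> S A \<Longrightarrow> S B \<Longrightarrow> S (A + B)"
    and smult: "\<And>A c. A \<in> carrier_mat d d \<Longrightarrow> S A \<Longrightarrow> S (c \<cdot>\<^sub>m A)"
  shows "S A"
proof -
  define E where "E j k = (mat d d (\<lambda>(a,b). if a = j \<and> b = k then 1 else 0) :: complex mat)" for j k
  have Ec: "E j k \<in> carrier_mat d d" for j k by (simp add: E_def)
  have diag: "S (E j j)" if "j < d" for j
  proof -
    have "outer d (basis_vec j) = E j j"
      by (rule eq_matI) (auto simp: outer_def E_def basis_vec_def)
    then show ?thesis using outer[of "basis_vec j"] that by (auto simp: axes_def)
  qed
  have SE: "S (E j k)" if jk: "j < d" "k < d" for j k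
  proof (cases "j = k")
    case True
    then show ?thesis using diag jk by simp
  next
    case False
    let ?u = "outer d (pair_vec 1 j k)" and ?w = "outer d (pair_vec \<i> j k)"
    have r: "complex_of_real (sqrt 2) * complex_of_real (sqrt 2) = 2"
      by (simp flip: of_real_mult)
    \<comment> \<open>In \<open>?u\<close> and \<open>\<i>\<close> times \<open>?w\<close> the
      entries at \<open>(j,k)\<close> are both \<open>1/2\<close> and those at \<open>(k,j)\<close>
      are opposite. The diagonal entries add up to \<open>(1 + \<i>) / 2\<close>, which the last
      summand removes.\<close>
    have "E j k = ?u + (\<i> \<cdot>\<^sub>m ?w + (- (1 + \<i>) / 2) \<cdot>\<^sub>m (E j j + E k k))"
      using False by (intro eq_matI) (auto simp: outer_def E_def pair_vec_def r field_simps)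
    moreover have "pair_vec 1 j k \<in> axes d" "pair_vec \<i> j k \<in> axes d"
      using jk False by (simp_all add: pair_vec_axes)
    ultimately show ?thesis
      using add[of ?u "\<i> \<cdot>\<^sub>m ?w + (- (1 + \<i>) / 2) \<cdot>\<^sub>m (E j j + E k k)"]
        add[of "\<i> \<cdot>\<^sub>m ?w" "(- (1 + \<i>) / 2) \<cdot>\<^sub>m (E j j + E k k)"] add[OF Ec Ec diag diag] jk
        outer smult Ec by simp
  qed
  show ?thesis
    using A
  proof (induction "card {(a,b). a < d \<and> b < d \<and> A $$ (a,b) \<noteq> 0}" arbitrary: A rule: less_induct)
    case less
    let ?N = "\<lambda>A :: complex mat. {(a,b). a < d \<and> b < d \<and> A $$ (a,b) \<noteq> 0}"
    have fin: "finite (?N A)" for A by (rule finite_subset[of _ "{..<d} \<times> {..<d}"]) auto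
    show ?case
    proof (cases "?N A = {}")
      case True
      then have "A = 0\<^sub>m d d" using less.prems by (intro eq_matI) auto
      then show ?thesis using zero by simp
    next
      case False
      then obtain j k where jk: "j < d" "k < d" "A $$ (j,k) \<noteq> 0" by auto
      define A' where "A' = A + (- A $$ (j,k)) \<cdot>\<^sub>m E j k"
      have A': "A' \<in> carrier_mat d d" using less.prems Ec by (simp add: A'_def)
      have idx: "A' $$ (a,b) = (if a = j \<and> b = k then 0 else A $$ (a,b))" if "a < d" "b < d" for a b
        using that less.prems by (auto simp: A'_def E_def)
      have "(j,k) \<in> ?N A" "(j,k) \<notin> ?N A'" using jk idx by auto
      moreover have "?N A' \<subseteq> ?N A" by (auto simp: idx split: if_splits)
      ultimately have "?N A' \<subset> ?N A" by blast
      then have "card (?N A') < card (?N A)" using fin by (rule psubset_card_mono[rotated])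
      then have "S A'" using less.hyps A' by blast
      then have "S (A' + A $$ (j,k) \<cdot>\<^sub>m E j k)"
        using jk by (intro add A' smult Ec SE) (simp_all add: Ec)
      moreover have "A' + A $$ (j,k) \<cdot>\<^sub>m E j k = A"
        using less.prems by (intro eq_matI) (auto simp: A'_def E_def)
      ultimately show ?thesis by simp
    qed
  qed
qed

section \<open>Independent families of matrices and their blocks\<close>

definition mindep :: "nat \<Rightarrow> 'i set \<Rightarrow> ('i \<Rightarrow> complex mat) \<Rightarrow> bool" where
  "mindep d I B \<longleftrightarrow> fam_indep I ({..<d} \<times> {..<d}) (\<lambda>i e. B i $$ e)"

lemma lincomb_eq_0_iff:
  "lincomb d I c B = 0\<^sub>m d d \<longleftrightarrow> (\<forall>e\<in>{..<d} \<times> {..<d}. (\<Sum>k\<in>I. c k * B k $$ e) = 0)"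
proof
  assume e: "lincomb d I c B = 0\<^sub>m d d"
  show "\<forall>e\<in>{..<d} \<times> {..<d}. (\<Sum>k\<in>I. c k * B k $$ e) = 0"
  proof
    fix e assume "e \<in> {..<d} \<times> {..<d}"
    then obtain i j where "e = (i,j)" "i < d" "j < d" by auto
    then show "(\<Sum>k\<in>I. c k * B k $$ e) = 0"
      using lincomb_index[of i d j I c B] e by simp
  qed
qed (auto intro!: eq_matI)

lemma mindep_iff: "mindep d I B \<longleftrightarrow> (\<forall>c. lincomb d I c B = 0\<^sub>m d d \<longrightarrow> (\<forall>i\<in>I. c i = 0))"
  by (simp add: mindep_def fam_indep_def lincomb_eq_0_iff)

lemma mindepD: "mindep d I B \<Longrightarrow> lincomb d I c B = 0\<^sub>m d d \<Longrightarrow> i \<in> I \<Longrightarrow> c i = 0"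
  by (simp add: mindep_iff)

lemma sandwich_lincomb:
  assumes "M \<in> carrier_mat d d" "N \<in> carrier_mat d d" "\<And>i. i \<in> I \<Longrightarrow> B i \<in> carrier_mat d d"
  shows "M * lincomb d I c B * N = lincomb d I c (\<lambda>i. M * B i * N)"
proof -
  have "M * lincomb d I c B * N = lincomb d I c (\<lambda>i. M * B i) * N"
    by (simp only: mult_lincomb[OF assms(1,3)])
  also have "\<dots> = lincomb d I c (\<lambda>i. M * B i * N)"
    by (rule lincomb_mult[OF assms(2) mult_carrier_mat[OF assms(1,3)]])
  finally show ?thesis .
qed

lemma mindep_sandwich:
  assumes ind: "mindep d I F" and M: "M \<in> carrier_mat d d" "N \<in> carrier_mat d d"
    and G: "\<And>i. i \<in> I \<Longrightarrow> G i \<in> carrier_mat d d" "\<And>i. i \<in> I \<Longrightarrow> F i = M * G i * N"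
  shows "mindep d I G"
  unfolding mindep_iff
proof (intro allI impI ballI)
  fix c i assume c: "lincomb d I c G = 0\<^sub>m d d" and i: "i \<in> I"
  have "M * lincomb d I c G * N = lincomb d I c (\<lambda>i. M * G i * N)"
    by (rule sandwich_lincomb[OF M G(1)])
  also have "\<dots> = lincomb d I c F" using G(2) by (intro lincomb_cong) auto
  finally have "lincomb d I c F = 0\<^sub>m d d" using M by (simp add: c)
  then show "c i = 0" using mindepD[OF ind _ i] by blast
qed

lemma block_carrier:
  assumes "P \<in> carrier_mat d d" "Q \<in> carrier_mat d d" "X \<in> carrier_mat d d"
  shows "block P Q s X \<in> carrier_mat d d"
  using assms by (simp add: block_def)

lemma block_lincomb:
  assumes PQ: "P \<in> carrier_mat d d" "Q \<in> carrier_mat d d" and B: "\<And>i. i \<in> I \<Longrightarrow> B i \<in> carrier_mat d d"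
  shows "block P Q s (lincomb d I c B) = lincomb d I c (\<lambda>i. block P Q s (B i))"
proof -
  have m: "R * lincomb d I c B * S = lincomb d I c (\<lambda>i. R * B i * S)"
    if "R \<in> carrier_mat d d" "S \<in> carrier_mat d d" for R S
    using that B by (rule sandwich_lincomb)
  have "lincomb d I c (\<lambda>i. P * B i * P) + lincomb d I c (\<lambda>i. Q * B i * Q) =
      lincomb d I c (\<lambda>i. P * B i * P + Q * B i * Q)"
    using PQ B by (intro lincomb_add) auto
  then show ?thesis
    using PQ by (cases "s = 0"; cases "s = 1"; simp add: block_def m)
qed

lemma block_add:
  assumes "P \<in> carrier_mat d d" "Q \<in> carrier_mat d d" "X \<in> carrier_mat d d" "Y \<in> carrier_mat d d"
  shows "block P Q s (X + Y) = block P Q s X + block P Q s Y"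
proof -
  note [simp] = assms[THEN carrier_matD(1)] assms[THEN carrier_matD(2)]
  show ?thesis
    by (cases "s = 0"; cases "s = 1"; simp add: block_def mat_ring)
      (intro eq_matI, auto simp del: index_mult_mat(1))
qed

lemma block_smult:
  assumes "P \<in> carrier_mat d d" "Q \<in> carrier_mat d d" "X \<in> carrier_mat d d"
  shows "block P Q s (k \<cdot>\<^sub>m X) = k \<cdot>\<^sub>m block P Q s X"
proof -
  note [simp] = assms[THEN carrier_matD(1)] assms[THEN carrier_matD(2)]
  show ?thesis
    by (cases "s = 0"; cases "s = 1"; simp add: block_def mat_ring)
      (intro eq_matI, auto simp del: index_mult_mat(1) simp: algebra_simps)
qed

text \<open>The three block maps are idempotent and annihilate each other, so a linear relation
  among blocks of mixed kinds splits into one relation for each kind.\<close>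

lemma block_block:
  assumes PQ: "complementary d P Q" and X: "X \<in> carrier_mat d d" and s: "s < 3" "t < 3"
  shows "block P Q s (block P Q t X) = (if s = t then block P Q s X else 0\<^sub>m d d)"
proof -
  note [simp] = complementaryD(3-)[OF PQ] carrier_matD[OF X]
  have "s = 0 \<or> s = 1 \<or> s = 2" "t = 0 \<or> t = 1 \<or> t = 2" using s by auto
  moreover have "0\<^sub>m d d + Y = Y" "Y + 0\<^sub>m d d = Y" if "dim_row Y = d" "dim_col Y = d" for Y :: "complex mat"
    using that by (auto intro!: eq_matI)
  ultimately show ?thesis
    by (auto simp: block_def mat_ring)
qed

lemma in_mspan_iff:
  "in_mspan d I B D \<longleftrightarrow> (\<exists>y. \<forall>e\<in>{..<d} \<times> {..<d}. D $$ e = (\<Sum>k\<in>I. y k * B k $$ e))"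
  unfolding in_mspan_def by (intro arg_cong[of _ _ Ex] ext) auto

lemma in_mspan_add:
  assumes "in_mspan d I B X" "in_mspan d I B Y" "Y \<in> carrier_mat d d"
  shows "in_mspan d I B (X + Y)"
proof -
  obtain x y where "\<forall>i<d. \<forall>j<d. X $$ (i,j) = (\<Sum>k\<in>I. x k * B k $$ (i,j))"
    "\<forall>i<d. \<forall>j<d. Y $$ (i,j) = (\<Sum>k\<in>I. y k * B k $$ (i,j))"
    using assms by (auto simp: in_mspan_def)
  then show ?thesis
    unfolding in_mspan_def using assms(3)
    by (intro exI[of _ "\<lambda>k. x k + y k"]) (auto simp: distrib_right sum.distrib)
qed

lemma in_mspan_smult:
  assumes "in_mspan d I B X" "X \<in> carrier_mat d d"
  shows "in_mspan d I B (c \<cdot>\<^sub>m X)"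
proof -
  obtain x where "\<forall>i<d. \<forall>j<d. X $$ (i,j) = (\<Sum>k\<in>I. x k * B k $$ (i,j))"
    using assms by (auto simp: in_mspan_def)
  then show ?thesis
    unfolding in_mspan_def using assms(2)
    by (intro exI[of _ "\<lambda>k. c * x k"]) (auto simp: sum_distrib_left mult_ac)
qed

lemma in_mspan_0: "in_mspan d I B (0\<^sub>m d d)"
  unfolding in_mspan_def by (rule exI[of _ "\<lambda>_. 0"]) simp

section \<open>Independence at points of maximal rank\<close>

lemma (in function_algebra) cmat_block:
  assumes "P \<in> carrier_mat d d" "Q \<in> carrier_mat d d" "cmat d d F"
  shows "cmat d d (\<lambda>x. block P Q s (F x))"
proof -
  have m: "cmat d d (\<lambda>x. R * F x * S)" if "R \<in> carrier_mat d d" "S \<in> carrier_mat d d" for R S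
    by (rule cmat_mult[OF cmat_mult[OF cmat_const[OF that(1)] assms(3)] cmat_const[OF that(2)]])
  show ?thesis
    using cmat_add[OF m m] m assms(1,2) by (cases "s = 0"; cases "s = 1"; simp add: block_def)
qed

lemma cmat_rot: "laurent.cmat d d (\<lambda>z. rot d v z)"
  unfolding rot_def
  by (intro laurent.cmat_add laurent.cmat_smult laurent.cmat_const laurent.diff
      laurent_id laurent_const) auto

text \<open>On the circle \<open>cnj z - 1 = - cnj z * (z - 1)\<close>, so the whole deviation from
  \<open>X\<close> carries the factor \<open>z - 1\<close>. The quotient is still a Laurent
  polynomial, and its value at \<open>z = 1\<close> is the commutator
  \<open>X * N - N * X\<close>.\<close>

lemma conj_rot:
  assumes U: "unitary_mat d U" and A: "A \<in> carrier_mat d d" and z: "z \<in> sphere 0 1"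
    and X: "X = adj U * A * U" and N: "N = adj U * outer d v * U"
  shows "adj (rot d v z * U) * A * (rot d v z * U) =
    X + (z - 1) \<cdot>\<^sub>m (X * N - cnj z \<cdot>\<^sub>m (N * X) + (cnj z - 1) \<cdot>\<^sub>m (N * (X * N)))"
proof -
  note [simp] = unitary_matD(3-)[OF U] carrier_matD[OF A]
  have zz: "z * cnj z = 1" using z by (simp flip: complex_norm_square)
  have "adj (rot d v z * U) * A * (rot d v z * U) = adj U * (rot d v (cnj z) * (A * (rot d v z * U)))"
    by (simp add: adj_mult[OF rot_carrier(1) unitary_matD(1)[OF U]] adj_rot mat_ring)
  also have "\<dots> = X + (z - 1) \<cdot>\<^sub>m (X * N) + (cnj z - 1) \<cdot>\<^sub>m (N * X) +
      ((z - 1) * (cnj z - 1)) \<cdot>\<^sub>m (N * (X * N))"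
    by (simp add: rot_def X N mat_ring)
      (intro eq_matI, auto simp del: index_mult_mat(1) simp: algebra_simps)
  also have "\<dots> = X + (z - 1) \<cdot>\<^sub>m (X * N - cnj z \<cdot>\<^sub>m (N * X) + (cnj z - 1) \<cdot>\<^sub>m (N * (X * N)))"
  proof -
    have zl: "z * (cnj z * c) = c" for c using zz by (simp flip: mult.assoc)
    show ?thesis
      using X N
      by (intro eq_matI) (auto simp del: index_mult_mat(1) simp: algebra_simps zz zl)
  qed
  finally show ?thesis .
qed

definition bfam :: "complex mat \<Rightarrow> complex mat \<Rightarrow> ('i \<Rightarrow> complex mat) \<Rightarrow> complex mat \<Rightarrow> nat \<times> 'i \<Rightarrow> complex mat" where
  "bfam P Q A U = (\<lambda>(s,i). block P Q s (adj U * A i * U))"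

text \<open>If \<open>block P Q s X = 0\<close>, then \<open>block P Q s\<close> of the rotated \<open>X\<close> is divisible by \<open>z - 1\<close>, and the
  quotient at \<open>z = 1\<close> is the commutator below. Were it outside the span of the maximal independent
  subfamily, then it would remain so for some \<open>z \<noteq> 1\<close>, and the rank would grow there.\<close>

lemma tangent_in_span:
  assumes PQ: "complementary d P Q" and U: "unitary_mat d U" and I: "finite I"
    and A: "\<And>i. i \<in> I \<Longrightarrow> A i \<in> carrier_mat d d"
    and J: "J \<subseteq> {..<3} \<times> I" and ind: "mindep d J (bfam P Q A U)"
    and max: "\<And>z J'. z \<in> sphere 0 1 \<Longrightarrow> J' \<subseteq> {..<3} \<times> I \<Longrightarrow>
      mindep d J' (bfam P Q A (rot d v z * U)) \<Longrightarrow> card J' \<le> card J"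
    and s: "s < 3" and X: "X = lincomb d I x (\<lambda>i. adj U * A i * U)" and X0: "block P Q s X = 0\<^sub>m d d"
  shows "in_mspan d J (bfam P Q A U) (block P Q s (comm X (adj U * outer d v * U)))"
proof (rule ccontr)
  assume nsp: "\<not> ?thesis"
  note P = complementaryD(1)[OF PQ] and Q = complementaryD(2)[OF PQ]
  note Uc = unitary_matD(1)[OF U] and Ua = unitary_matD(2)[OF U]
  have finJ: "finite J" by (rule finite_subset[OF J]) (simp add: I)
  define N where "N = adj U * outer d v * U"
  have N: "N \<in> carrier_mat d d" unfolding N_def by (intro mult_carrier_mat[where n = d] Ua Uc outer_carrier)
  have Xc: "X \<in> carrier_mat d d" by (simp add: X)
  define W where "W z = X * N - cnj z \<cdot>\<^sub>m (N * X) + (cnj z - 1) \<cdot>\<^sub>m (N * (X * N))" for z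
  have XN: "X * N \<in> carrier_mat d d" "N * X \<in> carrier_mat d d" "N * (X * N) \<in> carrier_mat d d"
    using Xc N by auto
  have Wc: "W z \<in> carrier_mat d d" for z using XN by (simp add: W_def minus_carrier_mat)
  have lau_W: "laurent.cmat d d W"
    unfolding W_def
    by (intro laurent.cmat_add laurent.cmat_diff laurent.cmat_smult laurent.cmat_const XN
        laurent.diff laurent_const laurent_cnj_id)
  have W1: "W 1 = comm X N"
    using Xc N by (auto simp: W_def comm_def simp del: index_mult_mat(1) intro!: eq_matI)
  define Y where "Y = lincomb d I x A"
  have XY: "X = adj U * Y * U"
    unfolding X Y_def by (rule sandwich_lincomb[OF Ua Uc A, symmetric])
  have Yc: "Y \<in> carrier_mat d d" by (simp add: Y_def)
  have RU: "rot d v z * U \<in> carrier_mat d d" for z by (rule mult_carrier_mat[OF rot_carrier(1) Uc])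
  have key: "lincomb d I x (\<lambda>i. bfam P Q A (rot d v z * U) (s,i)) = (z - 1) \<cdot>\<^sub>m block P Q s (W z)"
    if z: "z \<in> sphere 0 1" for z
  proof -
    let ?V = "rot d v z * U"
    have Va: "adj ?V \<in> carrier_mat d d" by (rule adj_carrier[OF RU])
    have VA: "adj ?V * A i * ?V \<in> carrier_mat d d" if "i \<in> I" for i
      by (intro mult_carrier_mat[where n = d] Va RU A[OF that])
    have "adj ?V * Y * ?V = lincomb d I x (\<lambda>i. adj ?V * A i * ?V)"
      unfolding Y_def by (rule sandwich_lincomb[OF Va RU A])
    then have "lincomb d I x (\<lambda>i. bfam P Q A ?V (s,i)) = block P Q s (adj ?V * Y * ?V)"
      using block_lincomb[OF P Q, of I "\<lambda>i. adj ?V * A i * ?V" s x] VA by (simp add: bfam_def)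
    also have "\<dots> = block P Q s (X + (z - 1) \<cdot>\<^sub>m W z)"
      by (simp only: conj_rot[OF U Yc z XY N_def] W_def)
    also have "\<dots> = block P Q s X + (z - 1) \<cdot>\<^sub>m block P Q s (W z)"
      using Wc[of z] by (simp add: block_add[OF P Q Xc] block_smult[OF P Q])
    also have "\<dots> = (z - 1) \<cdot>\<^sub>m block P Q s (W z)"
      using block_carrier[OF P Q Wc, of s z] by (simp add: X0)
    finally show ?thesis .
  qed
  \<comment> \<open>The index \<open>None\<close> carries the quotient by \<open>z - 1\<close>, the
    others carry the maximal subfamily at the rotated point. One Gram determinant then decides the
    independence of all of them together.\<close>
  define w where "w z k = (case k of None \<Rightarrow> block P Q s (W z) | Some j \<Rightarrow> bfam P Q A (rot d v z * U) j)"
    for z k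
  let ?K = "insert None (Some ` J)"
  have "mindep d ?K (w 1)"
    unfolding mindep_def
  proof (rule fam_indep_insert)
    have rU: "rot d v 1 * U = U" using Uc by (simp add: rot_one)
    have "mindep d J (\<lambda>j. w 1 (Some j))" using ind by (simp add: w_def rU)
    then show "fam_indep (Some ` J) ({..<d} \<times> {..<d}) (\<lambda>k e. w 1 k $$ e)"
      using fam_indep_reindex[of Some J "Some ` J" "{..<d} \<times> {..<d}" "\<lambda>k e. w 1 k $$ e"]
      by (simp add: mindep_def bij_betw_def)
    show "\<nexists>c. \<forall>e\<in>{..<d} \<times> {..<d}. w 1 None $$ e = (\<Sum>j\<in>Some ` J. c j * w 1 j $$ e)"
    proof
      assume "\<exists>c. \<forall>e\<in>{..<d} \<times> {..<d}. w 1 None $$ e = (\<Sum>j\<in>Some ` J. c j * w 1 j $$ e)"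
      then obtain c where c: "\<forall>e\<in>{..<d} \<times> {..<d}. w 1 None $$ e = (\<Sum>j\<in>Some ` J. c j * w 1 j $$ e)"
        by blast
      have "in_mspan d J (bfam P Q A U) (block P Q s (comm X N))"
        unfolding in_mspan_def
        by (rule exI[of _ "\<lambda>j. c (Some j)"]) (use c in \<open>auto simp: w_def rU W1 sum.reindex\<close>)
      then show False using nsp by (simp add: N_def)
    qed
  qed (use finJ in auto)
  moreover have "fin_or_all {z. \<not> fam_indep ?K ({..<d} \<times> {..<d}) (\<lambda>k e. w z k $$ e)}"
  proof (rule laurent_dependent)
    fix k e assume k: "k \<in> ?K" and e: "e \<in> {..<d} \<times> {..<d}"
    obtain a b where ab: "e = (a,b)" "a < d" "b < d" using e by auto
    have "laurent.cmat d d (\<lambda>z. w z k)"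
    proof (cases k)
      case None
      then show ?thesis using laurent.cmat_block[OF P Q lau_W] by (simp add: w_def)
    next
      case (Some j)
      obtain t i where j: "j = (t,i)" "i \<in> I" using k J Some by force
      have "laurent.cmat d d (\<lambda>z. rot d v z * U)"
        by (rule laurent.cmat_mult[OF cmat_rot laurent.cmat_const[OF Uc]])
      note V = this
      have "laurent.cmat d d (\<lambda>z. adj (rot d v z * U) * A i * (rot d v z * U))"
        by (rule laurent.cmat_mult[OF laurent.cmat_mult[OF laurent.cmat_adj[OF V]
              laurent.cmat_const[OF A[OF j(2)]]] V])
      then show ?thesis using laurent.cmat_block[OF P Q] Some by (simp add: w_def bfam_def j)
    qed
    then show "laurent (\<lambda>z. w z k $$ e)" using laurent.cmatD ab by blast
  qed (use finJ in auto)
  ultimately have "finite ({z. \<not> mindep d ?K (w z)} \<inter> sphere 0 1)"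
    unfolding fin_or_all_def mindep_def using mem_sphere_0[of "1 :: complex" 1] by force
  \<comment> \<open>The angle \<open>z = 1\<close> is removed as well, because a coefficient
    \<open>z - 1\<close> has to be nonzero below.\<close>
  then have "infinite (sphere 0 1 - (insert 1 ({z. \<not> mindep d ?K (w z)} \<inter> sphere 0 1)))"
    using infinite_circle by (intro Diff_infinite_finite) auto
  then obtain z where "z \<in> sphere 0 1 - insert 1 ({z. \<not> mindep d ?K (w z)} \<inter> sphere 0 1)"
    using infinite_imp_nonempty by blast
  then have z: "z \<in> sphere 0 1" "z \<noteq> 1" "mindep d ?K (w z)" by blast+
  let ?V = "rot d v z * U"
  have indJ: "mindep d J (bfam P Q A ?V)"
  proof -
    have "fam_indep (Some ` J) ({..<d} \<times> {..<d}) (\<lambda>k e. w z k $$ e)"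
      by (rule fam_indep_mono[OF z(3)[unfolded mindep_def]]) (use finJ in auto)
    then show ?thesis
      using fam_indep_reindex[of Some J "Some ` J" "{..<d} \<times> {..<d}" "\<lambda>k e. w z k $$ e"]
      by (simp add: mindep_def bij_betw_def w_def)
  qed
  \<comment> \<open>If all blocks of kind \<open>s\<close> at the rotated point lay in the span of
    the subfamily, then by \<open>key\<close> so would \<open>z - 1\<close> times the quotient,
    against the independence of the enlarged family.\<close>
  have ex: "\<exists>i\<in>I. \<not> in_mspan d J (bfam P Q A ?V) (bfam P Q A ?V (s,i))"
  proof (rule ccontr)
    assume "\<not> ?thesis"
    then have "\<forall>i\<in>I. \<exists>y. \<forall>a<d. \<forall>b<d. bfam P Q A ?V (s,i) $$ (a,b) = (\<Sum>j\<in>J. y j * bfam P Q A ?V j $$ (a,b))"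
      by (auto simp: in_mspan_def)
    from bchoice[OF this] obtain y where y: "\<forall>i\<in>I. \<forall>a<d. \<forall>b<d. bfam P Q A ?V (s,i) $$ (a,b) =
        (\<Sum>j\<in>J. y i j * bfam P Q A ?V j $$ (a,b))" ..
    define c where "c k = (case k of None \<Rightarrow> - (z - 1) | Some j \<Rightarrow> \<Sum>i\<in>I. x i * y i j)" for k
    have "lincomb d ?K c (w z) = 0\<^sub>m d d"
    proof (rule eq_matI)
      fix a b assume "a < dim_row (0\<^sub>m d d :: complex mat)" "b < dim_col (0\<^sub>m d d :: complex mat)"
      then have ab: "a < d" "b < d" by auto
      have "(z - 1) * block P Q s (W z) $$ (a,b) = lincomb d I x (\<lambda>i. bfam P Q A ?V (s,i)) $$ (a,b)"
        using ab block_carrier[OF P Q Wc, of s z] by (simp add: key[OF z(1)])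
      also have "\<dots> = (\<Sum>i\<in>I. \<Sum>j\<in>J. x i * (y i j * bfam P Q A ?V j $$ (a,b)))"
        using ab y by (simp add: sum_distrib_left)
      also have "\<dots> = (\<Sum>j\<in>J. (\<Sum>i\<in>I. x i * y i j) * bfam P Q A ?V j $$ (a,b))"
        by (subst sum.swap) (simp add: sum_distrib_right mult.assoc)
      finally have e: "(z - 1) * block P Q s (W z) $$ (a,b) = \<dots>" .
      have "lincomb d ?K c (w z) $$ (a,b) = - (z - 1) * block P Q s (W z) $$ (a,b) +
          (\<Sum>j\<in>J. (\<Sum>i\<in>I. x i * y i j) * bfam P Q A ?V j $$ (a,b))"
        using ab finJ by (simp add: c_def w_def sum.reindex)
      also have "\<dots> = 0" unfolding e[symmetric] by (simp add: algebra_simps)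
      finally show "lincomb d ?K c (w z) $$ (a,b) = 0\<^sub>m d d $$ (a,b)" using ab by simp
    qed auto
    then have "c None = 0" by (rule mindepD[where c = c and i = None, OF z(3)]) simp
    then show False using z(2) by (simp add: c_def)
  qed
  then obtain i where i: "i \<in> I" "\<not> in_mspan d J (bfam P Q A ?V) (bfam P Q A ?V (s,i))" by blast
  have notin: "(s,i) \<notin> J"
  proof
    assume "(s,i) \<in> J"
    then have "in_mspan d J (bfam P Q A ?V) (bfam P Q A ?V (s,i))"
      unfolding in_mspan_def using finJ
      by (intro exI[of _ "\<lambda>j. if j = (s,i) then 1 else 0"]) (simp add: if_distrib[of "\<lambda>x. x * _"] cong: if_cong)
    then show False using i by simp
  qed
  have "mindep d (insert (s,i) J) (bfam P Q A ?V)"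
    unfolding mindep_def
    by (rule fam_indep_insert[OF indJ[unfolded mindep_def] finJ notin])
      (use i(2) in \<open>simp only: in_mspan_iff not_False_eq_True\<close>)
  then have "card (insert (s,i) J) \<le> card J"
    by (rule max[OF z(1), rotated]) (use J s i in auto)
  then show False using finJ notin by simp
qed

section \<open>Words of rotations in one coordinate and points of maximal rank\<close>

definition rots :: "nat \<Rightarrow> ((nat \<Rightarrow> complex) \<times> complex) list \<Rightarrow> complex mat \<Rightarrow> complex mat" where
  "rots d ws U = fold (\<lambda>(v,z) U. rot d v z * U) ws U"

lemma rots_snoc: "rots d (ws @ [(v,z)]) U = rot d v z * rots d ws U"
  by (simp add: rots_def)

lemma unitary_rots:
  "unitary_mat d U \<Longrightarrow> set ws \<subseteq> axes d \<times> sphere 0 1 \<Longrightarrow> unitary_mat d (rots d ws U)"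
proof (induction ws rule: rev_induct)
  case Nil
  then show ?case by (simp add: rots_def)
next
  case (snoc w ws)
  obtain v z where w: "w = (v,z)" by fastforce
  then have "v \<in> axes d" "z \<in> sphere 0 1" using snoc.prems(2) by (simp_all add: subset_eq)
  then show ?case using snoc by (simp add: w rots_snoc unitary_mult unitary_rot)
qed

text \<open>The condition is linear in the test matrix, and conjugation by \<open>U\<close> maps
  onto all matrices, so the projections onto the axes suffice.\<close>

lemma comm_conj_span:
  assumes PQ: "complementary d P Q" and U: "unitary_mat d U" and X: "X \<in> carrier_mat d d"
    and outer: "\<And>v. v \<in> axes d \<Longrightarrow> in_mspan d J F (block P Q s (comm X (adj U * outer d v * U)))"
    and A: "A \<in> carrier_mat d d"
  shows "in_mspan d J F (block P Q s (comm X A))"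
proof -
  note [simp] = unitary_matD(3-)[OF U] carrier_matD[OF A] carrier_matD[OF X] complementaryD(3-6)[OF PQ]
  note P = complementaryD(1)[OF PQ] and Q = complementaryD(2)[OF PQ]
  note Uc = unitary_matD(1)[OF U] and Ua = unitary_matD(2)[OF U]
  define T where "T B = block P Q s (comm X (adj U * B * U))" for B
  have c: "comm X (adj U * B * U) \<in> carrier_mat d d" if "B \<in> carrier_mat d d" for B
    by (intro comm_carrier X mult_carrier_mat[where n = d] Ua Uc that)
  have Tc: "T B \<in> carrier_mat d d" if "B \<in> carrier_mat d d" for B
    unfolding T_def by (intro block_carrier P Q c that)
  have "in_mspan d J F (T (U * A * adj U))"
  proof (rule outers_span[where d = d and S = "\<lambda>B. in_mspan d J F (T B)"])
    show "U * A * adj U \<in> carrier_mat d d"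
      by (intro mult_carrier_mat[where n = d] Ua Uc A)
    have "comm X (adj U * 0\<^sub>m d d * U) = 0\<^sub>m d d"
      using X by (auto simp: comm_def mat_ring)
    moreover have "block P Q s (0\<^sub>m d d) = 0\<^sub>m d d" using P Q by (simp add: block_def mat_ring)
    ultimately have "T (0\<^sub>m d d) = 0\<^sub>m d d" by (simp add: T_def)
    then show "in_mspan d J F (T (0\<^sub>m d d))" by (simp add: in_mspan_0)
  next
    fix v assume "v \<in> axes d"
    then show "in_mspan d J F (T (outer d v))" using outer by (simp add: T_def)
  next
    fix B C assume B: "B \<in> carrier_mat d d" and C: "C \<in> carrier_mat d d"
      and sp: "in_mspan d J F (T B)" "in_mspan d J F (T C)"
    note [simp] = carrier_matD[OF B] carrier_matD[OF C]
    have "comm X (adj U * (B + C) * U) = comm X (adj U * B * U) + comm X (adj U * C * U)"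
      by (simp add: comm_def mat_ring) (intro eq_matI, auto simp del: index_mult_mat(1))
    then have "T (B + C) = T B + T C" using block_add[OF P Q c[OF B] c[OF C]] by (simp add: T_def)
    then show "in_mspan d J F (T (B + C))" using in_mspan_add[OF sp Tc[OF C]] by simp
  next
    fix B k assume B: "B \<in> carrier_mat d d" and sp: "in_mspan d J F (T B)"
    note [simp] = carrier_matD[OF B]
    have "comm X (adj U * (k \<cdot>\<^sub>m B) * U) = k \<cdot>\<^sub>m comm X (adj U * B * U)"
      by (simp add: comm_def mat_ring) (intro eq_matI, auto simp del: index_mult_mat(1) simp: algebra_simps)
    then have "T (k \<cdot>\<^sub>m B) = k \<cdot>\<^sub>m T B" using block_smult[OF P Q c[OF B]] by (simp add: T_def)
    then show "in_mspan d J F (T (k \<cdot>\<^sub>m B))" using in_mspan_smult[OF sp Tc[OF B]] by simp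
  qed
  moreover have "adj U * (U * A * adj U) * U = A" by (simp add: mat_ring)
  ultimately show ?thesis by (simp add: T_def)
qed

text \<open>The maximal subfamily \<open>J\<close> may mix the three kinds of blocks. Applying
  \<open>block P Q s\<close> once more kills the foreign kinds, so that \<open>card I\<close>
  matrices span instead of up to \<open>3 * card I\<close>; this is the number that enters the trace
  bounds.\<close>

lemma in_mspan_component:
  assumes PQ: "complementary d P Q" and I: "finite I" and B: "\<And>i. i \<in> I \<Longrightarrow> B i \<in> carrier_mat d d"
    and J: "J \<subseteq> {..<3} \<times> I" and F: "\<And>t i. F (t,i) = block P Q t (B i)"
    and s: "s < 3" and X: "X \<in> carrier_mat d d"
    and sp: "in_mspan d J F (block P Q s X)"
  shows "in_mspan d I (\<lambda>i. block P Q s (B i)) (block P Q s X)"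
proof -
  note P = complementaryD(1)[OF PQ] and Q = complementaryD(2)[OF PQ]
  obtain y where y: "\<And>a b. a < d \<Longrightarrow> b < d \<Longrightarrow> block P Q s X $$ (a,b) = (\<Sum>j\<in>J. y j * F j $$ (a,b))"
    using sp by (auto simp: in_mspan_def)
  define c where "c j = (if j \<in> J then y j else 0)" for j
  have FB: "F j \<in> carrier_mat d d" if "j \<in> {..<3} \<times> I" for j
    using that F B block_carrier[OF P Q] by auto
  have "block P Q s X = lincomb d ({..<3} \<times> I) c F"
  proof (rule eq_matI)
    fix a b assume "a < dim_row (lincomb d ({..<3} \<times> I) c F)" "b < dim_col (lincomb d ({..<3} \<times> I) c F)"
    then have ab: "a < d" "b < d" by auto
    have "(\<Sum>j\<in>{..<3} \<times> I. c j * F j $$ (a,b)) = (\<Sum>j\<in>J. y j * F j $$ (a,b))"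
      using J I by (intro sum.mono_neutral_cong_right) (auto simp: c_def)
    then show "block P Q s X $$ (a,b) = lincomb d ({..<3} \<times> I) c F $$ (a,b)"
      using ab y by simp
  qed (use block_carrier[OF P Q X] in auto)
  then have "block P Q s X = block P Q s (lincomb d ({..<3} \<times> I) c F)"
    using block_block[OF PQ X s s] by simp
  also have "\<dots> = lincomb d ({..<3} \<times> I) c (\<lambda>j. block P Q s (F j))"
    by (rule block_lincomb[OF P Q FB])
  finally have e: "block P Q s X = \<dots>" .
  have "block P Q s X $$ (a,b) = (\<Sum>i\<in>I. c (s,i) * block P Q s (B i) $$ (a,b))" if ab: "a < d" "b < d" for a b
  proof -
    have "block P Q s X $$ (a,b) = (\<Sum>j\<in>{..<3} \<times> I. c j * block P Q s (F j) $$ (a,b))"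
      using e ab by simp
    also have "\<dots> = (\<Sum>t\<in>{..<3}. \<Sum>i\<in>I. c (t,i) * block P Q s (F (t,i)) $$ (a,b))"
      by (simp add: sum.cartesian_product)
    also have "\<dots> = (\<Sum>t\<in>{..<3}. if t = s then \<Sum>i\<in>I. c (s,i) * block P Q s (B i) $$ (a,b) else 0)"
      using ab s block_block[OF PQ B s] by (intro sum.cong refl) (auto simp: F)
    finally show ?thesis using s by simp
  qed
  then show ?thesis unfolding in_mspan_def by (intro exI[of _ "\<lambda>i. c (s,i)"]) simp
qed

text \<open>By the splitting into kinds it is enough that each block map is injective on the span of
  the matrices \<open>B i\<close>. Maximality under one further rotation supplies the commutator
  condition of \<open>block_kernel_trivial\<close>, and that lemma gives the injectivity.\<close>

lemma bfam_indep_at_maximum: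
  assumes PQ: "complementary d P Q" and U: "unitary_mat d U" and I: "finite I"
    and A: "\<And>i. i \<in> I \<Longrightarrow> A i \<in> carrier_mat d d" "\<And>i. i \<in> I \<Longrightarrow> tr (A i) = 0" "mindep d I A"
    and big: "Re (tr P) > 2 * real (card I)" "Re (tr Q) > 2 * real (card I)"
    and J: "J \<subseteq> {..<3} \<times> I" "mindep d J (bfam P Q A U)"
    and max: "\<And>v z J'. v \<in> axes d \<Longrightarrow> z \<in> sphere 0 1 \<Longrightarrow> J' \<subseteq> {..<3} \<times> I \<Longrightarrow>
      mindep d J' (bfam P Q A (rot d v z * U)) \<Longrightarrow> card J' \<le> card J"
  shows "mindep d ({..<3} \<times> I) (bfam P Q A U)"
  unfolding mindep_iff
proof (intro allI impI ballI)
  note P = complementaryD(1)[OF PQ] and Q = complementaryD(2)[OF PQ]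
  note Uc = unitary_matD(1)[OF U] and Ua = unitary_matD(2)[OF U]
  note [simp] = unitary_matD(3-)[OF U]
  define B where "B i = adj U * A i * U" for i
  have Bc: "B i \<in> carrier_mat d d" if "i \<in> I" for i
    unfolding B_def by (intro mult_carrier_mat[where n = d] Ua Uc A that)
  have indB: "mindep d I B"
  proof (rule mindep_sandwich[OF A(3) Uc Ua Bc])
    fix i assume "i \<in> I"
    note [simp] = carrier_matD[OF A(1)[OF this]]
    show "A i = U * B i * adj U" by (simp add: B_def mat_ring)
  qed
  have trB: "tr (B i) = 0" if "i \<in> I" for i
  proof -
    note [simp] = carrier_matD[OF A(1)[OF that]]
    have "tr (adj U * A i * U) = tr (adj U * (A i * U))" by (simp add: mat_ring)
    also have "\<dots> = tr (A i * U * adj U)"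
      by (rule tr_mult_commute[OF Ua mult_carrier_mat[OF A(1)[OF that] Uc]])
    also have "\<dots> = tr (A i)" by (simp add: mat_ring)
    finally show ?thesis using A(2)[OF that] by (simp add: B_def)
  qed
  have FB: "bfam P Q A U (t,i) = block P Q t (B i)" for t i by (simp add: bfam_def B_def)
  have kernel: "x i = 0" if s: "s < 3" "block P Q s (lincomb d I x B) = 0\<^sub>m d d" and i: "i \<in> I" for s x i
  proof -
    let ?X = "lincomb d I x B"
    have XB: "?X = lincomb d I x (\<lambda>i. adj U * A i * U)" by (simp add: B_def[abs_def])
    have "?X = 0\<^sub>m d d"
    proof (rule block_kernel_trivial[where X = ?X and B = "\<lambda>s i. block P Q s (B i)",
          OF PQ lincomb_carrier tr_lincomb[OF Bc trB] I big s])
      fix t :: nat and N :: "complex mat"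
      assume t: "t < 3" "block P Q t ?X = 0\<^sub>m d d" and N: "N \<in> carrier_mat d d"
      have "in_mspan d J (bfam P Q A U) (block P Q t (comm ?X N))"
      proof (rule comm_conj_span[OF PQ U lincomb_carrier _ N])
        fix v assume v: "v \<in> axes d"
        show "in_mspan d J (bfam P Q A U) (block P Q t (comm ?X (adj U * outer d v * U)))"
          by (rule tangent_in_span[OF PQ U I A(1) J max[OF v] t(1) XB t(2)])
      qed
      then show "in_mspan d I (\<lambda>i. block P Q t (B i)) (block P Q t (comm ?X N))"
        using in_mspan_component[where F = "bfam P Q A U" and B = B and X = "comm ?X N",
            OF PQ I Bc J(1) FB t(1) comm_carrier[OF lincomb_carrier N]] by blast
    qed
    then show ?thesis using indB i unfolding mindep_iff by metis
  qed
  fix c si assume c: "lincomb d ({..<3} \<times> I) c (bfam P Q A U) = 0\<^sub>m d d" and si: "si \<in> {..<3 :: nat} \<times> I"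
  obtain s i where si': "si = (s,i)" "s < 3" "i \<in> I" using si by auto
  have "block P Q s (lincomb d I (\<lambda>i. c (s,i)) B) = 0\<^sub>m d d"
  proof (rule eq_matI)
    fix a b assume "a < dim_row (0\<^sub>m d d :: complex mat)" "b < dim_col (0\<^sub>m d d :: complex mat)"
    then have ab: "a < d" "b < d" by simp_all
    have "block P Q s (lincomb d I (\<lambda>i. c (s,i)) B) $$ (a,b) = (\<Sum>i\<in>I. c (s,i) * block P Q s (B i) $$ (a,b))"
      using ab by (simp add: block_lincomb[OF P Q Bc])
    also have "\<dots> = (\<Sum>t\<in>{..<3}. if t = s then \<Sum>i\<in>I. c (s,i) * block P Q s (B i) $$ (a,b) else 0)"
      using si' by simp
    also have "\<dots> = (\<Sum>t\<in>{..<3}. \<Sum>i\<in>I. c (t,i) * block P Q s (bfam P Q A U (t,i)) $$ (a,b))"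
      using ab si' block_block[OF PQ Bc si'(2)] by (intro sum.cong refl) (auto simp: bfam_def B_def)
    also have "\<dots> = (\<Sum>j\<in>{..<3} \<times> I. c j * block P Q s (bfam P Q A U j) $$ (a,b))"
      by (simp add: sum.cartesian_product)
    also have "\<dots> = lincomb d ({..<3} \<times> I) c (\<lambda>j. block P Q s (bfam P Q A U j)) $$ (a,b)"
      using ab by simp
    also have "\<dots> = block P Q s (lincomb d ({..<3} \<times> I) c (bfam P Q A U)) $$ (a,b)"
    proof -
      have "bfam P Q A U j \<in> carrier_mat d d" if "j \<in> {..<3} \<times> I" for j
        using that Bc block_carrier[OF P Q] by (auto simp: FB)
      then show ?thesis by (simp only: block_lincomb[OF P Q])
    qed
    also have "\<dots> = 0" using P Q ab by (simp add: c block_def mat_zero)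
    finally show "block P Q s (lincomb d I (\<lambda>i. c (s,i)) B) $$ (a,b) = 0\<^sub>m d d $$ (a,b)" using ab by simp
  qed (use carrier_matD[OF block_carrier[OF P Q lincomb_carrier]] in auto)
  from kernel[OF si'(2) this si'(3)] show "c si = 0" by (simp add: si'(1))
qed

section \<open>Reflections and the maps \<open>Phi\<close>\<close>

lemma complementary_reflection:
  assumes H: "H \<in> carrier_mat d d" "H * H = 1\<^sub>m d"
  shows "complementary d ((1/2) \<cdot>\<^sub>m (1\<^sub>m d + H)) ((1/2) \<cdot>\<^sub>m (1\<^sub>m d - H))"
proof -
  note [simp] = carrier_matD[OF H(1)]
  show ?thesis
    unfolding complementary_def
    using H by (simp add: mat_ring minus_carrier_mat)
      (auto intro!: eq_matI simp del: index_mult_mat(1) simp: field_simps)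
qed

lemma Phi_carrier:
  "K \<in> carrier_mat d d \<Longrightarrow> X \<in> carrier_mat d d \<Longrightarrow> Phi K k X \<in> carrier_mat d d"
  by (auto simp: Phi_def minus_carrier_mat)

lemma tr_Phi:
  assumes K: "K \<in> carrier_mat d d" "K * K = 1\<^sub>m d" and X: "X \<in> carrier_mat d d" "tr X = 0"
  shows "tr (Phi K k X) = 0"
proof -
  note [simp] = carrier_matD[OF K(1)] carrier_matD[OF X(1)]
  have "tr (K * X * K) = tr (K * (K * X))"
    using tr_mult_commute[of "K * X" d d K] K X by simp
  also have "\<dots> = tr ((K * K) * X)" by (simp only: mat_assoc carrier_matD[OF K(1)] carrier_matD[OF X(1)])
  finally have KXK: "tr (K * X * K) = 0" using K X by simp
  have KX: "tr (K * X) = tr (X * K)" by (rule tr_mult_commute[OF K(1) X(1)])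
  have c: "K * X * K \<in> carrier_mat d d" "K * X \<in> carrier_mat d d" "X * K \<in> carrier_mat d d"
    using K X by auto
  show ?thesis
    unfolding Phi_def using X c KXK KX
    by (auto simp: tr_smult[of _ d] tr_add[OF X(1) c(1)] tr_diff[OF X(1) c(1)] tr_diff[OF c(2,3)] minus_carrier_mat
        simp del: index_mult_mat(1))
qed

text \<open>Conjugation moves the rotation from the generator to the argument, so the rotated
  matrices can be studied against the fixed projections \<open>P\<close> and \<open>Q\<close> of
  \<open>H\<close>.\<close>

lemma Phi_conj:
  assumes U: "unitary_mat d U" and H: "H \<in> carrier_mat d d" and A: "A \<in> carrier_mat d d"
  shows "adj U * Phi (U * H * adj U) k A * U = Phi H k (adj U * A * U)"
proof -
  note [simp] = unitary_matD(3-)[OF U] carrier_matD[OF A] carrier_matD[OF H]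
  show ?thesis by (simp add: Phi_def mat_ring)
qed

lemma Phi_blocks:
  assumes H: "H \<in> carrier_mat d d" "H * H = 1\<^sub>m d" and X: "X \<in> carrier_mat d d"
    and P: "P = (1/2) \<cdot>\<^sub>m (1\<^sub>m d + H)" and Q: "Q = (1/2) \<cdot>\<^sub>m (1\<^sub>m d - H)"
  shows "Phi H 0 X = block P Q 0 X" "Phi H 1 X = block P Q 1 X + block P Q 2 X"
    "Phi H 2 X = \<i> \<cdot>\<^sub>m (block P Q 1 X - block P Q 2 X)"
proof -
  note [simp] = carrier_matD[OF H(1)] carrier_matD[OF X]
  show "Phi H 0 X = block P Q 0 X" "Phi H 1 X = block P Q 1 X + block P Q 2 X"
    "Phi H 2 X = \<i> \<cdot>\<^sub>m (block P Q 1 X - block P Q 2 X)"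
    unfolding P Q Phi_def block_def
    by (simp add: mat_ring, intro eq_matI, auto simp del: index_mult_mat(1) simp: field_simps)+
qed

lemma Phi_indep_of_bfam:
  assumes H: "H \<in> carrier_mat d d" "H * H = 1\<^sub>m d" and U: "unitary_mat d U"
    and P: "P = (1/2) \<cdot>\<^sub>m (1\<^sub>m d + H)" and Q: "Q = (1/2) \<cdot>\<^sub>m (1\<^sub>m d - H)"
    and I: "finite I" and A: "\<And>i. i \<in> I \<Longrightarrow> A i \<in> carrier_mat d d"
    and ind: "mindep d ({..<3} \<times> I) (bfam P Q A U)"
  shows "mindep d ({..<3} \<times> I) (\<lambda>(k,i). Phi (U * H * adj U) k (A i))"
proof -
  note Uc = unitary_matD(1)[OF U] and Ua = unitary_matD(2)[OF U]
  have Hc: "U * H * adj U \<in> carrier_mat d d" by (intro mult_carrier_mat[where n = d] Uc Ua H)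
  define B where "B i = adj U * A i * U" for i
  have Bc: "B i \<in> carrier_mat d d" if "i \<in> I" for i
    unfolding B_def by (intro mult_carrier_mat[where n = d] Ua Uc A that)
  have FB: "bfam P Q A U (t,i) = block P Q t (B i)" for t i by (simp add: bfam_def B_def)
  have PQ: "P \<in> carrier_mat d d" "Q \<in> carrier_mat d d" using H by (auto simp: P Q minus_carrier_mat)
  let ?F = "\<lambda>(k,i). Phi H k (B i)"
  have "mindep d ({..<3} \<times> I) ?F"
    unfolding mindep_iff
  proof (intro allI impI ballI)
    fix c j assume c: "lincomb d ({..<3} \<times> I) c ?F = 0\<^sub>m d d" and j: "j \<in> {..<3 :: nat} \<times> I"
    \<comment> \<open>These are the coefficients of the blocks after \<open>Phi_blocks\<close> is
      inserted. Between the kinds 1 and 2 they are a linear substitution of determinant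
      \<open>-2 * \<i>\<close>, hence invertible.\<close>
    define e where "e = (\<lambda>(k,i). if k = 0 then c (0,i) else if k = (1::nat) then c (1,i) + \<i> * c (2,i)
      else c (1,i) - \<i> * c (2,i))"
    have split: "(\<Sum>j\<in>{..<3} \<times> I. f j) = (\<Sum>i\<in>I. f (0,i) + f (1,i) + f (2,i))" for f :: "nat \<times> _ \<Rightarrow> complex"
    proof -
      have "(\<Sum>j\<in>{..<3} \<times> I. f j) = (\<Sum>k\<in>{..<3}. \<Sum>i\<in>I. f (k,i))"
        by (simp add: sum.cartesian_product)
      also have "\<dots> = (\<Sum>i\<in>I. f (0,i)) + (\<Sum>i\<in>I. f (1,i)) + (\<Sum>i\<in>I. f (2,i))"
        by (simp add: eval_nat_numeral lessThan_Suc add_ac)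
      finally show ?thesis by (simp add: sum.distrib)
    qed
    have "lincomb d ({..<3} \<times> I) e (bfam P Q A U) = lincomb d ({..<3} \<times> I) c ?F"
    proof (rule eq_matI)
      fix a b assume "a < dim_row (lincomb d ({..<3} \<times> I) c ?F)" "b < dim_col (lincomb d ({..<3} \<times> I) c ?F)"
      then have ab: "a < d" "b < d" by simp_all
      have "e (0,i) * block P Q 0 (B i) $$ (a,b) + e (1,i) * block P Q 1 (B i) $$ (a,b) + e (2,i) * block P Q 2 (B i) $$ (a,b)
        = c (0,i) * Phi H 0 (B i) $$ (a,b) + c (1,i) * Phi H 1 (B i) $$ (a,b) + c (2,i) * Phi H 2 (B i) $$ (a,b)"
        if i: "i \<in> I" for i
      proof -
        note b = block_carrier[OF PQ Bc[OF i]]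
        note [simp] = carrier_matD[OF b]
        show ?thesis
          unfolding Phi_blocks[OF H Bc[OF i] P Q]
          using ab by (simp add: e_def algebra_simps)
      qed
      then show "lincomb d ({..<3} \<times> I) e (bfam P Q A U) $$ (a,b) = lincomb d ({..<3} \<times> I) c ?F $$ (a,b)"
        using ab by (simp add: split FB cong: sum.cong)
    qed simp_all
    then have e0: "e j = 0" if "j \<in> {..<3} \<times> I" for j
      using mindepD[where c = e, OF ind _ that] c by simp
    obtain k i where ki: "j = (k,i)" "k < 3" "i \<in> I" using j by auto
    have "e (0,i) = 0" "e (1,i) = 0" "e (2,i) = 0" using e0 ki by auto
    then have z: "c (0,i) = 0" "c (1,i) + \<i> * c (2,i) = 0" "c (1,i) - \<i> * c (2,i) = 0"
      by (simp_all add: e_def)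
    then have "2 * c (1,i) = 0" "2 * \<i> * c (2,i) = 0" by (simp_all add: algebra_simps)
    then have "c (0,i) = 0" "c (1,i) = 0" "c (2,i) = 0" using z(1) by simp_all
    moreover have "k = 0 \<or> k = 1 \<or> k = 2" using ki(2) by auto
    ultimately show "c j = 0" using ki(1) by auto
  qed
  then show ?thesis
  proof (rule mindep_sandwich[OF _ Ua Uc])
    fix j assume "j \<in> {..<3 :: nat} \<times> I"
    then obtain k i where ki: "j = (k,i)" "i \<in> I" by auto
    show "(case j of (k, i) \<Rightarrow> Phi (U * H * adj U) k (A i)) \<in> carrier_mat d d"
      using Phi_carrier[OF Hc A] ki by simp
    show "(case j of (k, i) \<Rightarrow> Phi H k (B i)) = adj U * (case j of (k, i) \<Rightarrow> Phi (U * H * adj U) k (A i)) * U"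
      using Phi_conj[OF U H(1) A] ki by (simp add: B_def)
  qed
qed

text \<open>Since \<open>tr H = 0\<close>, both spectral projections have trace
  \<open>d / 2\<close>, and \<open>4 * card I < d\<close> becomes the trace condition of
  \<open>bfam_indep_at_maximum\<close>. The rank is bounded by \<open>3 * card I\<close>, so some
  word attains its maximum; appending a letter gives another word, and the rank does not
  grow.\<close>

lemma exists_rots_Phi_indep:
  assumes H: "H \<in> carrier_mat d d" "H * H = 1\<^sub>m d" "tr H = 0" and U: "unitary_mat d U" and I: "finite I"
    and A: "\<And>i. i \<in> I \<Longrightarrow> A i \<in> carrier_mat d d" "\<And>i. i \<in> I \<Longrightarrow> tr (A i) = 0" "mindep d I A"
    and big: "4 * card I < d"
  shows "\<exists>ws. set ws \<subseteq> axes d \<times> sphere 0 1 \<and>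
    mindep d ({..<3} \<times> I) (\<lambda>(k,i). Phi (rots d ws U * H * adj (rots d ws U)) k (A i))"
proof -
  define P where "P = (1/2 :: complex) \<cdot>\<^sub>m (1\<^sub>m d + H)"
  define Q where "Q = (1/2 :: complex) \<cdot>\<^sub>m (1\<^sub>m d - H)"
  have PQ: "complementary d P Q" unfolding P_def Q_def by (rule complementary_reflection[OF H(1,2)])
  have trP: "tr P = of_nat d / 2" using H by (simp add: P_def tr_smult[of _ d] tr_add[of _ d] tr_one)
  have trQ: "tr Q = of_nat d / 2"
    using H by (simp add: Q_def tr_smult[of _ d] tr_diff[of _ d] tr_one minus_carrier_mat)
  have bigPQ: "Re (tr P) > 2 * real (card I)" "Re (tr Q) > 2 * real (card I)"
    using big by (simp_all add: trP trQ)
  \<comment> \<open>Words are paired with independent subfamilies, so that a single maximum provides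
    both the word and the subfamily that attains the rank.\<close>
  define good where "good = (\<lambda>(ws,J). set ws \<subseteq> axes d \<times> sphere 0 1 \<and> J \<subseteq> {..<3} \<times> I \<and>
    mindep d J (bfam P Q A (rots d ws U)))"
  have fin: "finite ({..<3 :: nat} \<times> I)" using I by simp
  have "good ([],{})" by (simp add: good_def mindep_iff)
  moreover have "\<forall>y. good y \<longrightarrow> card (snd y) < card ({..<3 :: nat} \<times> I) + 1"
    using card_mono[OF fin] by (auto simp: good_def less_Suc_eq_le)
  ultimately obtain wJ where wJ: "good wJ" "\<And>y. good y \<Longrightarrow> card (snd y) \<le> card (snd wJ)"
    using ex_has_greatest_nat[of good "([],{})" "\<lambda>y. card (snd y)"] by blast
  obtain ws J where w: "wJ = (ws,J)" by (cases wJ)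
  have ws: "set ws \<subseteq> axes d \<times> sphere 0 1" and J: "J \<subseteq> {..<3} \<times> I" "mindep d J (bfam P Q A (rots d ws U))"
    using wJ(1) by (auto simp: w good_def)
  have V: "unitary_mat d (rots d ws U)" by (rule unitary_rots[OF U ws])
  have "mindep d ({..<3} \<times> I) (bfam P Q A (rots d ws U))"
  proof (rule bfam_indep_at_maximum[OF PQ V I A bigPQ J])
    fix v z J' assume "v \<in> axes d" "z \<in> sphere 0 1" "J' \<subseteq> {..<3} \<times> I"
      "mindep d J' (bfam P Q A (rot d v z * rots d ws U))"
    then have "good (ws @ [(v,z)], J')" using ws by (simp add: good_def rots_snoc)
    then show "card J' \<le> card J" using wJ(2) w by fastforce
  qed
  then have "mindep d ({..<3} \<times> I) (\<lambda>(k,i). Phi (rots d ws U * H * adj (rots d ws U)) k (A i))"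
    using Phi_indep_of_bfam[OF H(1,2) V P_def Q_def I, of A] A(1) by blast
  then show ?thesis using ws by blast
qed

section \<open>Words of rotations\<close>

type_synonym generator = "nat \<times> (nat \<Rightarrow> complex)"

definition act :: "nat \<Rightarrow> generator \<Rightarrow> complex \<Rightarrow> (nat \<Rightarrow> complex mat) \<Rightarrow> nat \<Rightarrow> complex mat" where
  "act d g z W = W(fst g := rot d (snd g) z * W (fst g))"

definition acts :: "nat \<Rightarrow> (generator \<times> complex) list \<Rightarrow> (nat \<Rightarrow> complex mat) \<Rightarrow> nat \<Rightarrow> complex mat" where
  "acts d u W = fold (\<lambda>(g,z). act d g z) u W"

definition gens :: "nat \<Rightarrow> nat \<Rightarrow> generator set" where
  "gens d p = {1..p} \<times> axes d"

definition words :: "nat \<Rightarrow> nat \<Rightarrow> (generator \<times> complex) list set" where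
  "words d p = lists (gens d p \<times> sphere 0 1)"

lemma acts_simps: "acts d [] W = W" "acts d ((g,z) # u) W = acts d u (act d g z W)"
  by (simp_all add: acts_def)

lemma acts_append: "acts d (u @ w) W = acts d w (acts d u W)"
  by (simp add: acts_def)

lemma act_simps: "act d (l,v) z W = W(l := rot d v z * W l)"
  by (simp add: act_def)

lemma acts_other: "u \<in> words d p \<Longrightarrow> p < l \<Longrightarrow> acts d u W l = W l"
proof (induction u arbitrary: W)
  case (Cons a u)
  obtain k v z where a: "a = ((k,v),z)" by (metis surj_pair)
  then have "k \<noteq> l" using Cons.prems by (auto simp: words_def gens_def)
  then show ?case using Cons a by (simp add: acts_simps act_simps words_def)
qed (simp add: acts_simps)

lemma acts_coordinate: "acts d (map (\<lambda>(v,z). ((l,v),z)) ws) W = W(l := rots d ws (W l))"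
proof (induction ws arbitrary: W)
  case (Cons a ws)
  obtain v z where "a = (v,z)" by fastforce
  then show ?case by (auto simp: Cons acts_simps act_simps rots_def fun_eq_iff)
qed (simp add: acts_simps rots_def)

definition head_zero :: "nat \<Rightarrow> (nat \<Rightarrow> nat) \<Rightarrow> nat \<Rightarrow> nat" where
  "head_zero p xi = (\<lambda>l. if l \<in> {1..p} then 0 else xi l)"

text \<open>\<open>I\<close> holds multi-indices whose entries up to \<open>p\<close> still vanish
  while those above may already be chosen; the extensions fill in the entries up to
  \<open>p\<close>.\<close>

definition extensions :: "nat \<Rightarrow> (nat \<Rightarrow> nat) set \<Rightarrow> (nat \<Rightarrow> nat) set" where
  "extensions p I = {xi. (\<forall>l\<in>{1..p}. xi l < 3) \<and> head_zero p xi \<in> I}"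

lemma head_zero_Suc: "head_zero (Suc p) xi = (head_zero p xi)(Suc p := 0)"
  by (auto simp: head_zero_def)

text \<open>\<open>Phi_xi\<close> applies the map of the highest coordinate first. So a word is
  first found for that coordinate, and the images under its three maps, still traceless by
  \<open>tr_Phi\<close>, become the family for the lower coordinates. The word found there leaves
  the highest coordinate alone and does not spoil the choice. Each coordinate triples the family,
  for which the factor \<open>3 ^ p\<close> pays.\<close>

lemma exists_acts_Phi_xi_indep:
  assumes H: "H \<in> carrier_mat d d" "H * H = 1\<^sub>m d" "tr H = 0"
  shows "finite I \<Longrightarrow> (\<And>i l. i \<in> I \<Longrightarrow> l \<in> {1..p} \<Longrightarrow> i l = 0) \<Longrightarrow>
    (\<And>i. i \<in> I \<Longrightarrow> A i \<in> carrier_mat d d) \<Longrightarrow> (\<And>i. i \<in> I \<Longrightarrow> tr (A i) = 0) \<Longrightarrow>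
    mindep d I A \<Longrightarrow> 4 * card I * 3 ^ p < d \<Longrightarrow> (\<And>l. l \<in> {1..p} \<Longrightarrow> unitary_mat d (W l)) \<Longrightarrow>
    \<exists>u\<in>words d p. mindep d (extensions p I)
      (\<lambda>xi. Phi_xi (\<lambda>l. acts d u W l * H * adj (acts d u W l)) xi p (A (head_zero p xi)))"
proof (induction p arbitrary: I A W)
  case 0
  have "extensions 0 I = I" by (auto simp: extensions_def head_zero_def)
  then show ?case using 0 by (intro bexI[of _ "[]"]) (simp_all add: head_zero_def words_def)
next
  case (Suc p)
  note fin = Suc.prems(1) and A = Suc.prems(3-5)
  have i0: "i (Suc p) = 0" if "i \<in> I" for i using Suc.prems(2)[OF that, of "Suc p"] by simp
  have U: "unitary_mat d (W (Suc p))" using Suc.prems(7) by simp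
  have "4 * card I * 1 \<le> 4 * card I * 3 ^ Suc p" by (intro mult_left_mono) simp_all
  then have "4 * card I < d" using Suc.prems(6) by linarith
  then have "\<exists>ws. set ws \<subseteq> axes d \<times> sphere 0 1 \<and>
      mindep d ({..<3} \<times> I) (\<lambda>(k,i). Phi (rots d ws (W (Suc p)) * H * adj (rots d ws (W (Suc p)))) k (A i))"
    by (intro exists_rots_Phi_indep[OF H U fin] A)
  then obtain ws where ws: "set ws \<subseteq> axes d \<times> sphere 0 1"
    "mindep d ({..<3} \<times> I) (\<lambda>(k,i). Phi (rots d ws (W (Suc p)) * H * adj (rots d ws (W (Suc p)))) k (A i))"
    by (elim exE conjE)
  define V where "V = rots d ws (W (Suc p))"
  have V: "unitary_mat d V" unfolding V_def by (rule unitary_rots[OF U ws(1)])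
  note Vc = unitary_matD(1,2)[OF V]
  define K where "K = V * H * adj V"
  have K: "K \<in> carrier_mat d d" unfolding K_def by (intro mult_carrier_mat[where n = d] Vc H)
  have KK: "K * K = 1\<^sub>m d"
  proof -
    note [simp] = unitary_matD(3-)[OF V] carrier_matD[OF H(1)]
    have "H * (H * adj V) = adj V" using H(2) by (simp flip: mat_assoc)
    then show ?thesis by (simp add: K_def mat_ring)
  qed
  \<comment> \<open>The choice \<open>k\<close> for the coordinate \<open>Suc p\<close> is stored in
    the index itself, and \<open>A'\<close> reads it off again; the new family is thus once more
    indexed by multi-indices, as the induction hypothesis requires.\<close>
  define f where "f = (\<lambda>(k,i). i(Suc p := k) :: nat \<Rightarrow> nat)"
  define I' where "I' = f ` ({..<3} \<times> I)"
  define A' where "A' i = Phi K (i (Suc p)) (A (i(Suc p := 0)))" for i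
  have red: "(i(Suc p := k))(Suc p := 0) = i" if "i \<in> I" for i k using i0[OF that] by auto
  have inj: "inj_on f ({..<3} \<times> I)"
  proof (rule inj_onI)
    fix x y assume xy: "x \<in> {..<3} \<times> I" "y \<in> {..<3} \<times> I" "f x = f y"
    obtain k i k' i' where e: "x = (k,i)" "y = (k',i')" by fastforce
    have "i(Suc p := k) = i'(Suc p := k')" using xy(3) by (simp add: f_def e)
    then have "(i(Suc p := k)) (Suc p) = (i'(Suc p := k')) (Suc p)"
      "(i(Suc p := k))(Suc p := 0) = (i'(Suc p := k'))(Suc p := 0)" by simp_all
    then show "x = y" using red xy e by simp
  qed
  have A'f: "A' (i(Suc p := k)) = Phi K k (A i)" if "i \<in> I" for k i
    by (simp add: A'_def red[OF that] del: fun_upd_upd)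
  have ind': "mindep d I' A'"
  proof -
    have "mindep d ({..<3} \<times> I) (\<lambda>j. A' (f j))"
      using ws(2) unfolding mindep_def
      by (rule fam_indep_cong[THEN iffD1, rotated]) (auto simp: f_def A'f K_def V_def)
    then show ?thesis
      unfolding mindep_def by (subst fam_indep_reindex[OF inj_on_imp_bij_betw[OF inj, folded I'_def]])
  qed
  have "card I' \<le> 3 * card I" unfolding I'_def using card_image_le[of "{..<3} \<times> I" f] fin by simp
  then have "4 * card I' * 3 ^ p \<le> 4 * (3 * card I) * 3 ^ p" by (intro mult_right_mono mult_left_mono) simp_all
  also have "\<dots> < d" using Suc.prems(6) by simp
  finally have big: "4 * card I' * 3 ^ p < d" .
  define W1 where "W1 = W(Suc p := V)"
  obtain u where u: "u \<in> words d p" "mindep d (extensions p I')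
      (\<lambda>xi. Phi_xi (\<lambda>l. acts d u W1 l * H * adj (acts d u W1 l)) xi p (A' (head_zero p xi)))"
  proof (rule bexE[OF Suc.IH[of I' A' W1]])
    show "finite I'" using fin by (simp add: I'_def)
    fix i assume "i \<in> I'"
    then obtain k j where kj: "i = j(Suc p := k)" "j \<in> I" by (auto simp: I'_def f_def)
    show "i l = 0" if "l \<in> {1..p}" for l using that kj Suc.prems(2)[OF kj(2), of l] by simp
    show "A' i \<in> carrier_mat d d" using Phi_carrier[OF K A(1)[OF kj(2)]] by (simp add: kj A'f)
    show "tr (A' i) = 0" using tr_Phi[OF K KK A(1,2)[OF kj(2)]] by (simp add: kj A'f)
  next
    show "unitary_mat d (W1 l)" if "l \<in> {1..p}" for l
      using Suc.prems(7)[of l] that by (simp add: W1_def)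
  qed (use ind' big in auto)
  define u1 where "u1 = map (\<lambda>(v,z). ((Suc p,v),z)) ws"
  have u1: "u1 \<in> words d (Suc p)" using ws(1) by (auto simp: u1_def words_def gens_def)
  have "u1 @ u \<in> words d (Suc p)" using u1 u(1) by (auto simp: words_def gens_def)
  moreover have acts: "acts d (u1 @ u) W = acts d u W1"
    by (simp add: acts_append u1_def acts_coordinate W1_def V_def)
  moreover have "mindep d (extensions (Suc p) I)
      (\<lambda>xi. Phi_xi (\<lambda>l. acts d u W1 l * H * adj (acts d u W1 l)) xi (Suc p) (A (head_zero (Suc p) xi)))"
  proof -
    have "extensions (Suc p) I = extensions p I'"
    proof (rule Set.set_eqI)
      fix xi :: "nat \<Rightarrow> nat"
      have hz: "head_zero p xi = (head_zero (Suc p) xi)(Suc p := xi (Suc p))"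
        by (auto simp: head_zero_def)
      have "head_zero p xi \<in> I' \<longleftrightarrow> xi (Suc p) < 3 \<and> head_zero (Suc p) xi \<in> I"
      proof
        assume "head_zero p xi \<in> I'"
        then obtain k j where kj: "head_zero p xi = j(Suc p := k)" "j \<in> I" "k < 3" by (auto simp: I'_def f_def)
        then have "head_zero (Suc p) xi = j" using red by (simp add: head_zero_Suc del: fun_upd_upd)
        moreover have "xi (Suc p) = k" using fun_cong[OF kj(1), of "Suc p"] by (simp add: head_zero_def)
        ultimately show "xi (Suc p) < 3 \<and> head_zero (Suc p) xi \<in> I" using kj by simp
      next
        assume "xi (Suc p) < 3 \<and> head_zero (Suc p) xi \<in> I"
        then show "head_zero p xi \<in> I'"
          unfolding I'_def by (intro image_eqI[of _ f "(xi (Suc p), head_zero (Suc p) xi)"]) (simp_all add: f_def hz)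
      qed
      then show "xi \<in> extensions (Suc p) I \<longleftrightarrow> xi \<in> extensions p I'"
        by (auto simp: extensions_def atLeastAtMostSuc_conv)
    qed
    moreover have "A' (head_zero p xi) = Phi (acts d u W1 (Suc p) * H * adj (acts d u W1 (Suc p))) (xi (Suc p)) (A (head_zero (Suc p) xi))" for xi
    proof -
      have "acts d u W1 (Suc p) = V" using acts_other[OF u(1), of "Suc p" W1] by (simp add: W1_def)
      then show ?thesis by (simp add: A'_def K_def head_zero_Suc) (simp add: head_zero_def)
    qed
    ultimately show ?thesis using u(2) by simp
  qed
  ultimately show ?case by (intro bexI[of _ "u1 @ u"]) simp_all
qed

lemma mindep_singleton:
  assumes "M \<in> carrier_mat d d" "M \<noteq> 0\<^sub>m d d"
  shows "mindep d {i} (\<lambda>_. M)"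
  unfolding mindep_iff
proof (intro allI impI ballI)
  fix c j assume c: "lincomb d {i} c (\<lambda>_. M) = 0\<^sub>m d d" and j: "j \<in> {i}"
  have "\<exists>a<d. \<exists>b<d. M $$ (a,b) \<noteq> 0"
  proof (rule ccontr)
    assume "\<not> ?thesis"
    then have "M = 0\<^sub>m d d" using assms(1) by (intro eq_matI) auto
    then show False using assms(2) by simp
  qed
  then obtain a b where ab: "a < d" "b < d" "M $$ (a,b) \<noteq> 0" by blast
  have "lincomb d {i} c (\<lambda>_. M) $$ (a,b) = 0" using ab by (simp add: c)
  then show "c j = 0" using ab j by simp
qed

section \<open>The index set, and real versus complex independence\<close>

lemma finite_xi_box: "finite {xi :: nat \<Rightarrow> nat. (\<forall>l\<in>{1..p}. xi l < 3) \<and> (\<forall>l. l \<notin> {1..p} \<longrightarrow> xi l = 0)}"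
proof (rule finite_subset)
  show "{xi :: nat \<Rightarrow> nat. (\<forall>l\<in>{1..p}. xi l < 3) \<and> (\<forall>l. l \<notin> {1..p} \<longrightarrow> xi l = 0)}
      \<subseteq> {xi. \<forall>l. (l \<in> {1..p} \<longrightarrow> xi l \<in> {..<3}) \<and> (l \<notin> {1..p} \<longrightarrow> xi l = 0)}" by auto
  show "finite {xi :: nat \<Rightarrow> nat. \<forall>l. (l \<in> {1..p} \<longrightarrow> xi l \<in> {..<3}) \<and> (l \<notin> {1..p} \<longrightarrow> xi l = 0)}"
    by (rule finite_set_of_finite_funs) simp_all
qed

lemma xi_set_subset:
  "xi_set p \<subseteq> {xi. (\<forall>l\<in>{1..p}. xi l < 3) \<and> (\<forall>l. l \<notin> {1..p} \<longrightarrow> xi l = 0)}"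
proof
  fix xi assume xi: "xi \<in> xi_set p"
  have "xi l < 3" for l
  proof -
    have "xi l \<in> {0,1,2}" using xi by (simp add: xi_set_def)
    then show ?thesis by auto
  qed
  then show "xi \<in> {xi. (\<forall>l\<in>{1..p}. xi l < 3) \<and> (\<forall>l. l \<notin> {1..p} \<longrightarrow> xi l = 0)}"
    using xi by (simp add: xi_set_def)
qed

lemma extensions_zero:
  "extensions p {\<lambda>_. 0} = {xi. (\<forall>l\<in>{1..p}. xi l < 3) \<and> (\<forall>l. l \<notin> {1..p} \<longrightarrow> xi l = 0)}"
  by (auto simp: extensions_def head_zero_def fun_eq_iff)

lemma finite_xi_set: "finite (xi_set p)"
  by (rule finite_subset[OF xi_set_subset finite_xi_box])

definition re_im :: "complex mat \<Rightarrow> (nat \<times> nat) \<times> bool \<Rightarrow> complex" where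
  "re_im A = (\<lambda>(e,b). complex_of_real (if b then Re (A $$ e) else Im (A $$ e)))"

text \<open>Real linear independence becomes complex linear independence once every matrix is replaced
  by the real and imaginary parts of its entries.\<close>

lemma qnn_lin_indep_iff:
  "qnn_lin_indep d p Hs M \<longleftrightarrow>
    fam_indep (xi_set p) (({..<d} \<times> {..<d}) \<times> UNIV) (\<lambda>xi. re_im (Phi_xi Hs xi p M))"
  (is "_ \<longleftrightarrow> fam_indep ?X ?E ?v")
proof -
  let ?F = "\<lambda>xi. Phi_xi Hs xi p M"
  have comp: "(\<forall>e\<in>?E. (\<Sum>xi\<in>?X. c xi * ?v xi e) = 0) \<longleftrightarrow>
      (\<forall>i<d. \<forall>j<d. (\<Sum>xi\<in>?X. c xi * of_real (Re (?F xi $$ (i,j)))) = 0 \<and>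
        (\<Sum>xi\<in>?X. c xi * of_real (Im (?F xi $$ (i,j)))) = 0)" for c :: "_ \<Rightarrow> complex"
    by (auto simp: re_im_def all_bool_eq)
  have real: "(\<Sum>xi\<in>?X. complex_of_real (r xi) * ?F xi $$ (i,j)) = 0 \<longleftrightarrow>
      (\<Sum>xi\<in>?X. r xi * Re (?F xi $$ (i,j))) = 0 \<and> (\<Sum>xi\<in>?X. r xi * Im (?F xi $$ (i,j))) = 0" for r i j
    by (simp add: complex_eq_iff)
  show ?thesis
  proof
    assume q: "qnn_lin_indep d p Hs M"
    show "fam_indep ?X ?E ?v"
    proof (rule fam_indepI)
      fix c xi assume "\<forall>e\<in>?E. (\<Sum>xi\<in>?X. c xi * ?v xi e) = 0" and xi: "xi \<in> ?X"
      then have c: "\<forall>i<d. \<forall>j<d. (\<Sum>xi\<in>?X. c xi * of_real (Re (?F xi $$ (i,j)))) = 0 \<and>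
        (\<Sum>xi\<in>?X. c xi * of_real (Im (?F xi $$ (i,j)))) = 0" unfolding comp by simp
      have "(\<Sum>xi\<in>?X. complex_of_real (Re (c xi)) * ?F xi $$ (i,j)) = 0"
        "(\<Sum>xi\<in>?X. complex_of_real (Im (c xi)) * ?F xi $$ (i,j)) = 0" if "i < d" "j < d" for i j
        using c that unfolding real by (simp_all add: complex_eq_iff)
      then have "Re (c xi) = 0" "Im (c xi) = 0"
        using q[unfolded qnn_lin_indep_def, rule_format, of "\<lambda>xi. Re (c xi)" xi]
          q[unfolded qnn_lin_indep_def, rule_format, of "\<lambda>xi. Im (c xi)" xi] xi by simp_all
      then show "c xi = 0" by (simp add: complex_eq_iff)
    qed
  next
    assume ind: "fam_indep ?X ?E ?v"
    show "qnn_lin_indep d p Hs M"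
      unfolding qnn_lin_indep_def
    proof (intro allI impI ballI)
      fix r xi assume r: "\<forall>i<d. \<forall>j<d. (\<Sum>xi\<in>?X. complex_of_real (r xi) * ?F xi $$ (i,j)) = 0" and xi: "xi \<in> ?X"
      have "\<forall>e\<in>?E. (\<Sum>xi\<in>?X. complex_of_real (r xi) * ?v xi e) = 0"
        unfolding comp using r unfolding real by (simp add: complex_eq_iff)
      then have "complex_of_real (r xi) = 0"
        using ind[unfolded fam_indep_def, rule_format, of "\<lambda>xi. complex_of_real (r xi)" xi] xi by blast
      then show "r xi = 0" by simp
    qed
  qed
qed

lemma qnn_lin_indep_if_mindep:
  assumes "mindep d (xi_set p) (\<lambda>xi. Phi_xi Hs xi p M)"
  shows "qnn_lin_indep d p Hs M"
  unfolding qnn_lin_indep_def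
proof (intro allI impI ballI)
  fix c xi assume "\<forall>i<d. \<forall>j<d. (\<Sum>xi\<in>xi_set p. complex_of_real (c xi) * Phi_xi Hs xi p M $$ (i,j)) = 0"
    and xi: "xi \<in> xi_set p"
  then have "lincomb d (xi_set p) (\<lambda>xi. complex_of_real (c xi)) (\<lambda>xi. Phi_xi Hs xi p M) = 0\<^sub>m d d"
    by (intro eq_matI) auto
  then have "complex_of_real (c xi) = 0"
    using assms xi unfolding mindep_iff by (auto dest: spec[of _ "\<lambda>xi. complex_of_real (c xi)"])
  then show "c xi = 0" by simp
qed

text \<open>The construction starts from the single matrix \<open>M\<close> with index zero, which
  is independent because it is nonzero. It yields complex independence of all \<open>3 ^ p\<close>
  matrices, and the claim follows by passing to the nonzero indices and to real
  coefficients.\<close>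

lemma exists_acts_qnn_lin_indep:
  assumes H: "H \<in> carrier_mat d d" "H * H = 1\<^sub>m d" "tr H = 0"
    and M: "M \<in> carrier_mat d d" "M \<noteq> 0\<^sub>m d d" "tr M = 0"
    and big: "4 * 3 ^ p < d" and W: "\<And>l. l \<in> {1..p} \<Longrightarrow> unitary_mat d (W l)"
  shows "\<exists>u\<in>words d p. qnn_lin_indep d p (\<lambda>l. acts d u W l * H * adj (acts d u W l)) M"
proof -
  have "\<exists>u\<in>words d p. mindep d (extensions p {\<lambda>_. 0})
      (\<lambda>xi. Phi_xi (\<lambda>l. acts d u W l * H * adj (acts d u W l)) xi p M)"
    by (rule exists_acts_Phi_xi_indep[OF H, where A = "\<lambda>_. M"])
      (use M mindep_singleton[OF M(1,2)] big W in simp_all)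
  then obtain u where u: "u \<in> words d p" "mindep d (extensions p {\<lambda>_. 0})
      (\<lambda>xi. Phi_xi (\<lambda>l. acts d u W l * H * adj (acts d u W l)) xi p M)"
    by (elim bexE)
  have "mindep d (xi_set p) (\<lambda>xi. Phi_xi (\<lambda>l. acts d u W l * H * adj (acts d u W l)) xi p M)"
    using fam_indep_mono[OF u(2)[unfolded mindep_def], of "xi_set p"] xi_set_subset[of p] finite_xi_box[of p]
    by (simp add: mindep_def extensions_zero)
  then show ?thesis using u(1) qnn_lin_indep_if_mindep by blast
qed

section \<open>The zero-one law for Haar measure\<close>

lemma (in function_algebra) re_im_Phi_xi:
  assumes V: "\<And>l. l \<in> {1..p} \<Longrightarrow> cmat d d (V l)" and H: "H \<in> carrier_mat d d" and M: "M \<in> carrier_mat d d"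
    and e: "e \<in> ({..<d} \<times> {..<d}) \<times> UNIV"
  shows "C (\<lambda>x. re_im (Phi_xi (\<lambda>l. V l x * H * adj (V l x)) xi p M) e)"
proof -
  obtain i j b where ij: "e = ((i,j),b)" "i < d" "j < d" using e by auto
  have "cmat d d (\<lambda>x. V l x * H * adj (V l x))" if "l \<in> {1..p}" for l
    by (rule cmat_mult[OF cmat_mult[OF V[OF that] cmat_const[OF H]] cmat_adj[OF V[OF that]]])
  then have "cmat d d (\<lambda>x. Phi_xi (\<lambda>l. V l x * H * adj (V l x)) xi p M)"
    by (intro cmat_Phi_xi[where K = "\<lambda>l x. V l x * H * adj (V l x)"] cmat_const M)
  from cmatD[OF this ij(2,3)] show ?thesis
    using of_real_Re of_real_Im by (cases b) (simp_all add: re_im_def ij)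
qed

lemma laurent_acts:
  "u \<in> words d p \<Longrightarrow> (\<And>l. l \<in> {1..p} \<Longrightarrow> laurent.cmat d d (\<lambda>z. F z l)) \<Longrightarrow> l \<in> {1..p} \<Longrightarrow>
    laurent.cmat d d (\<lambda>z. acts d u (F z) l)"
proof (induction u arbitrary: F)
  case (Cons a u)
  obtain k v y where a: "a = ((k,v),y)" by (metis surj_pair)
  have u: "u \<in> words d p" using Cons.prems(1) by (simp add: words_def)
  have "laurent.cmat d d (\<lambda>z. act d (k,v) y (F z) m)" if "m \<in> {1..p}" for m
    using laurent.cmat_mult[OF laurent.cmat_const[OF rot_carrier(1)] Cons.prems(2)[OF that]] Cons.prems(2)[OF that]
    by (cases "m = k") (simp_all add: act_simps)
  from Cons.IH[OF u this Cons.prems(3)] show ?case by (simp add: a acts_simps)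
qed (simp add: acts_simps)

lemma countable_words_gens: "countable (lists (gens d p))"
  by (intro countable_lists countable_finite) (simp add: gens_def finite_axes)

locale haar_tuples =
  fixes d p :: nat and \<mu> :: "complex mat measure"
  assumes haar: "is_haar d \<mu>"
begin

declare One_nat_def[simp del]

abbreviation \<Omega> :: "(nat \<Rightarrow> complex mat) measure" where
  "\<Omega> \<equiv> PiM {1..p} (\<lambda>_. \<mu>)"

lemma prob_space_mu: "prob_space \<mu>" and sets_mu: "sets \<mu> = sets (mat_space d)"
  and space_mu: "space \<mu> = carrier_mat d d"
  using haar by (auto simp: is_haar_def)

lemma prob_space_Omega: "prob_space \<Omega>"
  by (intro prob_space_PiM prob_space_mu)

lemma space_OmegaD: "W \<in> space \<Omega> \<Longrightarrow> l \<in> {1..p} \<Longrightarrow> W l \<in> carrier_mat d d"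
  by (auto simp: space_PiM PiE_iff space_mu)

lemma entry_measurable:
  assumes "i < d" "j < d"
  shows "(\<lambda>A. A $$ (i,j)) \<in> borel_measurable \<mu>"
proof -
  have "mat_entries d \<in> measurable (mat_space d) borel"
    unfolding mat_space_def by (rule measurable_vimage_algebra1) simp
  then have "(\<lambda>A. mat_entries d A (i,j)) \<in> borel_measurable (mat_space d)"
    by (rule measurable_compose[OF _ measurable_product_coordinates])
  then show ?thesis
    using assms by (simp add: mat_entries_def measurable_cong_sets[OF sets_mu refl])
qed

lemma mult_measurable:
  assumes V: "V \<in> carrier_mat d d"
  shows "(\<lambda>W. V * W) \<in> measurable \<mu> \<mu>"
proof -
  have "(\<lambda>W. V * W) \<in> measurable \<mu> (mat_space d)"
    unfolding mat_space_def
  proof (rule measurable_vimage_algebra2)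
    show "(\<lambda>W. V * W) \<in> space \<mu> \<rightarrow> carrier_mat d d" using V by (auto simp: space_mu)
    show "(\<lambda>W. mat_entries d (V * W)) \<in> borel_measurable \<mu>"
    proof (rule measurable_coordinatewise_then_product)
      fix e :: "nat \<times> nat"
      obtain i j where e: "e = (i,j)" by fastforce
      show "(\<lambda>W. mat_entries d (V * W) e) \<in> borel_measurable \<mu>"
      proof (cases "i < d \<and> j < d")
        case True
        have "(\<lambda>W. \<Sum>l\<in>{..<d}. V $$ (i,l) * W $$ (l,j)) \<in> borel_measurable \<mu>"
          using True by (intro borel_measurable_sum borel_measurable_times borel_measurable_const entry_measurable) auto
        moreover have "mat_entries d (V * W) e = (\<Sum>l\<in>{..<d}. V $$ (i,l) * W $$ (l,j))" if "W \<in> space \<mu>" for W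
          using True that mat_mult_index[OF V, of W d i j] by (simp add: mat_entries_def e space_mu)
        ultimately show ?thesis by (simp cong: measurable_cong)
      next
        case False
        then have "mat_entries d (V * W) e = 0" for W by (auto simp: mat_entries_def e)
        then show ?thesis by simp
      qed
    qed
  qed
  then show ?thesis by (simp add: measurable_cong_sets[OF refl sets_mu])
qed

lemma distr_mult:
  assumes "unitary_mat d V"
  shows "distr \<mu> \<mu> (\<lambda>W. V * W) = \<mu>"
proof -
  have "distr \<mu> \<mu> (\<lambda>W. V * W) = distr \<mu> (mat_space d) (\<lambda>W. V * W)"
    by (rule distr_cong) (simp_all add: sets_mu)
  then show ?thesis using haar assms by (simp add: is_haar_def)
qed

lemma act_measurable:
  assumes "g \<in> gens d p"
  shows "act d g z \<in> measurable \<Omega> \<Omega>"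
proof -
  have g: "fst g \<in> {1..p}" using assms by (auto simp: gens_def)
  have "(\<lambda>W. rot d (snd g) z * W (fst g)) \<in> measurable \<Omega> \<mu>"
    by (rule measurable_compose[OF measurable_component_singleton[OF g] mult_measurable]) simp
  then show ?thesis
    unfolding act_def[abs_def]
    by (intro measurable_fun_upd[where J = "{1..p}"]) (use g in auto)
qed

lemma act_space: "g \<in> gens d p \<Longrightarrow> W \<in> space \<Omega> \<Longrightarrow> act d g z W \<in> space \<Omega>"
  using act_measurable by (rule measurable_space)

lemma acts_space: "u \<in> words d p \<Longrightarrow> W \<in> space \<Omega> \<Longrightarrow> acts d u W \<in> space \<Omega>"
proof (induction u arbitrary: W)
  case (Cons a u)
  obtain g z where a: "a = (g,z)" by fastforce
  then have "g \<in> gens d p" "u \<in> words d p" using Cons.prems by (auto simp: words_def)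
  then show ?case using Cons.IH[OF _ act_space[OF _ Cons.prems(2)]] by (simp add: a acts_simps)
qed (simp add: acts_simps)

text \<open>The rotation of one coordinate pulls a box back to a box whose factors have the same
  measures, and the product measure is determined by its values on boxes.\<close>

lemma distr_act:
  assumes g: "g \<in> gens d p" and z: "z \<in> sphere 0 1"
  shows "distr \<Omega> \<Omega> (act d g z) = \<Omega>"
proof -
  interpret prob_space \<mu> by (rule prob_space_mu)
  interpret product_sigma_finite "\<lambda>_ :: nat. \<mu>" by unfold_locales
  define l where "l = fst g"
  define V where "V = rot d (snd g) z"
  have l: "l \<in> {1..p}" and V: "unitary_mat d V"
    using g unitary_rot[OF _ z] by (auto simp: l_def V_def gens_def)
  have act: "act d g z W = W(l := V * W l)" for W by (simp add: act_def l_def V_def)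
  note mV = mult_measurable[OF unitary_matD(1)[OF V]]
  show ?thesis
  proof (rule PiM_eqI)
    fix A :: "nat \<Rightarrow> complex mat set" assume A: "\<And>i. i \<in> {1..p} \<Longrightarrow> A i \<in> sets \<mu>"
    define B where "B = A(l := (\<lambda>W. V * W) -` A l \<inter> space \<mu>)"
    have B: "B i \<in> sets \<mu>" if "i \<in> {1..p}" for i
      using A[OF that] measurable_sets[OF mV A[OF l]] by (simp add: B_def)
    have "act d g z -` (Pi\<^sub>E {1..p} A) \<inter> space \<Omega> = Pi\<^sub>E {1..p} B"
    proof (intro equalityI subsetI)
      fix W assume W: "W \<in> act d g z -` (Pi\<^sub>E {1..p} A) \<inter> space \<Omega>"
      then have WA: "W i \<in> space \<mu>" "act d g z W i \<in> A i" if "i \<in> {1..p}" for i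
        using that by (auto simp: space_PiM PiE_iff)
      have "W i \<in> B i" if "i \<in> {1..p}" for i
        using WA[OF that] by (cases "i = l") (simp_all add: B_def act)
      then show "W \<in> Pi\<^sub>E {1..p} B" using W by (auto simp: space_PiM PiE_iff)
    next
      fix W assume W: "W \<in> Pi\<^sub>E {1..p} B"
      then have WB: "W i \<in> B i" if "i \<in> {1..p}" for i using that by auto
      have "W i \<in> space \<mu>" if "i \<in> {1..p}" for i
        using WB[OF that] sets.sets_into_space[OF B[OF that]] by blast
      moreover have "act d g z W i \<in> A i" if "i \<in> {1..p}" for i
        using WB[OF that] by (auto simp: act B_def split: if_splits)
      ultimately show "W \<in> act d g z -` (Pi\<^sub>E {1..p} A) \<inter> space \<Omega>"
        using W l by (auto simp: space_PiM PiE_iff act extensional_def)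
    qed
    then have "emeasure (distr \<Omega> \<Omega> (act d g z)) (Pi\<^sub>E {1..p} A) = emeasure \<Omega> (Pi\<^sub>E {1..p} B)"
      using A by (subst emeasure_distr[OF act_measurable[OF g]]) (auto intro!: sets_PiM_I_finite)
    also have "\<dots> = (\<Prod>i\<in>{1..p}. emeasure \<mu> (B i))" using B by (intro emeasure_PiM) auto
    also have "\<dots> = (\<Prod>i\<in>{1..p}. emeasure \<mu> (A i))"
    proof (rule prod.cong)
      fix i assume i: "i \<in> {1..p}"
      have "emeasure \<mu> (B l) = emeasure (distr \<mu> \<mu> (\<lambda>W. V * W)) (A l)"
        by (simp add: B_def emeasure_distr[OF mV A[OF l]])
      then have "emeasure \<mu> (B l) = emeasure \<mu> (A l)" by (simp only: distr_mult[OF V])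
      then show "emeasure \<mu> (B i) = emeasure \<mu> (A i)" by (cases "i = l") (simp_all add: B_def)
    qed simp
    finally show "emeasure (distr \<Omega> \<Omega> (act d g z)) (Pi\<^sub>E {1..p} A) = (\<Prod>i\<in>{1..p}. emeasure \<mu> (A i))" .
  qed simp_all
qed

text \<open>The word \<open>u\<close> after the varied letter \<open>h\<close> makes the property
  pass on to \<open>stable S g\<close>, since membership there appends one more letter. The empty
  \<open>u\<close> is the case that enters the measure argument.\<close>

definition nice :: "(nat \<Rightarrow> complex mat) set \<Rightarrow> bool" where
  "nice S \<longleftrightarrow> S \<in> sets \<Omega> \<and> (\<forall>u\<in>words d p. \<forall>h\<in>gens d p. \<forall>W\<in>space \<Omega>.
     fin_or_all {z. acts d u (act d h z W) \<in> S})"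

definition stable :: "(nat \<Rightarrow> complex mat) set \<Rightarrow> generator \<Rightarrow> (nat \<Rightarrow> complex mat) set" where
  "stable S g = {W \<in> space \<Omega>. \<forall>z\<in>sphere 0 1. act d g z W \<in> S}"

text \<open>Off \<open>stable S g\<close> only finitely many \<open>z\<close> move a point into \<open>S\<close>. Since all the preimages of \<open>S\<close>
  have the measure of \<open>S\<close>, dominated convergence along a sequence of distinct \<open>z\<close> gives
  \<open>stable S g\<close> the measure of \<open>S\<close> as well.\<close>

lemma stable_nice_AE:
  assumes S: "nice S" and g: "g \<in> gens d p"
  shows "nice (stable S g)" and "AE W in \<Omega>. W \<in> S \<longrightarrow> W \<in> stable S g"
proof -
  interpret prob_space \<Omega> by (rule prob_space_Omega)
  have Sm: "S \<in> sets \<Omega>" using S by (simp add: nice_def)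
  have foa: "fin_or_all {z. act d g z W \<in> S}" if "W \<in> space \<Omega>" for W
  proof -
    have "[] \<in> words d p" by (simp add: words_def)
    then have "fin_or_all {z. acts d [] (act d g z W) \<in> S}" using S g that unfolding nice_def by blast
    then show ?thesis by (simp add: acts_simps)
  qed
  obtain \<zeta> :: "nat \<Rightarrow> complex" where zeta: "inj \<zeta>" "range \<zeta> \<subseteq> sphere 0 1"
    using infinite_countable_subset[OF infinite_circle] by blast
  define T where "T k = act d g (\<zeta> k) -` S \<inter> space \<Omega>" for k
  have Tm: "T k \<in> sets \<Omega>" for k unfolding T_def by (rule measurable_sets[OF act_measurable[OF g] Sm])
  have fin: "finite {k. W \<in> T k}" if W: "W \<in> space \<Omega>" "W \<notin> stable S g" for W
  proof -
    have "finite ({z. act d g z W \<in> S} \<inter> sphere 0 1)"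
      using foa[OF W(1)] W by (auto simp: fin_or_all_def stable_def)
    then have "finite (\<zeta> -` ({z. act d g z W \<in> S} \<inter> sphere 0 1))"
      by (rule finite_vimageI[OF _ zeta(1)])
    then show ?thesis by (rule finite_subset[rotated]) (use zeta in \<open>auto simp: T_def\<close>)
  qed
  have sub: "stable S g \<subseteq> T k" for k using zeta by (auto simp: stable_def T_def)
  \<comment> \<open>A quantifier over the uncountable circle is replaced by a countable one: a point
    lying in every \<open>T k\<close> has infinitely many angles that lead into \<open>S\<close>,
    hence all angles do. This also gives measurability.\<close>
  have stT: "stable S g = (\<Inter>k. T k)"
  proof (intro equalityI subsetI)
    fix W assume W: "W \<in> (\<Inter>k. T k)"
    then have "W \<in> space \<Omega>" "{k. W \<in> T k} = UNIV" by (auto simp: T_def)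
    then show "W \<in> stable S g" using fin[of W] by (metis infinite_UNIV_nat)
  qed (use sub in auto)
  have stm: "stable S g \<in> sets \<Omega>" unfolding stT using Tm by auto
  \<comment> \<open>The angle \<open>z = 1\<close> moves nothing, so a stable point belongs to
    \<open>S\<close> itself.\<close>
  have stS: "stable S g \<subseteq> S"
  proof
    fix W assume W: "W \<in> stable S g"
    then have "act d g 1 W \<in> S" "W \<in> space \<Omega>" by (simp_all add: stable_def)
    moreover have "act d g 1 W = W"
    proof -
      have "W (fst g) \<in> carrier_mat d d"
        using g by (intro space_OmegaD[OF \<open>W \<in> space \<Omega>\<close>]) (auto simp: gens_def)
      then show ?thesis by (simp add: act_def rot_one)
    qed
    ultimately show "W \<in> S" by simp
  qed
  have "measure \<Omega> (T k) = measure \<Omega> S" for k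
  proof -
    have "\<zeta> k \<in> sphere 0 1" using zeta by blast
    then have "measure \<Omega> S = measure (distr \<Omega> \<Omega> (act d g (\<zeta> k))) S" by (simp only: distr_act[OF g])
    then show ?thesis unfolding T_def by (simp only: measure_distr[OF act_measurable[OF g] Sm])
  qed
  moreover have "(\<lambda>k. \<integral>W. indicator (T k) W \<partial>\<Omega>) \<longlonglongrightarrow> (\<integral>W. indicator (stable S g) W \<partial>\<Omega> :: real)"
  proof (rule integral_dominated_convergence[where w = "\<lambda>_. 1"])
    show "AE W in \<Omega>. (\<lambda>k. indicator (T k) W) \<longlonglongrightarrow> (indicator (stable S g) W :: real)"
    proof (rule AE_I2)
      fix W assume W: "W \<in> space \<Omega>"
      show "(\<lambda>k. indicator (T k) W) \<longlonglongrightarrow> (indicator (stable S g) W :: real)"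
      proof (cases "W \<in> stable S g")
        case True
        then have "W \<in> T k" for k using sub by blast
        then show ?thesis using True by simp
      next
        case False
        obtain N where "{k. W \<in> T k} \<subseteq> {..<N}"
          using fin[OF W False] unfolding finite_nat_iff_bounded by blast
        then have "W \<notin> T k" if "k \<ge> N" for k using that by (auto simp: subset_eq)
        then have "\<forall>\<^sub>F k in sequentially. indicator (T k) W = (0 :: real)"
          unfolding eventually_sequentially by (intro exI[of _ N]) simp
        then show ?thesis using False by (simp add: tendsto_eventually)
      qed
    qed
  qed (use stm Tm integrable_const[of "1 :: real"] in \<open>auto simp: indicator_def\<close>)
  moreover have "(\<integral>W. indicator A W \<partial>\<Omega>) = measure \<Omega> A" if "A \<in> sets \<Omega>" for A
    using sets.sets_into_space[OF that] by (simp add: Int_absorb2)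
  ultimately have "(\<lambda>_. measure \<Omega> S) \<longlonglongrightarrow> measure \<Omega> (stable S g)"
    using Tm stm by simp
  from LIMSEQ_unique[OF this tendsto_const] have "measure \<Omega> (stable S g) = measure \<Omega> S" by simp
  then have "measure \<Omega> (S - stable S g) = 0"
    using finite_measure_Diff[OF Sm stm stS] by simp
  then have "emeasure \<Omega> (S - stable S g) = 0" by (simp add: emeasure_eq_measure)
  then show "AE W in \<Omega>. W \<in> S \<longrightarrow> W \<in> stable S g"
    by (intro AE_I[where N = "S - stable S g"]) (use Sm stm in auto)
  show "nice (stable S g)"
    unfolding nice_def
  proof (intro conjI stm ballI)
    fix u h W assume u: "u \<in> words d p" and h: "h \<in> gens d p" and W: "W \<in> space \<Omega>"
    have "{z. acts d u (act d h z W) \<in> stable S g} =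
        (\<Inter>y\<in>sphere 0 1. {z. acts d (u @ [(g,y)]) (act d h z W) \<in> S})"
      using acts_space[OF u act_space[OF h W]] by (auto simp: stable_def acts_append acts_simps)
    moreover have "fin_or_all {z. acts d (u @ [(g,y)]) (act d h z W) \<in> S}" if "y \<in> sphere 0 1" for y
    proof -
      have "u @ [(g,y)] \<in> words d p" using u g that by (simp add: words_def)
      then show ?thesis using S h W unfolding nice_def by blast
    qed
    ultimately show "fin_or_all {z. acts d u (act d h z W) \<in> stable S g}"
      using fin_or_all_INT[of "sphere 0 1" "\<lambda>y. {z. acts d (u @ [(g,y)]) (act d h z W) \<in> S}"] by simp
  qed
qed

text \<open>The last generator is absorbed into \<open>stable S g\<close>, which is again nice and
  already quantifies over all angles. One null set therefore serves all words with the given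
  sequence of generators.\<close>

lemma AE_acts_word:
  "w \<in> lists (gens d p) \<Longrightarrow> nice S \<Longrightarrow>
    AE W in \<Omega>. W \<in> S \<longrightarrow> (\<forall>u\<in>words d p. map fst u = w \<longrightarrow> acts d u W \<in> S)"
proof (induction w arbitrary: S rule: rev_induct)
  case Nil
  then show ?case by (simp add: acts_simps)
next
  case (snoc g w)
  have g: "g \<in> gens d p" and w: "w \<in> lists (gens d p)" using snoc.prems(1) by auto
  note st = stable_nice_AE[OF snoc.prems(2) g]
  have "AE W in \<Omega>. W \<in> stable S g \<longrightarrow> (\<forall>u\<in>words d p. map fst u = w \<longrightarrow> acts d u W \<in> stable S g)"
    by (rule snoc.IH[OF w st(1)])
  then show ?case using st(2)
  proof eventually_elim
    case (elim W)
    show ?case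
    proof (intro impI ballI)
      fix u assume S: "W \<in> S" and u: "u \<in> words d p" "map fst u = w @ [g]"
      obtain u' z where u': "u = u' @ [(g,z)]" "map fst u' = w"
        using u(2) by (cases u rule: rev_cases) auto
      then have "u' \<in> words d p" "z \<in> sphere 0 1" using u(1) by (auto simp: words_def)
      then have "act d g z (acts d u' W) \<in> S" using elim S u'(2) by (auto simp: stable_def)
      then show "acts d u W \<in> S" by (simp add: u' acts_append acts_simps)
    qed
  qed
qed

lemma AE_acts:
  assumes "nice S"
  shows "AE W in \<Omega>. W \<in> S \<longrightarrow> (\<forall>u\<in>words d p. acts d u W \<in> S)"
proof -
  have "AE W in \<Omega>. \<forall>w\<in>lists (gens d p). W \<in> S \<longrightarrow> (\<forall>u\<in>words d p. map fst u = w \<longrightarrow> acts d u W \<in> S)"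
    unfolding AE_ball_countable[OF countable_words_gens] using AE_acts_word[OF _ assms] by blast
  then show ?thesis
  proof eventually_elim
    case (elim W)
    have "map fst u \<in> lists (gens d p)" if "u \<in> words d p" for u
      using that unfolding words_def lists_eq_set by fastforce
    then show ?case using elim by blast
  qed
qed

lemma AE_unitary: "AE W in \<Omega>. \<forall>l\<in>{1..p}. unitary_mat d (W l)"
proof -
  interpret prob_space \<mu> by (rule prob_space_mu)
  have "AE U in \<mu>. U \<in> {U \<in> carrier_mat d d. unitary_mat d U}"
    using haar by (intro AE_in_set_eq_1[THEN iffD2]) (auto simp: is_haar_def emeasure_eq_measure)
  then have "AE U in \<mu>. unitary_mat d U" by eventually_elim simp
  then show ?thesis
    by (intro eventually_ball_finite ballI AE_PiM_component prob_space_mu) auto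
qed

section \<open>The set of dependent tuples\<close>

definition dependent_tuples :: "complex mat \<Rightarrow> complex mat \<Rightarrow> (nat \<Rightarrow> complex mat) set" where
  "dependent_tuples H M = {W \<in> space \<Omega>. \<not> qnn_lin_indep d p (\<lambda>l. W l * H * adj (W l)) M}"

text \<open>The Gram determinant is used in two function algebras: over the measurable functions it
  shows that the set is measurable, over the Laurent polynomials it gives the dichotomy in the angle
  of a letter.\<close>

lemma nice_dependent_tuples:
  assumes H: "H \<in> carrier_mat d d" and M: "M \<in> carrier_mat d d"
  shows "nice (dependent_tuples H M)"
  unfolding nice_def
proof (intro conjI ballI)
  interpret meas: function_algebra "\<lambda>f. f \<in> borel_measurable \<Omega>"
    by unfold_locales (auto intro: borel_measurable_continuous_on[of cnj] continuous_intros)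
  let ?X = "xi_set p" and ?E = "({..<d} \<times> {..<d}) \<times> (UNIV :: bool set)"
  have fin: "finite ?X" "finite ?E" by (simp_all add: finite_xi_set)
  \<comment> \<open>The default value off the sample space only makes every tuple consist of \<open>d \<times> d\<close> matrices.\<close>
  define V where "V l W = (if W \<in> space \<Omega> then W l else 0\<^sub>m d d)" for l :: nat and W
  have V: "meas.cmat d d (V l)" if l: "l \<in> {1..p}" for l
    unfolding meas.cmat_def
  proof (intro conjI allI impI)
    show "V l W \<in> carrier_mat d d" for W using space_OmegaD[OF _ l] by (simp add: V_def)
    fix i j assume ij: "i < d" "j < d"
    have "(\<lambda>W. W l $$ (i,j)) \<in> borel_measurable \<Omega>"
      by (rule measurable_compose[OF measurable_component_singleton[OF l] entry_measurable[OF ij]])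
    then show "(\<lambda>W. V l W $$ (i,j)) \<in> borel_measurable \<Omega>"
      by (rule measurable_cong[THEN iffD1, rotated]) (simp add: V_def)
  qed
  have C: "(\<lambda>W. re_im (Phi_xi (\<lambda>l. V l W * H * adj (V l W)) xi p M) e) \<in> borel_measurable \<Omega>"
    if "e \<in> ?E" for xi e by (rule meas.re_im_Phi_xi[OF V H M that])
  let ?v = "\<lambda>W xi. re_im (Phi_xi (\<lambda>l. V l W * H * adj (V l W)) xi p M)"
  have "\<exists>f. f \<in> borel_measurable \<Omega> \<and> (\<forall>W. fam_indep ?X ?E (?v W) \<longleftrightarrow> f W \<noteq> (0 :: complex))"
    by (rule meas.fam_indep_witness[OF fin]) (rule C)
  then obtain f :: "(nat \<Rightarrow> complex mat) \<Rightarrow> complex"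
    where f: "f \<in> borel_measurable \<Omega>" "\<forall>W. fam_indep ?X ?E (?v W) \<longleftrightarrow> f W \<noteq> 0"
    by (elim exE conjE)
  have "dependent_tuples H M = {W \<in> space \<Omega>. f W = 0}"
    unfolding dependent_tuples_def
  proof (rule Collect_cong, rule conj_cong[OF refl])
    fix W assume "W \<in> space \<Omega>"
    then show "(\<not> qnn_lin_indep d p (\<lambda>l. W l * H * adj (W l)) M) = (f W = 0)"
      using spec[OF f(2), of W] by (simp add: qnn_lin_indep_iff V_def)
  qed
  then show "dependent_tuples H M \<in> sets \<Omega>" using f(1) by simp
  fix u h W assume u: "u \<in> words d p" and h: "h \<in> gens d p" and W: "W \<in> space \<Omega>"
  obtain k v where kv: "h = (k,v)" by fastforce
  have act: "laurent.cmat d d (\<lambda>z. act d h z W l)" if l: "l \<in> {1..p}" for l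
    using laurent.cmat_mult[OF cmat_rot laurent.cmat_const[OF space_OmegaD[OF W l]]]
      laurent.cmat_const[OF space_OmegaD[OF W l]]
    by (cases "l = k") (simp_all add: kv act_simps)
  have L: "laurent.cmat d d (\<lambda>z. acts d u (act d h z W) l)" if "l \<in> {1..p}" for l
    by (rule laurent_acts[OF u act that])
  have "fin_or_all {z. \<not> fam_indep ?X ?E (\<lambda>xi. re_im (Phi_xi (\<lambda>l. acts d u (act d h z W) l * H *
      adj (acts d u (act d h z W) l)) xi p M))}"
    by (rule laurent_dependent[OF fin])
      (rule laurent.re_im_Phi_xi[where V = "\<lambda>l z. acts d u (act d h z W) l", OF L H M])
  then show "fin_or_all {z. acts d u (act d h z W) \<in> dependent_tuples H M}"
    using acts_space[OF u act_space[OF h W]] by (simp add: dependent_tuples_def qnn_lin_indep_iff)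
qed

lemma prob_lin_indep_eq_1:
  assumes H: "H \<in> carrier_mat d d" "H * H = 1\<^sub>m d" "tr H = 0"
    and M: "M \<in> carrier_mat d d" "M \<noteq> 0\<^sub>m d d" "tr M = 0" and big: "4 * 3 ^ p < d"
  shows "prob_lin_indep d \<mu> p H M = 1"
proof -
  interpret prob_space \<Omega> by (rule prob_space_Omega)
  let ?G = "{W \<in> space \<Omega>. qnn_lin_indep d p (\<lambda>l. W l * H * adj (W l)) M}"
  note nice = nice_dependent_tuples[OF H(1) M(1)]
  have AE: "AE W in \<Omega>. W \<in> ?G"
    using AE_acts[OF nice] AE_unitary AE_space
  proof eventually_elim
    case (elim W)
    have "\<exists>u\<in>words d p. qnn_lin_indep d p (\<lambda>l. acts d u W l * H * adj (acts d u W l)) M"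
      by (rule exists_acts_qnn_lin_indep[OF H M big]) (use elim(2) in blast)
    then have "W \<notin> dependent_tuples H M" using elim(1) by (auto simp: dependent_tuples_def)
    then show ?case using elim(3) by (simp add: dependent_tuples_def)
  qed
  have "?G = space \<Omega> - dependent_tuples H M" by (auto simp: dependent_tuples_def)
  moreover have "dependent_tuples H M \<in> sets \<Omega>" using nice unfolding nice_def by blast
  ultimately have "?G \<in> sets \<Omega>" using sets.compl_sets by simp
  then have "measure \<Omega> ?G = 1" using AE by (simp only: prob_eq_1)
  then show ?thesis by (simp add: prob_lin_indep_def)
qed

end

section \<open>The two quantitative bounds\<close>

lemma prob_lin_indep_if_large:
  assumes "is_haar d \<mu>" "hermitian_mat d H" "tr H = 0" "H * H = 1\<^sub>m d"
    "hermitian_mat d M" "M \<noteq> 0\<^sub>m d d" "tr M = 0" "4 * 3 ^ p < d"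
  shows "prob_lin_indep d \<mu> p H M = 1"
  by (rule haar_tuples.prob_lin_indep_eq_1) (use assms in \<open>auto simp: haar_tuples_def hermitian_mat_def\<close>)

lemma prob_lin_indep_nonneg: "prob_lin_indep d \<mu> p H M \<ge> 0"
  by (simp add: prob_lin_indep_def)

theorem theorem2:
  shows
  "(\<forall>p::nat. \<exists>C::real. \<forall>d::nat. \<forall>\<mu> H M. d \<ge> 1 \<longrightarrow> is_haar d \<mu> \<longrightarrow>
      hermitian_mat d H \<longrightarrow> tr H = 0 \<longrightarrow> H * H = 1\<^sub>m d \<longrightarrow>
      hermitian_mat d M \<longrightarrow> M \<noteq> 0\<^sub>m d d \<longrightarrow> tr M = 0 \<longrightarrow>
      prob_lin_indep d \<mu> p H M \<ge> 1 - C / real d)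
 \<and> (\<exists>c1>0. \<forall>c2\<ge>c1. \<exists>C::real. \<forall>p::nat. \<forall>d::nat. \<forall>\<mu> H M. d \<ge> 1 \<longrightarrow>
      c1 * real p \<le> ln (real d) \<longrightarrow> ln (real d) \<le> c2 * real p \<longrightarrow> is_haar d \<mu> \<longrightarrow>
      hermitian_mat d H \<longrightarrow> tr H = 0 \<longrightarrow> H * H = 1\<^sub>m d \<longrightarrow>
      hermitian_mat d M \<longrightarrow> M \<noteq> 0\<^sub>m d d \<longrightarrow> tr M = 0 \<longrightarrow>
      prob_lin_indep d \<mu> p H M \<ge> 1 - C * exp (- real p))"
proof (intro conjI)
  show "\<forall>p::nat. \<exists>C::real. \<forall>d::nat. \<forall>\<mu> H M. d \<ge> 1 \<longrightarrow> is_haar d \<mu> \<longrightarrow>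
      hermitian_mat d H \<longrightarrow> tr H = 0 \<longrightarrow> H * H = 1\<^sub>m d \<longrightarrow>
      hermitian_mat d M \<longrightarrow> M \<noteq> 0\<^sub>m d d \<longrightarrow> tr M = 0 \<longrightarrow>
      prob_lin_indep d \<mu> p H M \<ge> 1 - C / real d"
  proof (rule allI)
    fix p :: nat
    show "\<exists>C::real. \<forall>d::nat. \<forall>\<mu> H M. d \<ge> 1 \<longrightarrow> is_haar d \<mu> \<longrightarrow>
      hermitian_mat d H \<longrightarrow> tr H = 0 \<longrightarrow> H * H = 1\<^sub>m d \<longrightarrow>
      hermitian_mat d M \<longrightarrow> M \<noteq> 0\<^sub>m d d \<longrightarrow> tr M = 0 \<longrightarrow>
      prob_lin_indep d \<mu> p H M \<ge> 1 - C / real d"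
    \<comment> \<open>With this constant the lower bound is positive only if
      \<open>d > 4 * 3 ^ p\<close>, and there the probability is 1.\<close>
    proof (intro allI exI[of _ "4 * 3 ^ p"] impI)
      fix d :: nat and \<mu> H M
      assume d: "d \<ge> 1" and as: "is_haar d \<mu>" "hermitian_mat d H" "tr H = 0" "H * H = 1\<^sub>m d"
        "hermitian_mat d M" "M \<noteq> 0\<^sub>m d d" "tr M = 0"
      show "prob_lin_indep d \<mu> p H M \<ge> 1 - (4 * 3 ^ p) / real d"
      proof (cases "4 * 3 ^ p < d")
        case True
        then show ?thesis using prob_lin_indep_if_large[OF as True] by simp
      next
        case False
        then have "real d \<le> real (4 * 3 ^ p)" by (simp only: of_nat_le_iff not_less)
        then have "1 - (4 * 3 ^ p) / real d \<le> 0" using d by (simp add: field_simps)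
        then show ?thesis using prob_lin_indep_nonneg[of d \<mu> p H M] by linarith
      qed
    qed
  qed
next
  show "\<exists>c1>0. \<forall>c2\<ge>c1. \<exists>C::real. \<forall>p::nat. \<forall>d::nat. \<forall>\<mu> H M. d \<ge> 1 \<longrightarrow>
      c1 * real p \<le> ln (real d) \<longrightarrow> ln (real d) \<le> c2 * real p \<longrightarrow> is_haar d \<mu> \<longrightarrow>
      hermitian_mat d H \<longrightarrow> tr H = 0 \<longrightarrow> H * H = 1\<^sub>m d \<longrightarrow>
      hermitian_mat d M \<longrightarrow> M \<noteq> 0\<^sub>m d d \<longrightarrow> tr M = 0 \<longrightarrow>
      prob_lin_indep d \<mu> p H M \<ge> 1 - C * exp (- real p)"
  \<comment> \<open>The constant \<open>ln 16\<close> yields \<open>16 ^ p \<le> d\<close>, and for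
    \<open>p \<ge> 1\<close> one has \<open>4 * 3 ^ p \<le> 12 ^ p < 16 ^ p\<close>. For
    \<open>p = 0\<close> the constant \<open>C = 1\<close> makes the lower bound 0.\<close>
  proof (rule exI[of _ "ln 16"], intro conjI allI impI exI[of _ "1 :: real"])
    fix c2 :: real and p d :: nat and \<mu> H M
    assume d: "d \<ge> 1" and ln: "ln 16 * real p \<le> ln (real d)"
      and as: "is_haar d \<mu>" "hermitian_mat d H" "tr H = 0" "H * H = 1\<^sub>m d"
      "hermitian_mat d M" "M \<noteq> 0\<^sub>m d d" "tr M = 0"
    show "prob_lin_indep d \<mu> p H M \<ge> 1 - 1 * exp (- real p)"
    proof (cases "p = 0")
      case True
      then show ?thesis using prob_lin_indep_nonneg[of d \<mu> p H M] by simp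
    next
      case False
      have "ln (16 ^ p) = ln 16 * real p" by (simp add: ln_realpow mult.commute)
      then have "ln (16 ^ p :: real) \<le> ln (real d)" using ln by simp
      then have "(16 :: real) ^ p \<le> real d" using d by (subst (asm) ln_le_cancel_iff) simp_all
      then have "real (16 ^ p) \<le> real d" by simp
      then have le: "16 ^ p \<le> d" by (simp only: of_nat_le_iff)
      have "(4 :: nat) * 3 ^ p \<le> 4 ^ p * 3 ^ p"
        using False by (intro mult_right_mono) (simp_all add: self_le_power)
      also have "\<dots> = 12 ^ p" by (simp flip: power_mult_distrib)
      also have "\<dots> < 16 ^ p" using False by (intro power_strict_mono) simp_all
      finally have "4 * 3 ^ p < d" using le by linarith
      then show ?thesis using prob_lin_indep_if_large[OF as] by simp
    qed
  qed simp
qed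

end
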